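(* Every normalized complete Pick space $\mathcal{H}$ satisfies the column-row property with constant $1$. That is, whenever $(\varphi_n)_{n=1}^\infty$ is a sequence in $\operatorname{Mult}(\mathcal{H})$ such that the column operator $$\begin{bmatrix} M_{\varphi_1} \\ M_{\varphi_2} \\ \vdots \end{bmatrix} : \mathcal{H} \to \mathcal{H}\otimes \ell^2,\quad f \mapsto (\varphi_n f)_{n},$$ is bounded with norm at most $1$, then the row operator $$\begin{bmatrix} M_{\varphi_1} & M_{\varphi_2} & \cdots \end{bmatrix} : \mathcal{H}\otimes \ell^2 \to \mathcal{H},\quad (f_n)_n \mapsto \sum_{n} \varphi_n f_n,$$ is bounded with norm at most $1$.
   Context: All reproducing kernel Hilbert spaces (RKHS) consist of complex-valued functions on a set $X$ and are assumed separable. For an RKHS $\mathcal{H}$, $\operatorname{Mult}(\mathcal{H})$ is the algebra of functions $\varphi: X\to\mathbb{C}$ with $\varphi f\in\mathcal{H}$ for all $f\in\mathcal{H}$; $M_\varphi$ is the (automatically bounded) multiplication operator. $\mathcal{H}\otimes\ell^2$ is identified with the space of square-summable sequences in $\mathcal{H}$. Normalized complete Pick space: an RKHS $\mathcal{H}$ on $X$ with kernel $K$ such that there is $z_0\in X$ with $K(z,z_0)=1$ for all $z\in X$ ("normalized at $z_0$"), and $\mathcal{H}$ has the complete Pick property: for every finite $Y\subset X$ and all $M,N\in\mathbb{N}$, the restriction map from $N\times M$ matrices of multipliers of $\mathcal{H}$ to $N\times M$ matrices of multipliers of $\mathcal{H}|_Y$ (the RKHS on $Y$ with kernel $K|_{Y\times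 Y}$) maps the closed unit ball onto the closed unit ball, where matrices carry the operator norm of the induced multiplication operator. Equivalently (Agler--McCarthy, McCullough, Quiggin), there are $d\in\mathbb{N}\cup\{\infty\}$ and a function $b:X\to\mathbb{B}_d$ with $b(z_0)=0$ and $K(z,w)=\frac{1}{1-\langle b(z),b(w)\rangle}$ for all $z,w \in X$, where $\mathbb{B}_d$ is the open unit ball of $\mathbb{C}^d$ (of $\ell^2$ if $d=\infty$). Either description may be taken as the definition. *)

theory Defs
  imports Complex_Main "HOL-Library.Countable_Set" "HOL-Library.Extended_Nat"
begin

text \<open>
  The set on which the functions live is the type \<open>'x\<close>. A Hilbert space of functions on it is given by
  its carrier \<open>H\<close> and an inner product \<open>ip\<close>, linear in the first argument; the values of \<open>ip\<close> outside
  \<open>H\<close> are irrelevant.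
\<close>

type_synonym 'x inner_prod = "('x \<Rightarrow> complex) \<Rightarrow> ('x \<Rightarrow> complex) \<Rightarrow> complex"

definition hnorm :: "'x inner_prod \<Rightarrow> ('x \<Rightarrow> complex) \<Rightarrow> real" where
  "hnorm ip f = sqrt (Re (ip f f))"

definition hdist :: "'x inner_prod \<Rightarrow> ('x \<Rightarrow> complex) \<Rightarrow> ('x \<Rightarrow> complex) \<Rightarrow> real" where
  "hdist ip f g = hnorm ip (\<lambda>x. f x - g x)"

locale rkhs =
  fixes H :: "('x \<Rightarrow> complex) set" and ip :: "'x inner_prod"
  assumes zero_mem: "(\<lambda>x. 0) \<in> H"
    and add_mem: "\<lbrakk>f \<in> H; g \<in> H\<rbrakk> \<Longrightarrow> (\<lambda>x. f x + g x) \<in> H"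
    and scale_mem: "f \<in> H \<Longrightarrow> (\<lambda>x. c * f x) \<in> H"
    and ip_add: "\<lbrakk>f \<in> H; g \<in> H; h \<in> H\<rbrakk> \<Longrightarrow> ip (\<lambda>x. f x + g x) h = ip f h + ip g h"
    and ip_scale: "\<lbrakk>f \<in> H; h \<in> H\<rbrakk> \<Longrightarrow> ip (\<lambda>x. c * f x) h = c * ip f h"
    and ip_cnj: "\<lbrakk>f \<in> H; g \<in> H\<rbrakk> \<Longrightarrow> ip g f = cnj (ip f g)"
    and ip_nonneg: "f \<in> H \<Longrightarrow> 0 \<le> Re (ip f f)"
    and ip_definite: "\<lbrakk>f \<in> H; ip f f = 0\<rbrakk> \<Longrightarrow> f = (\<lambda>x. 0)"
    and complete: "\<lbrakk>\<And>n. F n \<in> H; \<And>e. e > 0 \<Longrightarrow> \<exists>N. \<forall>m\<ge>N. \<forall>n\<ge>N. hdist ip (F m) (F n) < e\<rbrakk>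
        \<Longrightarrow> \<exists>f\<in>H. (\<lambda>n. hdist ip (F n) f) \<longlonglongrightarrow> 0"
    and separable: "\<exists>D\<subseteq>H. countable D \<and> (\<forall>f\<in>H. \<forall>e>0. \<exists>g\<in>D. hdist ip f g < e)"
    and bounded_evaluation: "\<exists>C. \<forall>f\<in>H. cmod (f x) \<le> C * hnorm ip f"

definition reproducing_kernel ::
    "('x \<Rightarrow> complex) set \<Rightarrow> 'x inner_prod \<Rightarrow> ('x \<Rightarrow> 'x \<Rightarrow> complex) \<Rightarrow> bool" where
  "reproducing_kernel H ip K \<longleftrightarrow>
     (\<forall>w. (\<lambda>z. K z w) \<in> H \<and> (\<forall>f\<in>H. f w = ip f (\<lambda>z. K z w)))"

text \<open>
  The open unit ball of \<open>\<complex>\<^sup>d\<close>, or of \<open>\<ell>\<^sup>2\<close> if \<open>d = \<infinity>\<close>. A vector of \<open>\<complex>\<^sup>d\<close> is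
  a sequence vanishing from index \<open>d\<close> on.
\<close>

definition unit_ball :: "enat \<Rightarrow> (nat \<Rightarrow> complex) set" where
  "unit_ball d = {a. (\<forall>n. d \<le> enat n \<longrightarrow> a n = 0) \<and>
     summable (\<lambda>n. (cmod (a n))\<^sup>2) \<and> (\<Sum>n. (cmod (a n))\<^sup>2) < 1}"

definition seq_inner :: "(nat \<Rightarrow> complex) \<Rightarrow> (nat \<Rightarrow> complex) \<Rightarrow> complex" where
  "seq_inner a b = (\<Sum>n. a n * cnj (b n))"

text \<open>
  The complete Pick property is taken in the form of the theorem of Agler--McCarthy, McCullough and
  Quiggin: the kernel is \<open>1 / (1 - \<langle>b z, b w\<rangle>)\<close> for a map \<open>b\<close> into a unit ball.
\<close>

definition normalized_complete_pick_space ::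
    "('x \<Rightarrow> complex) set \<Rightarrow> 'x inner_prod \<Rightarrow> bool" where
  "normalized_complete_pick_space H ip \<longleftrightarrow>
     rkhs H ip \<and>
     (\<exists>K z0. reproducing_kernel H ip K \<and> (\<forall>z. K z z0 = 1) \<and>
       (\<exists>d. \<exists>b :: 'x \<Rightarrow> nat \<Rightarrow> complex.
          (\<forall>z. b z \<in> unit_ball d) \<and> b z0 = (\<lambda>n. 0) \<and>
          (\<forall>z w. K z w = 1 / (1 - seq_inner (b z) (b w)))))"

definition multipliers :: "('x \<Rightarrow> complex) set \<Rightarrow> ('x \<Rightarrow> complex) set" where
  "multipliers H = {\<phi>. \<forall>f\<in>H. (\<lambda>x. \<phi> x * f x) \<in> H}"

text \<open>The Hilbert space \<open>H \<otimes> \<ell>\<^sup>2\<close>, as the space of square-summable sequences in \<open>H\<close>.\<close>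

definition ell2_space ::
    "('x \<Rightarrow> complex) set \<Rightarrow> 'x inner_prod \<Rightarrow> (nat \<Rightarrow> 'x \<Rightarrow> complex) set" where
  "ell2_space H ip = {F. (\<forall>n. F n \<in> H) \<and> summable (\<lambda>n. (hnorm ip (F n))\<^sup>2)}"

definition ell2_norm :: "'x inner_prod \<Rightarrow> (nat \<Rightarrow> 'x \<Rightarrow> complex) \<Rightarrow> real" where
  "ell2_norm ip F = sqrt (\<Sum>n. (hnorm ip (F n))\<^sup>2)"

definition hsums ::
    "('x \<Rightarrow> complex) set \<Rightarrow> 'x inner_prod \<Rightarrow> (nat \<Rightarrow> 'x \<Rightarrow> complex) \<Rightarrow> ('x \<Rightarrow> complex) \<Rightarrow> bool" where
  "hsums H ip F g \<longleftrightarrow> g \<in> H \<and> (\<lambda>N. hdist ip (\<lambda>x. \<Sum>n<N. F n x) g) \<longlonglongrightarrow> 0"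

definition column_bounded ::
    "('x \<Rightarrow> complex) set \<Rightarrow> 'x inner_prod \<Rightarrow> (nat \<Rightarrow> 'x \<Rightarrow> complex) \<Rightarrow> real \<Rightarrow> bool" where
  "column_bounded H ip \<phi> C \<longleftrightarrow>
     (\<forall>f\<in>H. (\<lambda>n x. \<phi> n x * f x) \<in> ell2_space H ip \<and>
            ell2_norm ip (\<lambda>n x. \<phi> n x * f x) \<le> C * hnorm ip f)"

text \<open>
  Boundedness of the row operator includes that the series defining it converges in the norm of \<open>H\<close>
  at every point of \<open>H \<otimes> \<ell>\<^sup>2\<close>.
\<close>

definition row_bounded ::
    "('x \<Rightarrow> complex) set \<Rightarrow> 'x inner_prod \<Rightarrow> (nat \<Rightarrow> 'x \<Rightarrow> complex) \<Rightarrow> real \<Rightarrow> bool" where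
  "row_bounded H ip \<phi> C \<longleftrightarrow>
     (\<forall>F\<in>ell2_space H ip. \<exists>g. hsums H ip (\<lambda>n x. \<phi> n x * F n x) g \<and>
            hnorm ip g \<le> C * ell2_norm ip F)"

definition column_row_property ::
    "('x \<Rightarrow> complex) set \<Rightarrow> 'x inner_prod \<Rightarrow> real \<Rightarrow> bool" where
  "column_row_property H ip c \<longleftrightarrow>
     (\<forall>\<phi> :: nat \<Rightarrow> 'x \<Rightarrow> complex. (\<forall>n. \<phi> n \<in> multipliers H) \<longrightarrow>
        column_bounded H ip \<phi> 1 \<longrightarrow> row_bounded H ip \<phi> c)"

end

theory Submission
  imports Defs "HOL-Analysis.Analysis" "HOL-Library.Poly_Mapping"
begin

text \<open>
  By duality and density of the kernels, the row bound says that
  \<open>\<Sum>n. \<parallel>M\<^sub>n\<^sup>* f\<parallel>\<^sup>2 \<le> \<parallel>f\<parallel>\<^sup>2\<close> for \<open>f\<close> a combination of finitely many kernels, where \<open>M\<^sub>n\<close> is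
  multiplication by \<open>\<phi> n\<close>. An antilinear operator \<open>C\<close> of Hankel type,
  \<open>\<langle>w, C u\<rangle> = (\<Sum>i. \<beta> i * u i * w i)\<close>, satisfies \<open>M\<^sub>n\<^sup>* (C u) = C (\<phi> n * u)\<close>. If \<open>f = C \<eta>\<close> with
  \<open>\<parallel>C\<parallel> \<le> 1\<close> and \<open>\<parallel>\<eta>\<parallel>\<close> close to \<open>\<parallel>f\<parallel>\<close>, then
  \<open>\<Sum>n. \<parallel>M\<^sub>n\<^sup>* f\<parallel>\<^sup>2 \<le> \<Sum>n. \<parallel>\<phi> n * \<eta>\<parallel>\<^sup>2 \<le> \<parallel>\<eta>\<parallel>\<^sup>2\<close> by the column bound.

  Such a factorization comes from a contraction \<open>C\<close> with \<open>C (1 + C y) = y\<close> for \<open>y = f / r\<close>: then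
  \<open>\<eta> = r * (1 + C y)\<close> has norm at most \<open>\<parallel>f\<parallel> + r\<close>. Its symbol \<open>\<beta>\<close> is a fixed point of a continuous map on
  the finite dimensional unit ball of Hankel symbols, found by Brouwer's theorem; a fixed point forced by the
  retraction onto the ball is excluded since a Hankel operator of norm 1 has a top singular vector
  \<open>s\<close> with \<open>s z0 \<noteq> 0\<close>. To find \<open>s\<close>, lift a top singular vector to the full Fock space, of which the
  Pick space is a quotient, and divide out its outer factor.
\<close>

subsection \<open>Brouwer's theorem on finite cubes\<close>

text \<open>The column bound speaks of products with \<open>\<phi> n\<close>, the row bound of
  adjoints. \<open>C\<close> exchanges them because values at a point commute: in both
  \<open>M\<^sub>n\<^sup>* (C u)\<close> and \<open>C (\<phi> n * u)\<close> the kernel at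
  \<open>i\<close> has the coefficient \<open>cnj (\<beta> i * \<phi> n i * u i)\<close>. One vector
  \<open>\<eta>\<close> then serves all \<open>n\<close> at once. Ideally
  \<open>\<eta> = C f\<close> with \<open>C (C f) = f\<close>; the equation in \<open>y\<close>
  replaces this by \<open>\<eta> = C f + r\<close>, perturbed by a small constant. The constant
  function 1 is the kernel at \<open>z0\<close>, so pairing with it is evaluation at
  \<open>z0\<close>, and a fixed point forced by the retraction is refuted by any top singular
  vector not vanishing there. A given top vector may vanish at \<open>z0\<close>. Its lift is an
  inner factor times one with nonzero constant term, and since evaluations commute, the inner factor
  can be handed to the other argument of the pairing. The inner factor of a polynomial is in general
  not a polynomial, so near minimizers and remainders made of long words take its place, and
  compactness in finite dimension restores an exact top vector.\<close>

lemma bounded_sequences_convergent_subsequence: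
  fixes f :: "nat \<Rightarrow> 'i \<Rightarrow> 'a::heine_borel"
  assumes "finite I" and "\<And>i. i \<in> I \<Longrightarrow> bounded (range (\<lambda>k. f k i))"
  shows "\<exists>l r. strict_mono (r :: nat \<Rightarrow> nat) \<and> (\<forall>i\<in>I. (\<lambda>k. f (r k) i) \<longlonglongrightarrow> l i)"
  using assms
proof (induction I rule: finite_induct)
  case empty
  then show ?case by (intro exI[of _ undefined] exI[of _ id]) (auto simp: strict_mono_def)
next
  case (insert a I)
  then obtain l r where r: "strict_mono (r :: nat \<Rightarrow> nat)" "\<forall>i\<in>I. (\<lambda>k. f (r k) i) \<longlonglongrightarrow> l i"
    by auto
  have "bounded (range (\<lambda>k. f (r k) a))"
    by (rule bounded_subset[OF insert.prems[of a]]) auto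
  then obtain c s where s: "strict_mono (s :: nat \<Rightarrow> nat)" "((\<lambda>k. f (r k) a) \<circ> s) \<longlonglongrightarrow> c"
    using bounded_imp_convergent_subsequence by blast
  have "(\<lambda>k. f ((r \<circ> s) k) i) \<longlonglongrightarrow> (l(a := c)) i" if "i \<in> insert a I" for i
  proof (cases "i = a")
    case True
    then show ?thesis using s(2) by (simp add: o_def)
  next
    case False
    then have "(\<lambda>k. f (r k) i) \<longlonglongrightarrow> l i" using r that by auto
    then show ?thesis using LIMSEQ_subseq_LIMSEQ[OF _ s(1)] False by (fastforce simp: o_def)
  qed
  then show ?case using strict_mono_o[OF r(1) s(1)] by blast
qed

text \<open>The library states Brouwer's theorem for types of class \<open>euclidean_space\<close>; here the dimension
  is the cardinality of a finite set that is not a type.\<close>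

theorem brouwer_finite_cube:
  fixes T :: "('i \<Rightarrow> real) \<Rightarrow> 'i \<Rightarrow> real"
  assumes fin: "finite I" and R: "R > 0"
    and into: "\<And>x i. \<forall>j\<in>I. \<bar>x j\<bar> \<le> R \<Longrightarrow> i \<in> I \<Longrightarrow> \<bar>T x i\<bar> \<le> R"
    and cont: "\<And>X x i. \<forall>k. \<forall>j\<in>I. \<bar>X k j\<bar> \<le> R \<Longrightarrow> \<forall>j\<in>I. (\<lambda>k. X k j) \<longlonglongrightarrow> x j \<Longrightarrow> i \<in> I
        \<Longrightarrow> (\<lambda>k. T (X k) i) \<longlonglongrightarrow> T x i"
  shows "\<exists>x. (\<forall>i\<in>I. \<bar>x i\<bar> \<le> R) \<and> (\<forall>i\<in>I. T x i = x i)"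
proof -
  define n where "n = card I"
  obtain h where h: "bij_betw h {0..<n} I"
    using ex_bij_betw_nat_finite[OF fin] n_def by blast
  define g where "g = inv_into {0..<n} h"
  have g: "g i < n" "h (g i) = i" if "i \<in> I" for i
    using that h bij_betw_inv_into_right[OF h] bij_betw_apply[OF bij_betw_inv_into[OF h]]
    by (auto simp: g_def)
  have hI: "h j \<in> I" "g (h j) = j" if "j < n" for j
    using that h bij_betw_apply[OF h] bij_betw_inv_into_left[OF h] by (auto simp: g_def)
  define z where "z p x i = - R + 2 * R * (real (x (g i)) / real p)" for p :: nat and x :: "nat \<Rightarrow> nat" and i
  \<comment> \<open>Label 0 promises that \<open>T\<close> does not decrease the coordinate, label 1
    that it does not increase it. On the two boundary faces, where Kuhn's lemma prescribes the
    label, the promise follows from \<open>into\<close>.\<close>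
  define label where "label p x j = (if x j = 0 then 0 else if x j = p then 1
      else if T (z p x) (h j) \<ge> z p x (h j) then 0 else (1::nat))" for p x j
  have zin: "\<bar>z p x i\<bar> \<le> R" if "p > 0" "\<forall>j<n. x j \<le> p" "i \<in> I" for p x i
  proof -
    have "0 \<le> real (x (g i)) / real p" "real (x (g i)) / real p \<le> 1"
      using that g by (auto simp: divide_le_eq)
    then have "0 \<le> 2 * R * (real (x (g i)) / real p)" "2 * R * (real (x (g i)) / real p) \<le> 2 * R * 1"
      using R by (auto intro!: mult_left_mono mult_nonneg_nonneg simp del: times_divide_eq_right)
    then show ?thesis unfolding z_def abs_le_iff by linarith
  qed
  have label0: "T (z p x) i \<ge> z p x i" if "p > 0" "\<forall>j<n. x j \<le> p" "i \<in> I" "label p x (g i) = 0" for p x i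
  proof (cases "x (g i) = 0")
    case True
    then have "z p x i = - R" by (simp add: z_def)
    then show ?thesis using into[of "z p x" i] zin that by (auto simp: abs_le_iff)
  next
    case False
    then show ?thesis using that g by (auto simp: label_def split: if_splits)
  qed
  have label1: "T (z p x) i \<le> z p x i" if "p > 0" "\<forall>j<n. x j \<le> p" "i \<in> I" "label p x (g i) = 1" for p x i
  proof (cases "x (g i) = p")
    case True
    then have "z p x i = R" using that by (simp add: z_def)
    then show ?thesis using into[of "z p x" i] zin that by (auto simp: abs_le_iff)
  next
    case False
    then show ?thesis using that g by (auto simp: label_def split: if_splits)
  qed
  define good where "good p q r s \<longleftrightarrow> (\<forall>j<n. q j < p) \<and> (\<forall>i<n. (\<forall>j<n. q j \<le> r i j \<and> r i j \<le> q j + 1) \<and>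
      (\<forall>j<n. q j \<le> s i j \<and> s i j \<le> q j + 1) \<and> label p (r i) i \<noteq> label p (s i) i)" for p q r s
  have "\<exists>q r s. good (Suc p) q r s" for p
  proof -
    obtain q where q: "\<forall>i<n. q i < Suc p" and
      "\<forall>i<n. \<exists>r s. (\<forall>j<n. q j \<le> r j \<and> r j \<le> q j + 1) \<and> (\<forall>j<n. q j \<le> s j \<and> s j \<le> q j + 1)
          \<and> label (Suc p) r i \<noteq> label (Suc p) s i"
      by (rule kuhn_lemma[of "Suc p" n "label (Suc p)"]) (auto simp: label_def)
    then obtain r s where "\<forall>i<n. (\<forall>j<n. q j \<le> r i j \<and> r i j \<le> q j + 1) \<and>
        (\<forall>j<n. q j \<le> s i j \<and> s i j \<le> q j + 1) \<and> label (Suc p) (r i) i \<noteq> label (Suc p) (s i) i"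
      by moura
    then show ?thesis using q unfolding good_def by blast
  qed
  then obtain q r s where qrs: "\<And>p. good (Suc p) (q p) (r p) (s p)" by metis
  have q: "\<And>p j. j < n \<Longrightarrow> q p j < Suc p"
    and r: "\<And>p i j. i < n \<Longrightarrow> j < n \<Longrightarrow> q p j \<le> r p i j \<and> r p i j \<le> q p j + 1"
    and s: "\<And>p i j. i < n \<Longrightarrow> j < n \<Longrightarrow> q p j \<le> s p i j \<and> s p i j \<le> q p j + 1"
    and rs: "\<And>p i. i < n \<Longrightarrow> label (Suc p) (r p i) i \<noteq> label (Suc p) (s p i) i"
    using qrs unfolding good_def by blast+
  have rle: "\<forall>j<n. r p i j \<le> Suc p" and sle: "\<forall>j<n. s p i j \<le> Suc p" and qle: "\<forall>j<n. q p j \<le> Suc p"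
    if "i < n" for p i
    using q[of _ p] r[OF that, of _ p] s[OF that, of _ p] by fastforce+
  have qz: "\<bar>z (Suc p) (q p) i\<bar> \<le> R" if "i \<in> I" for p i
    using zin[of "Suc p" "q p" i] qle[OF g(1)[OF that]] that by auto
  have "\<exists>l ss. strict_mono (ss :: nat \<Rightarrow> nat) \<and> (\<forall>i\<in>I. (\<lambda>k. z (Suc (ss k)) (q (ss k)) i) \<longlonglongrightarrow> l i)"
    by (rule bounded_sequences_convergent_subsequence[where f = "\<lambda>k. z (Suc k) (q k)"])
       (use fin qz in \<open>auto intro!: boundedI[where B = R]\<close>)
  then obtain x ss where ss: "strict_mono (ss :: nat \<Rightarrow> nat)"
    and lim: "\<forall>i\<in>I. (\<lambda>k. z (Suc (ss k)) (q (ss k)) i) \<longlonglongrightarrow> x i"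
    by blast
  have xR: "\<bar>x i\<bar> \<le> R" if "i \<in> I" for i
    using LIMSEQ_le_const2[OF tendsto_rabs[OF lim[rule_format, OF that]], of R] qz[OF that] by blast
  have near: "(\<lambda>k. z (Suc (ss k)) (v (ss k)) i) \<longlonglongrightarrow> x i"
    if v: "\<And>p j. j < n \<Longrightarrow> q p j \<le> v p j \<and> v p j \<le> q p j + 1" and i: "i \<in> I" for v i
  proof -
    have "(\<lambda>k. z (Suc (ss k)) (v (ss k)) i - z (Suc (ss k)) (q (ss k)) i) \<longlonglongrightarrow> 0"
    proof (rule Lim_null_comparison)
      show "(\<lambda>k. 2 * R * inverse (real (Suc (ss k)))) \<longlonglongrightarrow> 0"
        using LIMSEQ_subseq_LIMSEQ[OF LIMSEQ_inverse_real_of_nat ss] tendsto_mult_right_zero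
        by (fastforce simp: o_def)
      show "\<forall>\<^sub>F k in sequentially. norm (z (Suc (ss k)) (v (ss k)) i - z (Suc (ss k)) (q (ss k)) i)
          \<le> 2 * R * inverse (real (Suc (ss k)))"
      proof (intro always_eventually allI)
        fix k
        define m where "m = ss k"
        have "z (Suc m) (v m) i - z (Suc m) (q m) i =
            2 * R * inverse (real (Suc m)) * (real (v m (g i)) - real (q m (g i)))"
          by (simp add: z_def divide_inverse ring_distribs del: of_nat_Suc)
        moreover have "\<bar>real (v m (g i)) - real (q m (g i))\<bar> \<le> 1"
          using v[OF g(1)[OF i], of m] by auto
        ultimately show "norm (z (Suc (ss k)) (v (ss k)) i - z (Suc (ss k)) (q (ss k)) i)
          \<le> 2 * R * inverse (real (Suc (ss k)))"
          using R by (auto simp: abs_mult m_def intro!: mult_left_le)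
      qed
    qed
    from tendsto_add[OF this lim[rule_format, OF i]] show ?thesis by simp
  qed
  have "T x i = x i" if i: "i \<in> I" for i
  proof -
    define j where "j = g i"
    have j: "j < n" "h j = i" using g i by (auto simp: j_def)
    \<comment> \<open>Of the two corners whose labels differ in coordinate \<open>j\<close>,
      \<open>a p\<close> is the one labelled 0 and \<open>b p\<close> the one labelled 1. Both
      converge to \<open>x\<close>, so each gives one of the two inequalities.\<close>
    define a where "a p = (if label (Suc p) (r p j) j = 0 then r p j else s p j)" for p
    define b where "b p = (if label (Suc p) (r p j) j = 0 then s p j else r p j)" for p
    have lab: "label p v j = 0 \<or> label p v j = 1" for p v by (auto simp: label_def)
    have a0: "label (Suc p) (a p) j = 0" and b1: "label (Suc p) (b p) j = 1" for p
      using rs[OF j(1), of p] lab[of "Suc p" "r p j"] lab[of "Suc p" "s p j"] by (auto simp: a_def b_def)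
    have aq: "\<And>p k. k < n \<Longrightarrow> q p k \<le> a p k \<and> a p k \<le> q p k + 1"
      and bq: "\<And>p k. k < n \<Longrightarrow> q p k \<le> b p k \<and> b p k \<le> q p k + 1"
      using r s j by (auto simp: a_def b_def)
    have ale: "\<forall>k<n. a p k \<le> Suc p" and ble: "\<forall>k<n. b p k \<le> Suc p" for p
      using rle[OF j(1)] sle[OF j(1)] by (auto simp: a_def b_def)
    have alim: "(\<lambda>k. T (z (Suc (ss k)) (a (ss k))) i) \<longlonglongrightarrow> T x i"
      by (rule cont) (use zin ale near[OF aq] i in auto)
    have blim: "(\<lambda>k. T (z (Suc (ss k)) (b (ss k))) i) \<longlonglongrightarrow> T x i"
      by (rule cont) (use zin ble near[OF bq] i in auto)
    have "x i \<le> T x i"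
      using label0 ale a0 i by (intro LIMSEQ_le[OF near[OF aq i] alim]) (auto simp: j_def)
    moreover have "T x i \<le> x i"
      using label1 ble b1 i by (intro LIMSEQ_le[OF blim near[OF bq i]]) (auto simp: j_def)
    ultimately show ?thesis by simp
  qed
  then show ?thesis using xR by blast
qed

subsection \<open>Noncommutative polynomials\<close>

text \<open>Lists are not an instance of \<open>monoid_add\<close>, which \<open>Poly_Mapping\<close> needs for its convolution
  product.\<close>

datatype word = Word (letters: "nat list")

instantiation word :: monoid_add
begin
definition zero_word :: word where "0 = Word []"
definition plus_word :: "word \<Rightarrow> word \<Rightarrow> word" where "v + w = Word (letters v @ letters w)"
instance by standard (auto simp: zero_word_def plus_word_def)
end

lemma letters_zero [simp]: "letters 0 = []" and letters_plus [simp]: "letters (v + w) = letters v @ letters w"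
  by (auto simp: zero_word_def plus_word_def)

abbreviation wlen :: "word \<Rightarrow> nat" where "wlen w \<equiv> length (letters w)"

lemma word_eq_iff: "v = w \<longleftrightarrow> letters v = letters w"
  by (cases v; cases w) auto

lemma word_add_left_cancel [simp]: "w + y = w + z \<longleftrightarrow> y = (z :: word)"
  by (auto simp: word_eq_iff)

lemma inj_word_plus: "inj (\<lambda>z :: word. w + z)"
  by (auto intro: injI)

lemma word_add_eq_zero [simp]: "v + w = 0 \<longleftrightarrow> v = 0 \<and> w = (0 :: word)"
  by (auto simp: word_eq_iff)

lemma wlen_eq_0 [simp]: "letters w = [] \<longleftrightarrow> w = 0"
  by (auto simp: word_eq_iff)

text \<open>Two prefixes of one word are comparable. Hence the left multiples of two words are
  either nested or disjoint, which yields the orthogonality relations below.\<close>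

lemma word_split:
  assumes "v + w = v' + (w' :: word)" "wlen v \<le> wlen v'"
  shows "\<exists>y. v' = v + y \<and> w = y + w'"
proof -
  have e: "letters v @ letters w = letters v' @ letters w'" using assms(1) by (metis letters_plus)
  define y where "y = Word (drop (wlen v) (letters v'))"
  have "take (wlen v) (letters v') = letters v" using e assms(2)
    by (metis append_eq_append_conv_if append_take_drop_id)
  then have "v' = v + y" unfolding y_def word_eq_iff
    by (metis append_take_drop_id letters_plus word.sel)
  moreover then have "w = y + w'" using assms(1) by (simp add: add.assoc)
  ultimately show ?thesis by blast
qed

definition words :: "nat \<Rightarrow> word set" where "words d = {w. set (letters w) \<subseteq> {..<d}}"
definition words_upto :: "nat \<Rightarrow> nat \<Rightarrow> word set" where "words_upto d n = {w \<in> words d. wlen w \<le> n}"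

lemma finite_words_upto [simp]: "finite (words_upto d n)"
proof -
  have "words_upto d n \<subseteq> Word ` {xs. set xs \<subseteq> {..<d} \<and> length xs \<le> n}"
    by (auto simp: words_upto_def words_def) (metis (no_types, lifting) imageI mem_Collect_eq word.collapse)
  then show ?thesis by (rule finite_subset) (auto intro: finite_lists_length_le)
qed

lemma words_zero [simp]: "0 \<in> words d" "0 \<in> words_upto d n"
  by (auto simp: words_def words_upto_def)

lemma words_add [simp]: "v + w \<in> words d \<longleftrightarrow> v \<in> words d \<and> w \<in> words d"
  by (auto simp: words_def)

type_synonym fpoly = "word \<Rightarrow>\<^sub>0 complex"

abbreviation "keys \<equiv> Poly_Mapping.keys"
abbreviation "lookup \<equiv> Poly_Mapping.lookup"
abbreviation "single \<equiv> Poly_Mapping.single"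

lemma poly_mapping_sum_monomials: "(\<Sum>w\<in>keys p. single w (lookup p w)) = p"
  by (rule poly_mapping_eqI) (simp add: lookup_sum lookup_single when_def in_keys_iff)

lemma times_sum_monomials: "(g :: fpoly) * u = (\<Sum>w\<in>keys g. single w (lookup g w) * u)"
  by (subst poly_mapping_sum_monomials[of g, symmetric]) (simp add: sum_distrib_right)

lemma single_times: "single w c * (p :: fpoly) = (\<Sum>z\<in>keys p. single (w + z) (c * lookup p z))"
  by (subst poly_mapping_sum_monomials[of p, symmetric]) (simp add: sum_distrib_left mult_single)

lemma lookup_single_times: "lookup (single w c * (p :: fpoly)) (w + z) = c * lookup p z"
proof -
  have "lookup (single w c * p) (w + z) = (\<Sum>y\<in>keys p. c * lookup p y when y = z)"
    by (simp add: single_times lookup_sum lookup_single)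
  also have "\<dots> = c * lookup p z"
    by (auto simp: when_def sum.delta in_keys_iff)
  finally show ?thesis .
qed

text \<open>The empty word is the unit of the monoid, so \<open>single 0 c * p\<close> serves as
  scalar multiplication throughout.\<close>

lemma lookup_scale [simp]: "lookup (single 0 c * (p :: fpoly)) z = c * lookup p z"
  using lookup_single_times[of 0 c p z] by simp

lemma lookup_single_times_not_prefix:
  assumes "\<And>z. y \<noteq> w + z" shows "lookup (single w c * (p :: fpoly)) y = 0"
proof -
  have "lookup (single (w + z) a) y = (0 :: complex)" for z a
    using assms[of z] by (simp add: lookup_single_not_eq)
  then show ?thesis by (simp add: single_times lookup_sum)
qed

section \<open>The inner product of the full Fock space\<close>

definition fock_inner :: "fpoly \<Rightarrow> fpoly \<Rightarrow> complex" where
  "fock_inner p q = (\<Sum>w\<in>keys p. lookup p w * cnj (lookup q w))"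

definition fock_sq :: "fpoly \<Rightarrow> real" where
  "fock_sq p = (\<Sum>w\<in>keys p. (cmod (lookup p w))\<^sup>2)"

lemma fock_inner_superset: "finite S \<Longrightarrow> keys p \<subseteq> S \<Longrightarrow> fock_inner p q = (\<Sum>w\<in>S. lookup p w * cnj (lookup q w))"
  unfolding fock_inner_def by (rule sum.mono_neutral_left) (auto simp: in_keys_iff)

lemma fock_sq_superset: "finite S \<Longrightarrow> keys p \<subseteq> S \<Longrightarrow> fock_sq p = (\<Sum>w\<in>S. (cmod (lookup p w))\<^sup>2)"
  unfolding fock_sq_def by (rule sum.mono_neutral_left) (auto simp: in_keys_iff)

lemma fock_inner_self: "fock_inner p p = of_real (fock_sq p)"
  by (simp add: fock_inner_def fock_sq_def complex_norm_square del: of_real_power)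

lemma fock_sq_nonneg [simp]: "0 \<le> fock_sq p"
  by (simp add: fock_sq_def sum_nonneg)

lemma fock_inner_add_left: "fock_inner (p + q) r = fock_inner p r + fock_inner q r"
proof -
  let ?S = "keys p \<union> keys q"
  have "keys (p + q) \<subseteq> ?S" by (rule keys_add)
  then show ?thesis
    by (simp add: fock_inner_superset[of ?S] lookup_add sum.distrib ring_distribs)
qed

lemma fock_inner_cnj: "cnj (fock_inner p q) = fock_inner q p"
proof -
  let ?S = "keys p \<union> keys q"
  show ?thesis by (simp add: fock_inner_superset[of ?S] mult.commute)
qed

lemma fock_inner_add_right: "fock_inner r (p + q) = fock_inner r p + fock_inner r q"
  by (metis fock_inner_add_left fock_inner_cnj complex_cnj_add)

lemma fock_inner_scale_left: "fock_inner (single 0 c * p) q = c * fock_inner p q"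
proof -
  have "keys (single 0 c * p) \<subseteq> keys p" by (auto simp: in_keys_iff)
  then show ?thesis by (simp add: fock_inner_superset[of "keys p"] sum_distrib_left mult.assoc)
qed

lemma fock_inner_scale_right: "fock_inner q (single 0 c * p) = cnj c * fock_inner q p"
  by (metis fock_inner_scale_left fock_inner_cnj complex_cnj_mult)

lemma fock_inner_zero [simp]: "fock_inner 0 q = 0" "fock_inner q 0 = 0"
  by (auto simp: fock_inner_def)

lemma fock_inner_minus_left: "fock_inner (p - q) r = fock_inner p r - fock_inner q r"
  using fock_inner_add_left[of "p - q" q r] by simp

lemma fock_inner_minus_right: "fock_inner r (p - q) = fock_inner r p - fock_inner r q"
  using fock_inner_add_right[of r "p - q" q] by simp

lemma fock_inner_sum_left: "fock_inner (\<Sum>i\<in>I. f i) q = (\<Sum>i\<in>I. fock_inner (f i) q)"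
  by (induction I rule: infinite_finite_induct) (auto simp: fock_inner_add_left)

lemma fock_inner_sum_right: "fock_inner q (\<Sum>i\<in>I. f i) = (\<Sum>i\<in>I. fock_inner q (f i))"
  by (induction I rule: infinite_finite_induct) (auto simp: fock_inner_add_right)

lemma fock_sq_minus: "fock_sq (p - q) = fock_sq p - 2 * Re (fock_inner p q) + fock_sq q"
proof -
  have "complex_of_real (fock_sq (p - q)) = fock_inner p p - (fock_inner p q + cnj (fock_inner p q)) + fock_inner q q"
    by (simp add: fock_inner_self[symmetric] fock_inner_minus_left fock_inner_minus_right fock_inner_cnj)
  also have "\<dots> = of_real (fock_sq p - 2 * Re (fock_inner p q) + fock_sq q)"
    by (simp add: fock_inner_self complex_add_cnj)
  finally show ?thesis by (metis of_real_eq_iff)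
qed

lemma fock_sq_scale: "fock_sq (single 0 c * p) = (cmod c)\<^sup>2 * fock_sq p"
proof -
  have "complex_of_real (fock_sq (single 0 c * p)) = (c * cnj c) * fock_inner p p"
    by (simp add: fock_inner_self[symmetric] fock_inner_scale_left fock_inner_scale_right)
  also have "\<dots> = of_real ((cmod c)\<^sup>2 * fock_sq p)"
    by (simp add: fock_inner_self complex_norm_square del: of_real_power)
  finally show ?thesis by (metis of_real_eq_iff)
qed

lemma cauchy_schwarz_sum:
  "(cmod (\<Sum>i\<in>I. f i * g i))\<^sup>2 \<le> (\<Sum>i\<in>I. (cmod (f i))\<^sup>2) * (\<Sum>i\<in>I. (cmod (g i))\<^sup>2)"
proof -
  have "cmod (\<Sum>i\<in>I. f i * g i) \<le> (\<Sum>i\<in>I. cmod (f i) * cmod (g i))"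
    using norm_sum[of "\<lambda>i. f i * g i" I] by (simp add: norm_mult)
  then have "(cmod (\<Sum>i\<in>I. f i * g i))\<^sup>2 \<le> (\<Sum>i\<in>I. cmod (f i) * cmod (g i))\<^sup>2"
    by (simp add: power_mono)
  also have "\<dots> \<le> (\<Sum>i\<in>I. (cmod (f i))\<^sup>2) * (\<Sum>i\<in>I. (cmod (g i))\<^sup>2)"
    by (rule Cauchy_Schwarz_ineq_sum)
  finally show ?thesis .
qed

lemma fock_sq_minus_le: "fock_sq (p - q) \<le> 2 * fock_sq p + 2 * fock_sq q"
proof -
  have "keys (p - q) \<subseteq> keys p \<union> keys q"
    by (auto simp: in_keys_iff lookup_minus)
  then have "fock_sq (p - q) = (\<Sum>w\<in>keys p \<union> keys q. (cmod (lookup p w - lookup q w))\<^sup>2)"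
    by (simp add: fock_sq_superset[of "keys p \<union> keys q"] lookup_minus)
  also have "\<dots> \<le> (\<Sum>w\<in>keys p \<union> keys q. 2 * (cmod (lookup p w))\<^sup>2 + 2 * (cmod (lookup q w))\<^sup>2)"
  proof (rule sum_mono)
    fix w
    have "(cmod (lookup p w - lookup q w))\<^sup>2 \<le> (cmod (lookup p w) + cmod (lookup q w))\<^sup>2"
      by (intro power_mono norm_triangle_ineq4) auto
    also have "\<dots> \<le> 2 * (cmod (lookup p w))\<^sup>2 + 2 * (cmod (lookup q w))\<^sup>2"
      using sum_squares_bound[of "cmod (lookup p w)" "cmod (lookup q w)"] by (simp add: power2_sum)
    finally show "(cmod (lookup p w - lookup q w))\<^sup>2 \<le> 2 * (cmod (lookup p w))\<^sup>2 + 2 * (cmod (lookup q w))\<^sup>2" .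
  qed
  also have "\<dots> = 2 * fock_sq p + 2 * fock_sq q"
    by (simp add: fock_sq_superset[of "keys p \<union> keys q"] sum.distrib sum_distrib_left)
  finally show ?thesis .
qed

text \<open>The adjoint of left multiplication by \<open>w\<close>: it removes the prefix
  \<open>w\<close> and kills all words without it.\<close>

definition strip :: "word \<Rightarrow> fpoly \<Rightarrow> fpoly" where
  "strip w p = Poly_Mapping.map_key (\<lambda>z. w + z) p"

lemma lookup_strip [simp]: "lookup (strip w p) z = lookup p (w + z)"
  by (simp add: strip_def map_key.rep_eq[OF inj_word_plus])

lemma fock_inner_single_times_left: "fock_inner (single w c * u) p = c * fock_inner u (strip w p)"
proof -
  have "keys (single w c * u) \<subseteq> (\<lambda>z. w + z) ` keys u"
  proof
    fix y assume y: "y \<in> keys (single w c * u)"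
    then have "lookup (single w c * u) y \<noteq> 0" by (simp add: in_keys_iff)
    then obtain z where z: "y = w + z" using lookup_single_times_not_prefix[of y w c u] by blast
    then have "z \<in> keys u" using y by (simp add: in_keys_iff lookup_single_times)
    then show "y \<in> (\<lambda>z. w + z) ` keys u" using z by blast
  qed
  then have "fock_inner (single w c * u) p = (\<Sum>z\<in>(\<lambda>z. w + z) ` keys u. lookup (single w c * u) z * cnj (lookup p z))"
    by (simp add: fock_inner_superset)
  also have "\<dots> = (\<Sum>z\<in>keys u. lookup (single w c * u) (w + z) * cnj (lookup p (w + z)))"
    by (subst sum.reindex) (auto intro: inj_onI)
  also have "\<dots> = c * fock_inner u (strip w p)"
    by (simp add: fock_inner_def lookup_single_times sum_distrib_left mult.assoc)
  finally show ?thesis .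
qed

lemma fock_sq_strip_le: "fock_sq (strip w p) \<le> fock_sq p"
proof -
  have "fock_sq (strip w p) = (\<Sum>z\<in>keys (strip w p). (cmod (lookup p (w + z)))\<^sup>2)"
    by (simp add: fock_sq_def)
  also have "\<dots> = (\<Sum>z\<in>(\<lambda>z. w + z) ` keys (strip w p). (cmod (lookup p z))\<^sup>2)"
    by (simp add: sum.reindex inj_on_def)
  also have "\<dots> \<le> fock_sq p"
    unfolding fock_sq_def by (rule sum_mono2) (auto simp: in_keys_iff)
  finally show ?thesis .
qed

lemma strip_sum: "strip w (\<Sum>i\<in>I. f i) = (\<Sum>i\<in>I. strip w (f i))"
  by (rule poly_mapping_eqI) (simp add: lookup_sum)

lemma strip_single_times: "strip w (single (w + y) c * p) = single y c * (p :: fpoly)"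
proof (rule poly_mapping_eqI)
  fix z
  show "lookup (strip w (single (w + y) c * p)) z = lookup (single y c * p) z"
  proof (cases "\<exists>z'. z = y + z'")
    case True
    then obtain z' where z: "z = y + z'" by blast
    have "w + z = (w + y) + z'" by (simp add: z add.assoc)
    then show ?thesis using lookup_single_times[of "w + y" c p z'] lookup_single_times[of y c p z']
      by (simp add: z)
  next
    case False
    then have "w + z \<noteq> (w + y) + z'" for z' by (simp add: add.assoc)
    then show ?thesis using lookup_single_times_not_prefix[of "w + z" "w + y" c p] False
      lookup_single_times_not_prefix[of z y c p] by simp
  qed
qed

lemma strip_single_times_incomparable:
  assumes "\<And>y. c \<noteq> w + y" "wlen w \<le> wlen c"
  shows "strip w (single c a * p) = 0"
proof (rule poly_mapping_eqI)
  fix z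
  have "w + z \<noteq> c + z'" for z' using word_split[of w z c z'] assms by metis
  then show "lookup (strip w (single c a * p)) z = lookup 0 z"
    by (simp add: lookup_single_times_not_prefix)
qed

text \<open>A word of \<open>r\<close> is at least as long as \<open>w\<close>, so it either starts
  with \<open>w\<close> or is incomparable with it; the removed prefix never reaches into
  \<open>v\<close>.\<close>

lemma strip_times:
  assumes "\<And>c. c \<in> keys r \<Longrightarrow> wlen w \<le> wlen c"
  shows "strip w (r * v) = strip w r * v"
proof -
  have *: "strip w (single c a * v) = strip w (single c a) * v" if "wlen w \<le> wlen c" for c and a :: complex
  proof (cases "\<exists>y. c = w + y")
    case True
    then obtain y where c: "c = w + y" by blast
    show ?thesis using strip_single_times[of w y a v] strip_single_times[of w y a 1] by (simp add: c)
  next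
    case False
    then show ?thesis using strip_single_times_incomparable[of c w a v] strip_single_times_incomparable[of c w a 1] that
      by simp
  qed
  have "strip w (r * v) = (\<Sum>c\<in>keys r. strip w (single c (lookup r c) * v))"
    by (subst times_sum_monomials) (simp add: strip_sum)
  also have "\<dots> = (\<Sum>c\<in>keys r. strip w (single c (lookup r c)) * v)"
    using assms * by (auto intro!: sum.cong)
  also have "\<dots> = strip w (\<Sum>c\<in>keys r. single c (lookup r c)) * v"
    by (simp add: strip_sum sum_distrib_right)
  finally show ?thesis by (simp add: poly_mapping_sum_monomials)
qed

lemma lookup_times_0: "lookup (x * (y :: fpoly)) 0 = lookup x 0 * lookup y 0"
proof -
  have "lookup (single w c * y) 0 = (if w = 0 then c * lookup y 0 else 0)" for w c
  proof (cases "w = 0")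
    case False
    then have "0 \<noteq> w + z" for z by (metis word_add_eq_zero)
    then show ?thesis using False lookup_single_times_not_prefix[of 0 w c y] by simp
  qed simp
  then have "lookup (x * y) 0 = (\<Sum>w\<in>keys x. if w = 0 then lookup x w * lookup y 0 else 0)"
    by (subst times_sum_monomials) (simp add: lookup_sum)
  then show ?thesis by (auto simp: sum.delta in_keys_iff)
qed

lemma fock_inner_cauchy_schwarz: "(cmod (fock_inner p q))\<^sup>2 \<le> fock_sq p * fock_sq q"
proof -
  let ?S = "keys p \<union> keys q"
  show ?thesis
    using cauchy_schwarz_sum[of "lookup p" "\<lambda>w. cnj (lookup q w)" ?S]
    by (simp add: fock_inner_superset[of ?S] fock_sq_superset[of ?S])
qed

text \<open>Left multiplication by a word is isometric, so the common prefix cancels. Together with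
  the orthogonality of incomparable prefixes this computes all Gram entries of left
  multiples.\<close>

lemma fock_inner_single_times_single_times:
  "fock_inner (single w a * u) (single (w + y) c * u') = a * cnj c * fock_inner u (single y 1 * u')"
  using fock_inner_scale_right[of u c "single y 1 * u'"]
  by (simp add: fock_inner_single_times_left strip_single_times mult.assoc[symmetric] mult_single)

lemma fock_sq_single_times: "fock_sq (single w c * u) = (cmod c)\<^sup>2 * fock_sq u"
proof -
  have "complex_of_real (fock_sq (single w c * u)) = (c * cnj c) * fock_inner u u"
    using fock_inner_single_times_single_times[of w c u 0 c u] by (simp add: fock_inner_self[symmetric])
  also have "\<dots> = of_real ((cmod c)\<^sup>2 * fock_sq u)"
    by (simp add: fock_inner_self complex_norm_square del: of_real_power)
  finally show ?thesis by (metis of_real_eq_iff)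
qed

lemma fock_inner_single_times_incomparable:
  assumes "\<And>y. w' \<noteq> w + y" "wlen w \<le> wlen w'"
  shows "fock_inner (single w a * u) (single w' c * u') = 0"
  using assms by (simp add: fock_inner_single_times_left strip_single_times_incomparable)

text \<open>A quadratic polynomial in \<open>c\<close> whose value at 0 is within
  \<open>s\<^sup>2\<close> of a lower bound has a small linear coefficient: test
  \<open>c = z / B\<close>, or a large multiple of \<open>z\<close> when \<open>B = 0\<close>. With
  \<open>s = 0\<close> it turns exact minimality into orthogonality.\<close>

lemma quadratic_near_minimum:
  fixes z :: complex
  assumes "\<And>c. t \<le> U - 2 * Re (cnj c * z) + (cmod c)\<^sup>2 * B" "U \<le> t + s\<^sup>2" "B \<ge> 0" "s \<ge> 0"
  shows "cmod z \<le> s * sqrt B"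
proof -
  have q: "0 \<le> s\<^sup>2 - 2 * m * (cmod z)\<^sup>2 + m\<^sup>2 * (cmod z)\<^sup>2 * B" for m :: real
  proof -
    have "Re (cnj (of_real m * z) * z) = m * (cmod z)\<^sup>2"
      by (simp add: cmod_power2) (simp add: power2_eq_square algebra_simps)
    moreover have "(cmod (of_real m * z))\<^sup>2 = m\<^sup>2 * (cmod z)\<^sup>2"
      by (simp add: norm_mult power_mult_distrib)
    ultimately show ?thesis using assms(1)[of "of_real m * z"] assms(2) by simp
  qed
  show ?thesis
  proof (cases "B = 0")
    case True
    have "cmod z = 0"
    proof (rule ccontr)
      assume "cmod z \<noteq> 0"
      then have "0 < (cmod z)\<^sup>2" by simp
      then obtain m where m: "m * (cmod z)\<^sup>2 = s\<^sup>2 + 1"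
        by (metis less_numeral_extra(3) nonzero_divide_eq_eq)
      have "0 \<le> s\<^sup>2 - 2 * (m * (cmod z)\<^sup>2)"
        using q[of m] by (simp only: True mult.assoc mult_zero_right add_0_right)
      then have "s\<^sup>2 + 2 \<le> 0" unfolding m by simp
      moreover have "0 \<le> s\<^sup>2" by simp
      ultimately show False by linarith
    qed
    then show ?thesis using True by simp
  next
    case False
    then have B: "B > 0" using assms by simp
    have "(cmod z)\<^sup>2 \<le> s\<^sup>2 * B"
      using q[of "1 / B"] B by (simp add: field_simps power2_eq_square)
    then have "(cmod z)\<^sup>2 \<le> (s * sqrt B)\<^sup>2" using B by (simp add: power_mult_distrib)
    then show ?thesis by (rule power2_le_imp_le) (simp add: assms)
  qed
qed

lemma square_sum_le_card:
  assumes "finite S" shows "(\<Sum>w\<in>S. cmod (f w))\<^sup>2 \<le> real (card S) * (\<Sum>w\<in>S. (cmod (f w))\<^sup>2)"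
  using Cauchy_Schwarz_ineq_sum[of "\<lambda>_. 1" "\<lambda>w. cmod (f w)" S] by simp

section \<open>Near minimizers and approximate inner factors\<close>

definition truncate :: "nat \<Rightarrow> fpoly \<Rightarrow> fpoly" where
  "truncate n p = (\<Sum>w\<in>{w \<in> keys p. wlen w \<le> n}. single w (lookup p w))"

lemma lookup_truncate: "lookup (truncate n p) w = (if wlen w \<le> n then lookup p w else 0)"
  by (auto simp: truncate_def lookup_sum lookup_single when_def in_keys_iff)

lemma keys_words_times:
  assumes "keys p \<subseteq> words d" "keys q \<subseteq> words d"
  shows "keys (p * (q :: fpoly)) \<subseteq> words d"
  using keys_mult[of p q] assms by fastforce

lemma keys_one: "keys (1 :: fpoly) = {0}"
  by (simp add: single_one[symmetric] del: single_one)

lemma keys_words_power: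
  assumes "keys p \<subseteq> words d" shows "keys ((p :: fpoly) ^ k) \<subseteq> words d"
  by (induction k) (use assms keys_words_times in \<open>auto simp: keys_one\<close>)

lemma keys_power_long:
  assumes "lookup p 0 = 0" "w \<in> keys ((p :: fpoly) ^ k)"
  shows "k \<le> wlen w"
  using assms(2)
proof (induction k arbitrary: w)
  case (Suc k)
  then obtain a c where w: "w = a + c" "a \<in> keys p" "c \<in> keys (p ^ k)"
    using keys_mult[of p "p ^ k"] by auto
  then have "a \<noteq> 0" using assms(1) by (auto simp: in_keys_iff)
  then have "wlen a \<ge> 1" by (metis One_nat_def Suc_leI length_greater_0_conv wlen_eq_0)
  then show ?case using Suc.IH[OF w(3)] w(1) by simp
qed simp

text \<open>The left inverse of \<open>k\<close> is the geometric series in \<open>1 - k\<close>.\<close>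

lemma truncated_left_inverse:
  assumes k: "lookup (k :: fpoly) 0 = 1" "keys k \<subseteq> words d"
  shows "\<exists>x r. x * k = 1 + r \<and> keys x \<subseteq> words_upto d n \<and> lookup x 0 = 1 \<and> keys r \<subseteq> words d
           \<and> (\<forall>w\<in>keys r. n < wlen w)"
proof -
  define y where "y = 1 - k"
  have y0: "lookup y 0 = 0" using k by (simp add: y_def lookup_minus)
  have yk: "keys y \<subseteq> words d"
    using keys_diff[of 1 k] k keys_one by (auto simp: y_def)
  define x0 where "x0 = (\<Sum>j\<le>n. y ^ j)"
  have geo: "(\<Sum>j\<le>m. y ^ j) * (1 - y) = 1 - y ^ Suc m" for m
  proof (induction m)
    case (Suc m)
    have "y ^ Suc m * (1 - y) = y ^ Suc m - y ^ Suc (Suc m)"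
      by (simp add: right_diff_distrib power_Suc2 del: power_Suc)
    then show ?case using Suc by (simp add: distrib_right del: power_Suc)
  qed simp
  have x0k: "x0 * k = 1 - y ^ Suc n"
    using geo[of n] by (simp add: x0_def y_def)
  define x where "x = truncate n x0"
  have x0w: "keys x0 \<subseteq> words d"
    using keys_sum[of "\<lambda>j. y ^ j" "{..n}"] keys_words_power[OF yk] by (fastforce simp: x0_def)
  have xw: "keys x \<subseteq> words_upto d n"
    using x0w by (auto simp: x_def words_upto_def in_keys_iff lookup_truncate split: if_splits)
  define e where "e = x0 - x"
  have ek: "keys e \<subseteq> words d" and el: "\<And>w. w \<in> keys e \<Longrightarrow> n < wlen w"
    using x0w by (auto simp: e_def x_def in_keys_iff lookup_minus lookup_truncate split: if_splits)
  \<comment> \<open>Both terms consist of words longer than \<open>n\<close>: the power because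
    \<open>y\<close> has no constant term, and \<open>e * k\<close> because multiplication only
    lengthens the words of the tail \<open>e\<close>.\<close>
  define r where "r = - (y ^ Suc n) - e * k"
  have "x * k = 1 + r"
    using x0k by (simp add: r_def e_def algebra_simps)
  moreover have rk: "keys r \<subseteq> keys (y ^ Suc n) \<union> keys (e * k)"
    using keys_diff[of "- (y ^ Suc n)" "e * k"] by (simp add: r_def)
  then have "keys r \<subseteq> words d"
    using keys_words_power[OF yk, of "Suc n"] keys_words_times[OF ek k(2)] by blast
  moreover have "\<forall>w\<in>keys r. n < wlen w"
  proof
    fix w assume "w \<in> keys r"
    then consider "w \<in> keys (y ^ Suc n)" | "w \<in> keys (e * k)" using rk by blast
    then show "n < wlen w"
    proof cases
      case 1
      then show ?thesis using keys_power_long[OF y0] by fastforce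
    next
      case 2
      then obtain a c where "w = a + c" "a \<in> keys e" using keys_mult[of e k] by blast
      then show ?thesis using el[of a] by simp
    qed
  qed
  moreover have "lookup x 0 = 1"
  proof -
    have "lookup (y ^ j) 0 = (if j = 0 then 1 else 0)" for j
      by (cases j) (auto simp: lookup_times_0 y0)
    then show ?thesis by (simp add: x_def lookup_truncate x0_def lookup_sum)
  qed
  ultimately show ?thesis using xw by blast
qed

text \<open>A near minimizer \<open>k\<close> of \<open>fock_sq (k * v)\<close> under \<open>lookup k 0 = 1\<close> makes \<open>u = k * v\<close> almost orthogonal
  to its proper left multiples, so that right multiplication by \<open>u\<close> is almost a multiple of an isometry
  on short words: \<open>u\<close> stands in for the inner factor of \<open>v\<close>, and the left inverse \<open>x\<close> of \<open>k\<close> for the outer one.\<close>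

lemma almost_inner_factor:
  assumes low: "\<And>k. keys k \<subseteq> words d \<Longrightarrow> lookup k 0 = 1 \<Longrightarrow> \<tau> \<le> fock_sq (k * v)"
    and \<theta>: "\<theta> > 0"
  shows "\<exists>k x r. lookup k 0 = 1 \<and> keys k \<subseteq> words d \<and> x * k = 1 + r \<and> keys x \<subseteq> words_upto d n \<and> lookup x 0 = 1
     \<and> keys r \<subseteq> words d \<and> (\<forall>w\<in>keys r. n < wlen w) \<and> \<tau> \<le> fock_sq (k * v) \<and> fock_sq (k * v) \<le> fock_sq v + 1
     \<and> (\<forall>g. keys g \<subseteq> words_upto d n \<longrightarrow> \<bar>fock_sq (g * (k * v)) - fock_sq g * fock_sq (k * v)\<bar> \<le> \<theta> * fock_sq g)
     \<and> fock_sq (x * (k * v)) \<le> fock_sq v + \<theta> * fock_sq x"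
proof -
  define P where "P = {fock_sq (k * v) | k. keys k \<subseteq> words d \<and> lookup k 0 = 1}"
  have P1: "fock_sq v \<in> P" unfolding P_def using keys_one by (intro CollectI exI[of _ 1]) auto
  have Pbelow: "bdd_below P" unfolding P_def by (rule bdd_belowI[of _ 0]) auto
  define t where "t = Inf P"
  have tle: "t \<le> fock_sq (k * v)" if "keys k \<subseteq> words d" "lookup k 0 = 1" for k
    unfolding t_def by (rule cInf_lower[OF _ Pbelow]) (use that P_def in auto)
  define A where "A = fock_sq v + 1"
  define D where "D = real (card (words_upto d n))"
  have D1: "D \<ge> 1" unfolding D_def
    using card_mono[of "words_upto d n" "{0}"] by simp
  have A1: "A \<ge> 1" by (simp add: A_def)
  \<comment> \<open>\<open>D * fock_sq g\<close> dominates the square of the sum of the moduli of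
    the coefficients of \<open>g\<close>, and \<open>A\<close> dominates \<open>fock_sq u\<close>
    thanks to the cap at 1. Summing all off-diagonal Gram entries then costs
    \<open>s * D * A\<close>, which must not exceed \<open>\<theta>\<close>.\<close>
  define s where "s = min 1 (\<theta> / (D * A))"
  have s: "s > 0" "s \<le> 1" using \<theta> D1 A1 by (auto simp: s_def)
  have sDA: "s * D * A \<le> \<theta>"
  proof -
    have "s * (D * A) \<le> \<theta> / (D * A) * (D * A)"
      using D1 A1 by (intro mult_right_mono) (auto simp: s_def)
    then show ?thesis using D1 A1 by (simp add: mult.assoc)
  qed
  have "\<exists>p\<in>P. p < t + s\<^sup>2" unfolding t_def
    using cInf_lessD[of P "Inf P + s\<^sup>2"] P1 s by auto
  then obtain k where k: "keys k \<subseteq> words d" "lookup k 0 = 1" and kmin: "fock_sq (k * v) \<le> t + s\<^sup>2"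
    unfolding P_def by auto
  define u where "u = k * v"
  have "t \<le> fock_sq v" using P1 Pbelow by (simp add: t_def cInf_lower)
  then have uA: "fock_sq u \<le> A"
    using kmin s power_le_one[of s 2] by (simp add: A_def u_def)
  \<comment> \<open>Subtracting a multiple of \<open>y\<close> from \<open>k\<close> keeps the
    constant coefficient 1, so the result competes with \<open>k\<close> for the minimum.\<close>
  have ortho: "cmod (fock_inner u (y * v)) \<le> s * sqrt (fock_sq (y * v))"
    if y: "keys y \<subseteq> words d" "lookup y 0 = 0" for y
  proof (rule quadratic_near_minimum)
    fix c
    let ?c = "single 0 c * y"
    have cy: "keys ?c \<subseteq> words d" using y by (auto simp: in_keys_iff)
    have "keys (k - ?c) \<subseteq> words d" using keys_diff[of k ?c] k cy by blast
    then have "t \<le> fock_sq ((k - ?c) * v)" using k y by (intro tle) (auto simp: lookup_minus)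
    also have "(k - ?c) * v = u - single 0 c * (y * v)"
      by (simp add: u_def left_diff_distrib mult.assoc)
    also have "fock_sq \<dots> = fock_sq u - 2 * Re (cnj c * fock_inner u (y * v)) + (cmod c)\<^sup>2 * fock_sq (y * v)"
      by (simp add: fock_sq_minus fock_inner_scale_right fock_sq_scale)
    finally show "t \<le> fock_sq u - 2 * Re (cnj c * fock_inner u (y * v)) + (cmod c)\<^sup>2 * fock_sq (y * v)" .
  qed (use kmin s in \<open>auto simp: u_def\<close>)
  have shift: "cmod (fock_inner u (single y 1 * u)) \<le> s * A" if "y \<noteq> 0" "y \<in> words d" for y
  proof -
    have "keys (single y 1 * k) \<subseteq> words d" by (rule keys_words_times) (use that k in auto)
    moreover have "lookup (single y 1 * k) 0 = 0" using that by (simp add: lookup_times_0 lookup_single)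
    ultimately have "cmod (fock_inner u (single y 1 * u)) \<le> s * sqrt (fock_sq (single y 1 * u))"
      using ortho[of "single y 1 * k"] by (simp add: u_def mult.assoc)
    also have "\<dots> = s * sqrt (fock_sq u)" by (simp add: fock_sq_single_times)
    also have "\<dots> \<le> s * sqrt A" using uA s by simp
    also have "\<dots> \<le> s * A" using s A1 by (simp add: real_le_lsqrt power2_eq_square)
    finally show ?thesis .
  qed
  \<comment> \<open>If one word is a prefix of the other, the entry reduces to pairing
    \<open>u\<close> with a proper left multiple of itself; incomparable words give 0.\<close>
  have cross: "cmod (fock_inner (single w a * u) (single w' c * u)) \<le> cmod a * cmod c * (s * A)"
    if "w \<noteq> w'" "w \<in> words d" "w' \<in> words d" for w w' a c
  proof -
    have le: "cmod (fock_inner (single w a * u) (single w' c * u)) \<le> cmod a * cmod c * (s * A)"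
      if "w \<noteq> w'" "w' \<in> words d" "wlen w \<le> wlen w'" for w w' a c
    proof (cases "\<exists>y. w' = w + y")
      case True
      then obtain y where y: "w' = w + y" by blast
      then have "y \<noteq> 0" "y \<in> words d" using that by auto
      then have "cmod a * cmod c * cmod (fock_inner u (single y 1 * u)) \<le> cmod a * cmod c * (s * A)"
        using shift by (intro mult_left_mono) auto
      then show ?thesis by (simp add: y fock_inner_single_times_single_times norm_mult)
    next
      case False
      then show ?thesis using that s A1 by (simp add: fock_inner_single_times_incomparable)
    qed
    show ?thesis
    proof (cases "wlen w \<le> wlen w'")
      case True
      then show ?thesis using le that by blast
    next
      case False
      then have "cmod (fock_inner (single w' c * u) (single w a * u)) \<le> cmod c * cmod a * (s * A)"
        using le[of w' w c a] that by auto
      moreover have "cmod (fock_inner (single w' c * u) (single w a * u)) = cmod (fock_inner (single w a * u) (single w' c * u))"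
        by (metis fock_inner_cnj complex_mod_cnj)
      ultimately show ?thesis by (simp add: mult.commute mult.left_commute)
    qed
  qed
  have l1: "(\<Sum>w\<in>keys g. cmod (lookup g w))\<^sup>2 \<le> D * fock_sq g" if "keys g \<subseteq> words_upto d n" for g
  proof -
    have "(\<Sum>w\<in>keys g. cmod (lookup g w))\<^sup>2 \<le> real (card (keys g)) * fock_sq g"
      unfolding fock_sq_def by (rule square_sum_le_card) simp
    also have "\<dots> \<le> D * fock_sq g"
      unfolding D_def using that by (intro mult_right_mono) (auto intro!: card_mono)
    finally show ?thesis .
  qed
  have iso: "\<bar>fock_sq (g * u) - fock_sq g * fock_sq u\<bar> \<le> \<theta> * fock_sq g" if g: "keys g \<subseteq> words_upto d n" for g
  proof -
    define G where "G = keys g"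
    define h where "h w w' = fock_inner (single w (lookup g w) * u) (single w' (lookup g w') * u)" for w w'
    have Gw: "w \<in> words d" if "w \<in> G" for w using that g by (auto simp: G_def words_upto_def)
    have gu: "g * u = (\<Sum>w\<in>G. single w (lookup g w) * u)"
      unfolding G_def by (rule times_sum_monomials)
    have "fock_inner (g * u) (g * u) = (\<Sum>w\<in>G. \<Sum>w'\<in>G. h w w')"
      unfolding h_def fock_inner_sum_right[symmetric] gu[symmetric]
      unfolding fock_inner_sum_left[symmetric] gu[symmetric] ..
    also have "\<dots> = (\<Sum>w\<in>G. h w w + (\<Sum>w'\<in>G - {w}. h w w'))"
      by (intro sum.cong refl) (auto simp: G_def intro: sum.remove)
    also have "\<dots> = of_real (fock_sq g * fock_sq u) + (\<Sum>w\<in>G. \<Sum>w'\<in>G - {w}. h w w')"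
      by (simp add: sum.distrib h_def fock_inner_self fock_sq_single_times fock_sq_def[of g] G_def sum_distrib_right)
    finally have "complex_of_real (fock_sq (g * u) - fock_sq g * fock_sq u) = (\<Sum>w\<in>G. \<Sum>w'\<in>G - {w}. h w w')"
      by (simp add: fock_inner_self)
    then have "\<bar>fock_sq (g * u) - fock_sq g * fock_sq u\<bar> = cmod (\<Sum>w\<in>G. \<Sum>w'\<in>G - {w}. h w w')"
      by (metis norm_of_real)
    also have "\<dots> \<le> (\<Sum>w\<in>G. \<Sum>w'\<in>G - {w}. cmod (h w w'))"
      by (intro order_trans[OF norm_sum] sum_mono norm_sum)
    also have "\<dots> \<le> (\<Sum>w\<in>G. \<Sum>w'\<in>G - {w}. cmod (lookup g w) * cmod (lookup g w') * (s * A))"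
      unfolding h_def by (intro sum_mono cross) (auto intro: Gw)
    also have "\<dots> \<le> (\<Sum>w\<in>G. \<Sum>w'\<in>G. cmod (lookup g w) * cmod (lookup g w') * (s * A))"
      using s A1 by (intro sum_mono sum_mono2) (auto simp: G_def)
    also have "\<dots> = (s * A) * (\<Sum>w\<in>G. cmod (lookup g w))\<^sup>2"
      by (simp add: power2_eq_square sum_product sum_distrib_left sum_distrib_right mult.commute)
    also have "\<dots> \<le> (s * A) * (D * fock_sq g)"
      using l1[OF g] s A1 by (intro mult_left_mono) (auto simp: G_def)
    also have "\<dots> = (s * D * A) * fock_sq g" by simp
    also have "\<dots> \<le> \<theta> * fock_sq g" using sDA by (intro mult_right_mono) auto
    finally show ?thesis .
  qed
  obtain x r where x: "x * k = 1 + r" "keys x \<subseteq> words_upto d n" "lookup x 0 = 1"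
    and r: "keys r \<subseteq> words d" "\<forall>w\<in>keys r. n < wlen w"
    using truncated_left_inverse[OF k(2,1)] by blast
  \<comment> \<open>The norm \<open>R\<close> of \<open>r * v\<close> is uncontrolled. Since
    \<open>x * u = v + r * v\<close> and the cross term is at most \<open>s * S * R\<close>, the
    contribution \<open>2 * (s * S * R) - R\<^sup>2\<close> is at most
    \<open>(s * S)\<^sup>2\<close> whatever \<open>R\<close> is.\<close>
  have "fock_sq (x * u) \<le> fock_sq v + \<theta> * fock_sq x"
  proof -
    define S where "S = (\<Sum>w\<in>keys x. cmod (lookup x w))"
    define R where "R = sqrt (fock_sq (r * v))"
    have S0: "S \<ge> 0" by (simp add: S_def sum_nonneg)
    \<comment> \<open>The words of \<open>r\<close> are longer than those of \<open>x\<close>, so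
      removing a word of \<open>x\<close> acts on \<open>r\<close> alone and leaves no constant
      term. This is the situation of \<open>ortho\<close>.\<close>
    have strip_bound: "cmod (fock_inner u (strip w (r * v))) \<le> s * R" if w: "w \<in> keys x" for w
    proof -
      have wl: "wlen w \<le> n" "w \<in> words d" using w x by (auto simp: words_upto_def)
      have st: "strip w (r * v) = strip w r * v"
        using r wl by (intro strip_times) (meson less_imp_le_nat order_trans)
      have "w \<notin> keys r" using r wl by force
      then have "lookup (strip w r) 0 = 0" by (simp add: in_keys_iff)
      moreover have "keys (strip w r) \<subseteq> words d"
      proof
        fix z assume "z \<in> keys (strip w r)"
        then have "w + z \<in> keys r" by (simp add: in_keys_iff)
        then show "z \<in> words d" using r words_add by blast
      qed
      ultimately have "cmod (fock_inner u (strip w (r * v))) \<le> s * sqrt (fock_sq (strip w (r * v)))"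
        using ortho[of "strip w r"] st by simp
      also have "\<dots> \<le> s * R" using s by (simp add: R_def fock_sq_strip_le)
      finally show ?thesis .
    qed
    have "fock_inner (x * u) (r * v) = (\<Sum>w\<in>keys x. lookup x w * fock_inner u (strip w (r * v)))"
      by (subst times_sum_monomials) (simp add: fock_inner_sum_left fock_inner_single_times_left)
    then have "cmod (fock_inner (x * u) (r * v)) \<le> (\<Sum>w\<in>keys x. cmod (lookup x w) * cmod (fock_inner u (strip w (r * v))))"
      by (simp add: norm_mult[symmetric] norm_sum)
    also have "\<dots> \<le> (\<Sum>w\<in>keys x. cmod (lookup x w) * (s * R))"
      by (intro sum_mono mult_left_mono strip_bound) auto
    also have "\<dots> = s * S * R" by (simp add: S_def sum_distrib_right[symmetric])
    finally have c: "Re (fock_inner (x * u) (r * v)) \<le> s * S * R"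
      using complex_Re_le_cmod order_trans by blast
    have "v = x * u - r * v"
      using x(1) by (simp add: u_def mult.assoc[symmetric] distrib_right)
    then have "fock_sq v = fock_sq (x * u) - 2 * Re (fock_inner (x * u) (r * v)) + fock_sq (r * v)"
      by (metis fock_sq_minus)
    moreover have "fock_sq (r * v) = R\<^sup>2" by (simp add: R_def)
    ultimately have "fock_sq (x * u) \<le> fock_sq v + 2 * (s * S * R) - R\<^sup>2" using c by linarith
    also have "2 * (s * S * R) - R\<^sup>2 \<le> (s * S)\<^sup>2"
      using zero_le_power2[of "s * S - R"] by (simp add: power2_diff)
    then have "fock_sq v + 2 * (s * S * R) - R\<^sup>2 \<le> fock_sq v + (s * S)\<^sup>2" by linarith
    also have "(s * S)\<^sup>2 \<le> \<theta> * fock_sq x"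
    proof -
      have "(s * S)\<^sup>2 \<le> s\<^sup>2 * (D * fock_sq x)"
        using l1[OF x(2)] by (simp add: power_mult_distrib S_def mult_left_mono)
      also have "\<dots> \<le> (s * A) * (D * fock_sq x)"
      proof (rule mult_right_mono)
        have "s * s \<le> s * A" using s A1 by (intro mult_left_mono) auto
        then show "s\<^sup>2 \<le> s * A" by (simp add: power2_eq_square)
      qed (use D1 in simp)
      also have "\<dots> = (s * D * A) * fock_sq x" by simp
      also have "\<dots> \<le> \<theta> * fock_sq x" using sDA by (intro mult_right_mono) auto
      finally show ?thesis .
    qed
    finally show ?thesis by simp
  qed
  then show ?thesis
    using k x r low[OF k] uA iso unfolding u_def A_def by blast
qed

text \<open>\<open>v\<close> has no word shorter than \<open>w0\<close>, so only the constant term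
  of \<open>k\<close> contributes at \<open>w0\<close>. A nonzero coefficient there bounds all such
  products \<open>k * v\<close> away from 0.\<close>

lemma lookup_times_first_term:
  assumes k: "lookup (k :: fpoly) 0 = 1" and v: "\<And>z. wlen z < wlen w0 \<Longrightarrow> lookup v z = 0"
  shows "lookup (k * v) w0 = lookup v w0"
proof -
  have "lookup (single w (lookup k w) * v) w0 = (if w = 0 then lookup v w0 else 0)" for w
  proof (cases "\<exists>z. w0 = w + z")
    case True
    then obtain z where z: "w0 = w + z" by blast
    show ?thesis
    proof (cases "w = 0")
      case False
      then have "wlen z < wlen w0" using z by (simp add: length_greater_0_conv[symmetric] del: length_greater_0_conv)
         (metis length_greater_0_conv wlen_eq_0)
      then show ?thesis using v False lookup_single_times[of w "lookup k w" v z] z by simp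
    qed (use k in simp)
  next
    case False
    then show ?thesis using lookup_single_times_not_prefix[of w0 w "lookup k w" v] by (metis add_0)
  qed
  then have "lookup (k * v) w0 = (\<Sum>w\<in>keys k. if w = 0 then lookup v w0 else 0)"
    by (subst times_sum_monomials) (simp add: lookup_sum)
  then show ?thesis using k by (simp add: in_keys_iff)
qed

lemma cmod_lookup_le_fock_sq: "(cmod (lookup p w))\<^sup>2 \<le> fock_sq p"
proof -
  have "(\<Sum>w\<in>{w}. (cmod (lookup p w))\<^sup>2) \<le> (\<Sum>w\<in>insert w (keys p). (cmod (lookup p w))\<^sup>2)"
    by (rule sum_mono2) auto
  then show ?thesis using fock_sq_superset[of "insert w (keys p)" p] by (simp add: subset_insertI)
qed

subsection \<open>Pick kernels on finitely many points\<close>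

definition mon :: "(nat \<Rightarrow> complex) \<Rightarrow> word \<Rightarrow> complex" where
  "mon \<beta> w = prod_list (map \<beta> (letters w))"

lemma mon_zero [simp]: "mon \<beta> 0 = 1" and mon_plus [simp]: "mon \<beta> (v + w) = mon \<beta> v * mon \<beta> w"
  by (auto simp: mon_def)

text \<open>Evaluation at a commuting tuple, a multiplicative functional. At the points
  \<open>b i\<close> it realizes the quotient map from the Fock space to functions.\<close>

definition peval :: "(nat \<Rightarrow> complex) \<Rightarrow> fpoly \<Rightarrow> complex" where
  "peval \<beta> p = (\<Sum>w\<in>keys p. lookup p w * mon \<beta> w)"

lemma peval_superset: "finite S \<Longrightarrow> keys p \<subseteq> S \<Longrightarrow> peval \<beta> p = (\<Sum>w\<in>S. lookup p w * mon \<beta> w)"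
  unfolding peval_def by (rule sum.mono_neutral_left) (auto simp: in_keys_iff)

lemma peval_add: "peval \<beta> (p + q) = peval \<beta> p + peval \<beta> q"
  using keys_add[of p q]
  by (simp add: peval_superset[of "keys p \<union> keys q"] lookup_add sum.distrib ring_distribs)

lemma peval_zero [simp]: "peval \<beta> 0 = 0"
  by (simp add: peval_def)

lemma peval_single [simp]: "peval \<beta> (single w c) = c * mon \<beta> w"
  by (simp add: peval_superset[of "{w}"])

lemma peval_one [simp]: "peval \<beta> 1 = 1"
  using peval_single[of \<beta> 0 1] by (simp del: peval_single)

lemma peval_sum: "peval \<beta> (\<Sum>i\<in>I. f i) = (\<Sum>i\<in>I. peval \<beta> (f i))"
  by (induction I rule: infinite_finite_induct) (auto simp: peval_add)

lemma peval_times: "peval \<beta> (p * q) = peval \<beta> p * peval \<beta> q"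
proof -
  have "peval \<beta> (single w c * q) = c * mon \<beta> w * peval \<beta> q" for w c
    by (simp add: single_times peval_sum peval_def[of \<beta> q] sum_distrib_left mult_ac)
  then show ?thesis
    by (subst times_sum_monomials) (simp add: peval_sum peval_def[of \<beta> p] sum_distrib_left mult_ac)
qed

lemma peval_null: "peval (\<lambda>_. 0) p = lookup p 0"
proof -
  have *: "mon (\<lambda>_. 0) w = (if w = 0 then 1 else 0)" for w
    by (cases "letters w") (auto simp: mon_def)
  have "peval (\<lambda>_. 0) p = (\<Sum>w\<in>keys p. if w = 0 then lookup p 0 else 0)"
    unfolding peval_def by (rule sum.cong) (simp_all only: *, auto)
  then show ?thesis by (simp add: in_keys_iff)
qed

text \<open>Splitting off the first letter shows that the words of length \<open>m\<close>
  contribute the \<open>m\<close>-th power of the inner product. The Pick kernel is thus the Gram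
  kernel of the monomial vectors.\<close>

lemma sum_words_upto:
  "(\<Sum>w\<in>words_upto d n. mon \<beta> w * cnj (mon \<gamma> w)) = (\<Sum>m\<le>n. (\<Sum>k<d. \<beta> k * cnj (\<gamma> k)) ^ m)"
proof -
  define E where "E m = {w \<in> words d. wlen w = m}" for m
  have finE: "finite (E m)" for m
    by (rule finite_subset[OF _ finite_words_upto[of d m]]) (auto simp: E_def words_upto_def)
  have E: "(\<Sum>w\<in>E m. mon \<beta> w * cnj (mon \<gamma> w)) = (\<Sum>k<d. \<beta> k * cnj (\<gamma> k)) ^ m" for m
  proof (induction m)
    case 0
    have "E 0 = {0}" by (auto simp: E_def)
    then show ?case by simp
  next
    case (Suc m)
    have bij: "bij_betw (\<lambda>(k, w). Word [k] + w) ({..<d} \<times> E m) (E (Suc m))"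
    proof (rule bij_betwI[where g = "\<lambda>w. (hd (letters w), Word (tl (letters w)))"])
      show "(\<lambda>(k, w). Word [k] + w) \<in> {..<d} \<times> E m \<rightarrow> E (Suc m)"
        by (auto simp: E_def words_def)
      show "(\<lambda>w. (hd (letters w), Word (tl (letters w)))) \<in> E (Suc m) \<rightarrow> {..<d} \<times> E m"
        by (auto simp: E_def words_def length_Suc_conv)
    qed (auto simp: E_def word_eq_iff length_Suc_conv simp del: wlen_eq_0)
    have "(\<Sum>w\<in>E (Suc m). mon \<beta> w * cnj (mon \<gamma> w))
        = (\<Sum>(k, w)\<in>{..<d} \<times> E m. (\<beta> k * cnj (\<gamma> k)) * (mon \<beta> w * cnj (mon \<gamma> w)))"
      by (subst sum.reindex_bij_betw[OF bij, symmetric]) (auto simp: mon_def mult_ac intro!: sum.cong)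
    also have "\<dots> = (\<Sum>k<d. \<beta> k * cnj (\<gamma> k)) * (\<Sum>w\<in>E m. mon \<beta> w * cnj (mon \<gamma> w))"
      by (simp add: sum.cartesian_product[symmetric] sum_product)
    finally show ?case by (simp add: Suc.IH)
  qed
  have "words_upto d n = (\<Union>m\<le>n. E m)" by (auto simp: words_upto_def E_def)
  then have "(\<Sum>w\<in>words_upto d n. mon \<beta> w * cnj (mon \<gamma> w)) = (\<Sum>m\<le>n. \<Sum>w\<in>E m. mon \<beta> w * cnj (mon \<gamma> w))"
    using finE by (simp only:) (rule sum.UNION_disjoint, auto simp: E_def)
  then show ?thesis by (simp add: E)
qed

text \<open>\<open>K_definite\<close> expresses that the kernels at the points of \<open>X\<close>
  are linearly independent, so coefficient vectors represent functions faithfully. The base point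
  belongs to \<open>X\<close> because its kernel is the constant function 1.\<close>

locale pick_points =
  fixes X :: "'x set" and z0 :: 'x and b :: "'x \<Rightarrow> nat \<Rightarrow> complex" and K :: "'x \<Rightarrow> 'x \<Rightarrow> complex"
  assumes finX [simp]: "finite X" and z0X [simp]: "z0 \<in> X"
    and b_summable: "i \<in> X \<Longrightarrow> summable (\<lambda>n. (cmod (b i n))\<^sup>2)"
    and b_ball: "i \<in> X \<Longrightarrow> suminf (\<lambda>n. (cmod (b i n))\<^sup>2) < 1"
    and b_z0: "b z0 = (\<lambda>_. 0)"
    and K_eq: "i \<in> X \<Longrightarrow> j \<in> X \<Longrightarrow> K i j = 1 / (1 - seq_inner (b i) (b j))"
    and K_definite: "(\<Sum>i\<in>X. (\<Sum>j\<in>X. K i j * a j) * cnj (a i)) = 0 \<Longrightarrow> i \<in> X \<Longrightarrow> a i = 0"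
begin

text \<open>A coefficient vector \<open>a\<close> stands for the function \<open>ev a = (\<Sum>j\<in>X. a j * K _ j)\<close>, and \<open>kip\<close> is
  the inner product of these functions.\<close>

definition ev :: "('x \<Rightarrow> complex) \<Rightarrow> 'x \<Rightarrow> complex" where
  "ev a i = (\<Sum>j\<in>X. K i j * a j)"

definition kip :: "('x \<Rightarrow> complex) \<Rightarrow> ('x \<Rightarrow> complex) \<Rightarrow> complex" where
  "kip a c = (\<Sum>i\<in>X. ev a i * cnj (c i))"

definition ksq :: "('x \<Rightarrow> complex) \<Rightarrow> real" where
  "ksq a = Re (kip a a)"

text \<open>The lift of \<open>ev a\<close> to the Fock space, truncated to words of length at most \<open>n\<close> in \<open>n\<close> letters.\<close>

definition kernel_poly :: "nat \<Rightarrow> ('x \<Rightarrow> complex) \<Rightarrow> fpoly" where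
  "kernel_poly n a = (\<Sum>w\<in>words_upto n n. single w (\<Sum>j\<in>X. a j * cnj (mon (b j) w)))"

lemma lookup_kernel_poly:
  "lookup (kernel_poly n a) w = (if w \<in> words_upto n n then \<Sum>j\<in>X. a j * cnj (mon (b j) w) else 0)"
  by (simp add: kernel_poly_def lookup_sum lookup_single when_def sum.delta)

lemma keys_kernel_poly: "keys (kernel_poly n a) \<subseteq> words_upto n n"
  by (auto simp: in_keys_iff lookup_kernel_poly split: if_splits)

text \<open>The Gram kernel of the truncated lifts. Letters and word length are cut by the same
  \<open>n\<close>, so a single limit recovers \<open>K\<close> also when the ball is infinite
  dimensional.\<close>

definition Kn :: "nat \<Rightarrow> 'x \<Rightarrow> 'x \<Rightarrow> complex" where
  "Kn n i j = (\<Sum>m\<le>n. (\<Sum>k<n. b i k * cnj (b j k)) ^ m)"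

definition rho :: "'x \<Rightarrow> real" where "rho i = suminf (\<lambda>n. (cmod (b i n))\<^sup>2)"

lemma rho: "i \<in> X \<Longrightarrow> 0 \<le> rho i" "i \<in> X \<Longrightarrow> rho i < 1"
  using b_ball b_summable by (auto simp: rho_def intro: suminf_nonneg)

lemma partial_inner_le:
  assumes "i \<in> X" "j \<in> X"
  shows "cmod (\<Sum>k<n. b i k * cnj (b j k)) \<le> (rho i + rho j) / 2"
proof -
  have "cmod (\<Sum>k<n. b i k * cnj (b j k)) \<le> (\<Sum>k<n. ((cmod (b i k))\<^sup>2 + (cmod (b j k))\<^sup>2) / 2)"
  proof (rule order_trans[OF norm_sum], rule sum_mono)
    fix k
    show "cmod (b i k * cnj (b j k)) \<le> ((cmod (b i k))\<^sup>2 + (cmod (b j k))\<^sup>2) / 2"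
      using sum_squares_bound[of "cmod (b i k)" "cmod (b j k)"] by (simp add: norm_mult)
  qed
  also have "\<dots> = ((\<Sum>k<n. (cmod (b i k))\<^sup>2) + (\<Sum>k<n. (cmod (b j k))\<^sup>2)) / 2"
    by (simp add: sum.distrib sum_divide_distrib[symmetric])
  also have "\<dots> \<le> (rho i + rho j) / 2"
    unfolding rho_def using assms
    by (intro divide_right_mono add_mono sum_le_suminf b_summable) auto
  finally show ?thesis .
qed

lemma partial_inner_tendsto:
  assumes "i \<in> X" "j \<in> X"
  shows "(\<lambda>n. \<Sum>k<n. b i k * cnj (b j k)) \<longlonglongrightarrow> seq_inner (b i) (b j)"
proof -
  have "summable (\<lambda>k. b i k * cnj (b j k))"
  proof (rule summable_comparison_test)
    show "\<exists>N. \<forall>k\<ge>N. norm (b i k * cnj (b j k)) \<le> ((cmod (b i k))\<^sup>2 + (cmod (b j k))\<^sup>2) / 2"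
    proof (intro exI[of _ 0] allI impI)
      fix k
      show "norm (b i k * cnj (b j k)) \<le> ((cmod (b i k))\<^sup>2 + (cmod (b j k))\<^sup>2) / 2"
        using sum_squares_bound[of "cmod (b i k)" "cmod (b j k)"] by (simp add: norm_mult)
    qed
    show "summable (\<lambda>k. ((cmod (b i k))\<^sup>2 + (cmod (b j k))\<^sup>2) / 2)"
      using assms by (intro summable_divide summable_add b_summable)
  qed
  then show ?thesis by (simp add: seq_inner_def summable_LIMSEQ)
qed

text \<open>The partial inner product changes together with the exponent, so its convergence alone
  does not suffice; the uniform bound \<open>q < 1\<close> makes the remainder of the geometric sum
  vanish.\<close>

lemma Kn_tendsto:
  assumes ij: "i \<in> X" "j \<in> X"
  shows "(\<lambda>n. Kn n i j) \<longlonglongrightarrow> K i j"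
proof -
  define q where "q = (rho i + rho j) / 2"
  define l where "l n = (\<Sum>k<n. b i k * cnj (b j k))" for n
  have q: "0 \<le> q" "q < 1" using rho[OF ij(1)] rho[OF ij(2)] by (auto simp: q_def)
  have lq: "cmod (l n) \<le> q" for n using partial_inner_le[OF ij] by (simp add: l_def q_def)
  have llim: "l \<longlonglongrightarrow> seq_inner (b i) (b j)" unfolding l_def by (rule partial_inner_tendsto[OF ij])
  have "cmod (seq_inner (b i) (b j)) \<le> q"
    using lq by (intro LIMSEQ_le_const2[OF tendsto_norm[OF llim]]) auto
  then have ne: "1 - seq_inner (b i) (b j) \<noteq> 0" using q by auto
  have ln: "l n \<noteq> 1" for n using lq[of n] q by auto
  have "(\<lambda>n. l n ^ Suc n) \<longlonglongrightarrow> 0"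
  proof (rule Lim_null_comparison)
    show "\<forall>\<^sub>F n in sequentially. norm (l n ^ Suc n) \<le> q ^ Suc n"
      using lq by (intro always_eventually allI) (simp add: norm_power power_mono del: power_Suc)
    show "(\<lambda>n. q ^ Suc n) \<longlonglongrightarrow> 0" using LIMSEQ_Suc[OF LIMSEQ_power_zero[of q]] q by simp
  qed
  then have "(\<lambda>n. (1 - l n ^ Suc n) / (1 - l n)) \<longlonglongrightarrow> (1 - 0) / (1 - seq_inner (b i) (b j))"
    by (intro tendsto_intros llim ne)
  moreover have "Kn n i j = (1 - l n ^ Suc n) / (1 - l n)" for n
    using ln[of n] sum_gp0[of "l n" n] by (simp add: Kn_def l_def)
  ultimately show ?thesis using K_eq[OF ij] by simp
qed

lemma Kn_words: "Kn n i j = (\<Sum>w\<in>words_upto n n. mon (b i) w * cnj (mon (b j) w))"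
  by (simp add: Kn_def sum_words_upto)

lemma K_z0: "i \<in> X \<Longrightarrow> K i z0 = 1" "i \<in> X \<Longrightarrow> K z0 i = 1"
  by (simp_all add: K_eq b_z0 seq_inner_def)

lemma fock_inner_kernel_poly: "keys x \<subseteq> words_upto n n \<Longrightarrow> fock_inner x (kernel_poly n e) = (\<Sum>i\<in>X. cnj (e i) * peval (b i) x)"
proof -
  assume x: "keys x \<subseteq> words_upto n n"
  have "fock_inner x (kernel_poly n e) = (\<Sum>w\<in>words_upto n n. \<Sum>i\<in>X. cnj (e i) * (lookup x w * mon (b i) w))"
    using x by (simp add: fock_inner_superset[of "words_upto n n"] lookup_kernel_poly sum_distrib_left mult_ac)
  also have "\<dots> = (\<Sum>i\<in>X. \<Sum>w\<in>words_upto n n. cnj (e i) * (lookup x w * mon (b i) w))"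
    by (rule sum.swap)
  also have "\<dots> = (\<Sum>i\<in>X. cnj (e i) * peval (b i) x)"
    using x by (simp add: peval_superset[of "words_upto n n"] sum_distrib_left)
  finally show ?thesis .
qed

lemma peval_kernel_poly: "peval (b i) (kernel_poly n a) = (\<Sum>j\<in>X. Kn n i j * a j)"
proof -
  have "peval (b i) (kernel_poly n a) = (\<Sum>w\<in>words_upto n n. \<Sum>j\<in>X. (mon (b i) w * cnj (mon (b j) w)) * a j)"
    using keys_kernel_poly
    by (simp add: peval_superset[of "words_upto n n"] lookup_kernel_poly sum_distrib_left sum_distrib_right mult_ac)
  also have "\<dots> = (\<Sum>j\<in>X. \<Sum>w\<in>words_upto n n. (mon (b i) w * cnj (mon (b j) w)) * a j)"
    by (rule sum.swap)
  finally show ?thesis by (simp add: Kn_words sum_distrib_right)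
qed

lemma peval_kernel_poly_tendsto:
  assumes "i \<in> X" shows "(\<lambda>n. peval (b i) (kernel_poly n a)) \<longlonglongrightarrow> ev a i"
  unfolding peval_kernel_poly ev_def by (intro tendsto_intros Kn_tendsto assms)

lemma fock_inner_kernel_poly_tendsto: "(\<lambda>n. fock_inner (kernel_poly n a) (kernel_poly n c)) \<longlonglongrightarrow> kip a c"
proof -
  have "(\<lambda>n. \<Sum>i\<in>X. cnj (c i) * peval (b i) (kernel_poly n a)) \<longlonglongrightarrow> (\<Sum>i\<in>X. cnj (c i) * ev a i)"
    by (intro tendsto_intros peval_kernel_poly_tendsto)
  then show ?thesis using fock_inner_kernel_poly[OF keys_kernel_poly] by (simp add: kip_def mult.commute)
qed

lemma fock_sq_kernel_poly_tendsto: "(\<lambda>n. fock_sq (kernel_poly n a)) \<longlonglongrightarrow> ksq a"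
  using tendsto_Re[OF fock_inner_kernel_poly_tendsto[of a a]] by (simp add: ksq_def fock_inner_self)

text \<open>The coefficient at a word no longer depends on \<open>n\<close> once the word is
  included, so the squared norms increase to their limit.\<close>

lemma fock_sq_kernel_poly_le: "fock_sq (kernel_poly n a) \<le> ksq a"
proof -
  have "incseq (\<lambda>n. fock_sq (kernel_poly n a))"
  proof (rule incseq_SucI)
    fix n
    have sub: "words_upto n n \<subseteq> words_upto (Suc n) (Suc n)"
      by (force simp: words_upto_def words_def)
    have eq: "fock_sq (kernel_poly m a) = (\<Sum>w\<in>words_upto m m. (cmod (\<Sum>j\<in>X. a j * cnj (mon (b j) w)))\<^sup>2)" for m
      using fock_sq_superset[OF finite_words_upto keys_kernel_poly, of m a] by (simp add: lookup_kernel_poly)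
    show "fock_sq (kernel_poly n a) \<le> fock_sq (kernel_poly (Suc n) a)"
      unfolding eq by (rule sum_mono2) (use sub in auto)
  qed
  then show ?thesis using incseq_le fock_sq_kernel_poly_tendsto by blast
qed

lemma ksq_nonneg [simp]: "0 \<le> ksq a"
  using fock_sq_kernel_poly_le[of 0 a] fock_sq_nonneg order_trans by blast

lemma ksq_definite: "ksq a = 0 \<Longrightarrow> i \<in> X \<Longrightarrow> a i = 0"
proof -
  assume a: "ksq a = 0" and i: "i \<in> X"
  have "(\<lambda>n. fock_inner (kernel_poly n a) (kernel_poly n a)) \<longlonglongrightarrow> of_real (ksq a)"
    unfolding fock_inner_self by (intro tendsto_of_real fock_sq_kernel_poly_tendsto)
  then have "kip a a = of_real (ksq a)" using fock_inner_kernel_poly_tendsto LIMSEQ_unique by blast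
  then show ?thesis using K_definite[of a i] a i by (simp add: kip_def ev_def)
qed

lemma kip_self: "kip a a = of_real (ksq a)"
proof -
  have "(\<lambda>n. fock_inner (kernel_poly n a) (kernel_poly n a)) \<longlonglongrightarrow> of_real (ksq a)"
    unfolding fock_inner_self by (intro tendsto_of_real fock_sq_kernel_poly_tendsto)
  then show ?thesis using fock_inner_kernel_poly_tendsto LIMSEQ_unique by blast
qed

lemma kip_cnj: "cnj (kip a c) = kip c a"
proof -
  have "(\<lambda>n. fock_inner (kernel_poly n c) (kernel_poly n a)) \<longlonglongrightarrow> cnj (kip a c)"
    using tendsto_cnj[OF fock_inner_kernel_poly_tendsto[of a c]] by (simp add: fock_inner_cnj)
  then show ?thesis using fock_inner_kernel_poly_tendsto LIMSEQ_unique by blast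
qed

lemma kip_cauchy_schwarz: "(cmod (kip a c))\<^sup>2 \<le> ksq a * ksq c"
  by (rule LIMSEQ_le[where X = "\<lambda>n. (cmod (fock_inner (kernel_poly n a) (kernel_poly n c)))\<^sup>2"
        and Y = "\<lambda>n. fock_sq (kernel_poly n a) * fock_sq (kernel_poly n c)"])
     (auto intro!: tendsto_intros fock_inner_kernel_poly_tendsto fock_sq_kernel_poly_tendsto fock_inner_cauchy_schwarz)

text \<open>The quotient map from the Fock space is contractive. The norm of the evaluated function
  is expressed by testing against all combinations of kernels; for \<open>n\<close> large enough
  this test is an inner product with \<open>kernel_poly n e\<close>.\<close>

lemma kip_peval_le: "(cmod (\<Sum>i\<in>X. cnj (e i) * peval (b i) x))\<^sup>2 \<le> fock_sq x * ksq e"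
proof -
  have "\<exists>n. keys x \<subseteq> words_upto n n"
  proof -
    define n where "n = Max (insert 0 (wlen ` keys x) \<union> (\<Union>w\<in>keys x. Suc ` set (letters w)))"
    have fin: "finite (insert 0 (wlen ` keys x) \<union> (\<Union>w\<in>keys x. Suc ` set (letters w)))" by simp
    have "wlen w \<le> n" if "w \<in> keys x" for w
      unfolding n_def by (rule Max_ge[OF fin]) (use that in auto)
    moreover have "Suc k \<le> n" if "w \<in> keys x" "k \<in> set (letters w)" for w k
      unfolding n_def by (rule Max_ge[OF fin]) (use that in auto)
    ultimately have "keys x \<subseteq> words_upto n n" by (auto simp: words_upto_def words_def Suc_le_eq)
    then show ?thesis ..
  qed
  then obtain n where n: "keys x \<subseteq> words_upto n n" ..
  have "(cmod (\<Sum>i\<in>X. cnj (e i) * peval (b i) x))\<^sup>2 \<le> fock_sq x * fock_sq (kernel_poly n e)"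
    using fock_inner_cauchy_schwarz[of x "kernel_poly n e"] fock_inner_kernel_poly[OF n, of e] by simp
  also have "\<dots> \<le> fock_sq x * ksq e" by (intro mult_left_mono fock_sq_kernel_poly_le) simp
  finally show ?thesis .
qed

text \<open>Points of the open ball damp long words: the squared weights of the words longer than
  \<open>n\<close> sum to at most a geometric tail, uniformly in the number \<open>d\<close> of
  letters.\<close>

lemma peval_long_le:
  assumes i: "i \<in> X" and r: "keys r \<subseteq> words d" "\<forall>w\<in>keys r. n < wlen w"
  shows "(cmod (peval (b i) r))\<^sup>2 \<le> fock_sq r * (rho i ^ Suc n / (1 - rho i))"
proof -
  define M where "M = Max (insert n (wlen ` keys r))"
  have Mn: "n \<le> M" by (simp add: M_def)
  have M: "keys r \<subseteq> words_upto d M - words_upto d n"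
    using r by (force simp: words_upto_def M_def)
  define l where "l = (\<Sum>k<d. (cmod (b i k))\<^sup>2)"
  have l: "0 \<le> l" "l \<le> rho i"
    unfolding l_def rho_def using b_summable[OF i] by (auto intro: sum_nonneg sum_le_suminf)
  have S: "(\<Sum>w\<in>words_upto d m. (cmod (mon (b i) w))\<^sup>2) = (\<Sum>j\<le>m. l ^ j)" for m
  proof -
    have "complex_of_real l = (\<Sum>k<d. b i k * cnj (b i k))"
      by (simp add: l_def complex_norm_square del: of_real_power)
    moreover have "complex_of_real (\<Sum>w\<in>words_upto d m. (cmod (mon (b i) w))\<^sup>2)
        = (\<Sum>w\<in>words_upto d m. mon (b i) w * cnj (mon (b i) w))"
      by (simp add: complex_norm_square del: of_real_power)
    ultimately have "complex_of_real (\<Sum>w\<in>words_upto d m. (cmod (mon (b i) w))\<^sup>2) = of_real (\<Sum>j\<le>m. l ^ j)"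
      by (simp add: sum_words_upto)
    then show ?thesis by (metis of_real_eq_iff)
  qed
  have "(cmod (peval (b i) r))\<^sup>2 \<le> fock_sq r * (\<Sum>w\<in>keys r. (cmod (mon (b i) w))\<^sup>2)"
    unfolding peval_def fock_sq_def by (rule cauchy_schwarz_sum)
  also have "(\<Sum>w\<in>keys r. (cmod (mon (b i) w))\<^sup>2) \<le> (\<Sum>w\<in>words_upto d M - words_upto d n. (cmod (mon (b i) w))\<^sup>2)"
    using M by (intro sum_mono2) auto
  also have "\<dots> = (\<Sum>j\<le>M. l ^ j) - (\<Sum>j\<le>n. l ^ j)"
  proof -
    have "words_upto d n \<subseteq> words_upto d M" using Mn by (auto simp: words_upto_def)
    then show ?thesis by (simp add: sum_diff S)
  qed
  also have "\<dots> \<le> (\<Sum>j\<le>M. rho i ^ j) - (\<Sum>j\<le>n. rho i ^ j)"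
  proof -
    have split: "(\<Sum>j\<le>M. f j) - (\<Sum>j\<le>n. f j) = (\<Sum>j\<in>{..M} - {..n}. f j)" for f :: "nat \<Rightarrow> real"
      using Mn by (subst sum_diff) auto
    show ?thesis unfolding split using l by (intro sum_mono power_mono) auto
  qed
  also have "\<dots> = (rho i ^ Suc n - rho i ^ Suc M) / (1 - rho i)"
    using rho[OF i] sum_gp0[of "rho i"] by (simp add: diff_divide_distrib)
  also have "\<dots> \<le> rho i ^ Suc n / (1 - rho i)"
    using rho[OF i] by (intro divide_right_mono) auto
  finally show ?thesis by (simp add: mult_left_mono)
qed

subsection \<open>Hankel operators\<close>

text \<open>The coefficient vector of the kernel at \<open>i\<close>; in particular
  \<open>delta z0\<close> stands for the constant function 1.\<close>

definition delta :: "'x \<Rightarrow> 'x \<Rightarrow> complex" where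
  "delta i = (\<lambda>j. if j = i then 1 else 0)"

lemma kip_delta: "i \<in> X \<Longrightarrow> kip a (delta i) = ev a i"
  by (simp add: kip_def delta_def if_distrib[of cnj] if_distrib[of "\<lambda>z. _ * z"] sum.delta cong: if_cong)

lemma cmod_ev_le: "i \<in> X \<Longrightarrow> (cmod (ev a i))\<^sup>2 \<le> ksq a * ksq (delta i)"
  using kip_cauchy_schwarz[of a "delta i"] by (simp add: kip_delta)

text \<open>\<open>hankel \<beta> u\<close> is the coefficient vector of \<open>C u\<close>, where \<open>C\<close> is the antilinear Hankel operator with
  \<open>\<langle>w, C u\<rangle> = (\<Sum>i\<in>X. \<beta> i * u i * w i)\<close>.\<close>

definition hankel :: "('x \<Rightarrow> complex) \<Rightarrow> ('x \<Rightarrow> complex) \<Rightarrow> 'x \<Rightarrow> complex" where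
  "hankel \<beta> u i = cnj (\<beta> i * u i)"

definition hankel_contraction :: "('x \<Rightarrow> complex) \<Rightarrow> bool" where
  "hankel_contraction \<beta> \<longleftrightarrow> (\<forall>a. ksq (hankel \<beta> (ev a)) \<le> ksq a)"

lemma kip_hankel: "kip a (hankel \<beta> u) = (\<Sum>i\<in>X. \<beta> i * u i * ev a i)"
  by (simp add: kip_def hankel_def mult_ac)

text \<open>Here \<open>s\<close> is given by its values on \<open>X\<close>, and its norm bound by
  tests against combinations of kernels. Testing with the Hankel image of
  \<open>ev (hankel \<beta> s)\<close> produces \<open>ksq (hankel \<beta> s)\<close>, and the
  contraction property closes the estimate.\<close>

lemma ksq_hankel_le:
  assumes \<beta>: "hankel_contraction \<beta>" and s: "\<And>e. (cmod (\<Sum>i\<in>X. cnj (e i) * s i))\<^sup>2 \<le> B * ksq e" and "B \<ge> 0"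
  shows "ksq (hankel \<beta> s) \<le> B"
proof -
  let ?e = "hankel \<beta> s"
  have "(\<Sum>i\<in>X. cnj (hankel \<beta> (ev ?e) i) * s i) = kip ?e ?e"
    unfolding kip_hankel by (simp add: hankel_def mult_ac)
  then have "(ksq ?e)\<^sup>2 \<le> B * ksq (hankel \<beta> (ev ?e))"
    using s[of "hankel \<beta> (ev ?e)"] by (simp add: kip_self)
  also have "\<dots> \<le> B * ksq ?e" using \<beta> \<open>B \<ge> 0\<close> by (auto simp: hankel_contraction_def intro: mult_left_mono)
  finally have "ksq ?e * ksq ?e \<le> B * ksq ?e" by (simp add: power2_eq_square)
  then show ?thesis using \<open>B \<ge> 0\<close> ksq_nonneg[of ?e]
    by (cases "ksq ?e = 0") (auto simp: mult_le_cancel_right)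
qed

text \<open>Write the lift of \<open>a\<close> as \<open>x * u\<close> with \<open>u\<close> almost inner. Evaluations commute, so the factor \<open>u\<close>
  can be moved to the lift of \<open>c\<close> at almost no cost in norm. Thus the evaluation \<open>s\<close> of \<open>x\<close> is almost a
  top vector, and \<open>s z0\<close> is the coefficient of \<open>x\<close> at the empty word.\<close>

lemma approximate_top_vector:
  assumes \<beta>: "hankel_contraction \<beta>" and a: "ksq a \<le> 1" and c: "ksq c \<le> 1"
    and ac: "(\<Sum>i\<in>X. \<beta> i * ev a i * ev c i) = 1"
  shows "\<exists>\<tau>>0. \<forall>\<epsilon>>0. \<epsilon> < 1 \<longrightarrow> (\<exists>s U. s z0 = 1 \<and> \<tau> \<le> U \<and> U \<le> 2 \<and>
     (\<forall>e. (cmod (\<Sum>i\<in>X. cnj (e i) * s i))\<^sup>2 * (U - \<epsilon>) \<le> ksq e) \<and> 1 - \<epsilon> \<le> ksq (hankel \<beta> s) * (U + \<epsilon>))"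
proof -
  define vh where "vh w = (\<Sum>j\<in>X. a j * cnj (mon (b j) w))" for w
  have "\<exists>w. vh w \<noteq> 0"
  proof (rule ccontr)
    assume "\<not> ?thesis"
    then have "kernel_poly n a = 0" for n by (auto simp: kernel_poly_def vh_def)
    then have "ksq a = 0" using LIMSEQ_unique[OF fock_sq_kernel_poly_tendsto[of a]] by (simp add: fock_sq_def)
    then have "ev a i = 0" if "i \<in> X" for i using cmod_ev_le[OF that, of a] by simp
    then show False using ac by simp
  qed
  then obtain w1 where "vh w1 \<noteq> 0" by blast
  \<comment> \<open>A shortest word in the lift of \<open>a\<close>. Its coefficient yields a lower
    bound \<open>\<tau>\<close> independent of the truncation and of
    \<open>\<epsilon>\<close>.\<close>
  define w0 where "w0 = arg_min wlen (\<lambda>w. vh w \<noteq> 0)"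
  have w0: "vh w0 \<noteq> 0" unfolding w0_def by (rule arg_min_natI) fact
  have w0min: "vh z = 0" if "wlen z < wlen w0" for z
    using arg_min_nat_le[of "\<lambda>w. vh w \<noteq> 0" z wlen] that by (force simp: w0_def)
  define \<tau> where "\<tau> = (cmod (vh w0))\<^sup>2"
  have \<tau>: "\<tau> > 0" using w0 by (simp add: \<tau>_def)
  show ?thesis
  proof (intro exI[of _ \<tau>] conjI \<tau> allI impI)
    fix \<epsilon> :: real assume \<epsilon>: "\<epsilon> > 0" "\<epsilon> < 1"
    define v where "v n = kernel_poly n a" for n
    define w where "w n = kernel_poly n c" for n
    have v1: "fock_sq (v n) \<le> 1" and w1: "fock_sq (w n) \<le> 1" for n
      using fock_sq_kernel_poly_le a c order_trans unfolding v_def w_def by blast+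
    have "(\<lambda>n. cmod (\<Sum>i\<in>X. \<beta> i * peval (b i) (v n) * peval (b i) (w n))) \<longlonglongrightarrow> cmod (\<Sum>i\<in>X. \<beta> i * ev a i * ev c i)"
      unfolding v_def w_def by (intro tendsto_intros peval_kernel_poly_tendsto)
    then have "\<forall>\<^sub>F n in sequentially. cmod (\<Sum>i\<in>X. \<beta> i * peval (b i) (v n) * peval (b i) (w n)) > 1 - \<epsilon> / 4"
      using \<epsilon> by (intro order_tendstoD(1)) (auto simp: ac)
    moreover have "\<forall>\<^sub>F n in sequentially. w0 \<in> words_upto n n"
    proof -
      define m where "m = Max (insert (wlen w0) (Suc ` set (letters w0)))"
      have "w0 \<in> words_upto n n" if "n \<ge> m" for n
      proof -
        have "Suc k \<le> m" if "k \<in> set (letters w0)" for k unfolding m_def by (rule Max_ge) (use that in auto)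
        moreover have "wlen w0 \<le> m" unfolding m_def by (rule Max_ge) auto
        ultimately show ?thesis using that by (fastforce simp: words_upto_def words_def)
      qed
      then show ?thesis by (auto simp: eventually_sequentially)
    qed
    ultimately have "\<forall>\<^sub>F n in sequentially. cmod (\<Sum>i\<in>X. \<beta> i * peval (b i) (v n) * peval (b i) (w n)) > 1 - \<epsilon> / 4
        \<and> w0 \<in> words_upto n n" by (rule eventually_conj)
    then obtain N where N: "cmod (\<Sum>i\<in>X. \<beta> i * peval (b i) (v N) * peval (b i) (w N)) > 1 - \<epsilon> / 4"
      and w0N: "w0 \<in> words_upto N N" using eventually_happens'[OF sequentially_bot] by blast
    have low: "\<tau> \<le> fock_sq (k * v N)" if "lookup k 0 = 1" for k
    proof -
      have "lookup (k * v N) w0 = lookup (v N) w0"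
        using that w0min by (intro lookup_times_first_term) (auto simp: v_def lookup_kernel_poly vh_def)
      also have "\<dots> = vh w0" using w0N by (simp add: v_def lookup_kernel_poly vh_def)
      finally show ?thesis using cmod_lookup_le_fock_sq[of "k * v N" w0] by (simp add: \<tau>_def)
    qed
    define \<theta> where "\<theta> = min \<epsilon> (\<tau> / 2) / 2"
    have \<theta>: "\<theta> > 0" "2 * \<theta> \<le> \<epsilon>" "4 * \<theta> \<le> \<tau>" using \<epsilon> \<tau> by (auto simp: \<theta>_def)
    \<comment> \<open>The order of choices matters: the truncation \<open>N\<close> is fixed, and
      only now a length \<open>n\<close> is taken so large that words longer than \<open>n\<close>
      are negligible at the points of \<open>X\<close>. The factor 6 anticipates the bound on
      \<open>fock_sq (r * v N)\<close>.\<close>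
    define err where "err n = (\<Sum>i\<in>X. cmod (\<beta> i) * cmod (peval (b i) (w N)) * sqrt (6 * (rho i ^ Suc n / (1 - rho i))))" for n
    have "err \<longlonglongrightarrow> (\<Sum>i\<in>X. cmod (\<beta> i) * cmod (peval (b i) (w N)) * sqrt (6 * (0 / (1 - rho i))))"
      unfolding err_def
      by (intro tendsto_intros LIMSEQ_Suc LIMSEQ_power_zero) (use rho in \<open>fastforce+\<close>)
    then have "\<forall>\<^sub>F n in sequentially. err n < \<epsilon> / 4"
      using \<epsilon> by (intro order_tendstoD(2)) auto
    then have "\<forall>\<^sub>F n in sequentially. err n < \<epsilon> / 4 \<and> n \<ge> N"
      using eventually_ge_at_top by (rule eventually_conj)
    then obtain n where n: "err n < \<epsilon> / 4" "n \<ge> N" using eventually_happens'[OF sequentially_bot] by blast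
    obtain k x r where k: "lookup k 0 = 1" "keys k \<subseteq> words N" and x: "x * k = 1 + r"
      "keys x \<subseteq> words_upto N n" "lookup x 0 = 1" and r: "keys r \<subseteq> words N" "\<forall>w\<in>keys r. n < wlen w"
      and U: "\<tau> \<le> fock_sq (k * v N)" "fock_sq (k * v N) \<le> fock_sq (v N) + 1"
      and iso: "\<And>g. keys g \<subseteq> words_upto N n \<Longrightarrow> \<bar>fock_sq (g * (k * v N)) - fock_sq g * fock_sq (k * v N)\<bar> \<le> \<theta> * fock_sq g"
      and xu: "fock_sq (x * (k * v N)) \<le> fock_sq (v N) + \<theta> * fock_sq x"
      using almost_inner_factor[of N \<tau> "v N" \<theta> n] low \<theta>(1) by blast
    define u where "u = k * v N"
    define s where "s i = peval (b i) x" for i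
    \<comment> \<open>The squared norm of \<open>x * u\<close> is at most
      \<open>1 + \<theta> * fock_sq x\<close>, and near isometry bounds it below by
      \<open>fock_sq x * (fock_sq u - \<theta>)\<close>.\<close>
    have xU: "fock_sq x * (fock_sq u - 2 * \<theta>) \<le> 1"
      using iso[OF x(2)] xu v1[of N] by (simp add: u_def algebra_simps abs_le_iff)
    have x\<tau>: "\<theta> * fock_sq x \<le> 1 / 2"
    proof -
      have "fock_sq x * (2 * \<theta>) \<le> fock_sq x * (fock_sq u - 2 * \<theta>)"
        using \<theta> U by (intro mult_left_mono) (auto simp: u_def)
      then have "fock_sq x * (2 * \<theta>) \<le> 1" using xU by linarith
      then show ?thesis by (simp add: mult_ac)
    qed
    have rv: "fock_sq (r * v N) \<le> 6"
    proof -
      have "r * v N = x * u - v N" using x(1) by (simp add: u_def mult.assoc[symmetric] distrib_right)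
      then have "fock_sq (r * v N) \<le> 2 * fock_sq (x * u) + 2 * fock_sq (v N)" using fock_sq_minus_le by metis
      then show ?thesis using xu x\<tau> v1[of N] by (simp add: u_def)
    qed
    have up: "fock_sq (w N * u) \<le> fock_sq u + \<epsilon>"
    proof -
      have "keys (w N) \<subseteq> words_upto N n"
        using keys_kernel_poly[of N c] n by (force simp: w_def words_upto_def)
      from iso[OF this] have "fock_sq (w N * u) \<le> fock_sq (w N) * fock_sq u + \<theta> * fock_sq (w N)"
        by (simp add: u_def abs_le_iff)
      also have "\<dots> \<le> 1 * fock_sq u + \<theta> * 1"
        using w1 \<theta> by (intro add_mono mult_mono) auto
      finally show ?thesis using \<theta> by simp
    qed
    \<comment> \<open>The exchange of factors: at each point the value of
      \<open>x * (k * v N) * w N\<close> is regrouped so that \<open>x\<close> stays alone in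
      \<open>s\<close> and \<open>u\<close> moves to \<open>w N\<close>; the defect \<open>r\<close>
      of the left inverse gives the second sum.\<close>
    have B: "(\<Sum>i\<in>X. cnj (hankel \<beta> s i) * peval (b i) (w N * u)) =
        (\<Sum>i\<in>X. \<beta> i * peval (b i) (v N) * peval (b i) (w N)) + (\<Sum>i\<in>X. \<beta> i * peval (b i) (w N) * peval (b i) (r * v N))"
    proof -
      have xk: "peval (b i) x * peval (b i) k = 1 + peval (b i) r" for i
        using x(1) by (metis peval_times peval_add peval_one)
      have "cnj (hankel \<beta> s i) * peval (b i) (w N * u) = \<beta> i * peval (b i) (v N) * peval (b i) (w N)
          + \<beta> i * peval (b i) (w N) * peval (b i) (r * v N)" for i
      proof -
        have "cnj (hankel \<beta> s i) * peval (b i) (w N * u) =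
            (peval (b i) x * peval (b i) k) * (\<beta> i * peval (b i) (v N) * peval (b i) (w N))"
          by (simp add: hankel_def s_def u_def peval_times mult_ac)
        also have "\<dots> = \<beta> i * peval (b i) (v N) * peval (b i) (w N)
            + \<beta> i * peval (b i) (w N) * peval (b i) (r * v N)"
          unfolding xk by (simp add: peval_times algebra_simps)
        finally show ?thesis .
      qed
      then show ?thesis by (simp add: sum.distrib)
    qed
    have "cmod (\<Sum>i\<in>X. \<beta> i * peval (b i) (w N) * peval (b i) (r * v N)) \<le> err n"
      unfolding err_def
    proof (rule order_trans[OF norm_sum], rule sum_mono)
      fix i assume i: "i \<in> X"
      have "keys (r * v N) \<subseteq> words N"
        using keys_kernel_poly[of N a] by (intro keys_words_times r) (auto simp: v_def words_upto_def)
      moreover have "\<forall>w\<in>keys (r * v N). n < wlen w"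
        using keys_mult[of r "v N"] r by fastforce
      ultimately have "(cmod (peval (b i) (r * v N)))\<^sup>2 \<le> fock_sq (r * v N) * (rho i ^ Suc n / (1 - rho i))"
        by (rule peval_long_le[OF i])
      also have "\<dots> \<le> 6 * (rho i ^ Suc n / (1 - rho i))"
        using rv rho[OF i] by (intro mult_right_mono) auto
      finally have "cmod (peval (b i) (r * v N)) \<le> sqrt (6 * (rho i ^ Suc n / (1 - rho i)))"
        by (rule real_le_rsqrt)
      then show "cmod (\<beta> i * peval (b i) (w N) * peval (b i) (r * v N)) \<le>
          cmod (\<beta> i) * cmod (peval (b i) (w N)) * sqrt (6 * (rho i ^ Suc n / (1 - rho i)))"
        by (simp add: norm_mult mult_left_mono)
    qed
    then have "cmod (\<Sum>i\<in>X. cnj (hankel \<beta> s i) * peval (b i) (w N * u)) \<ge> 1 - \<epsilon> / 2"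
      unfolding B using N n(1) norm_diff_ineq[of "\<Sum>i\<in>X. \<beta> i * peval (b i) (v N) * peval (b i) (w N)"
          "\<Sum>i\<in>X. \<beta> i * peval (b i) (w N) * peval (b i) (r * v N)"] by linarith
    then have "(1 - \<epsilon> / 2)\<^sup>2 \<le> (cmod (\<Sum>i\<in>X. cnj (hankel \<beta> s i) * peval (b i) (w N * u)))\<^sup>2"
      using \<epsilon> by (intro power_mono) auto
    also have "\<dots> \<le> fock_sq (w N * u) * ksq (hankel \<beta> s)" by (rule kip_peval_le)
    also have "\<dots> \<le> (fock_sq u + \<epsilon>) * ksq (hankel \<beta> s)" using up by (intro mult_right_mono) auto
    finally have lower: "1 - \<epsilon> \<le> ksq (hankel \<beta> s) * (fock_sq u + \<epsilon>)"
    proof -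
      assume "(1 - \<epsilon> / 2)\<^sup>2 \<le> (fock_sq u + \<epsilon>) * ksq (hankel \<beta> s)"
      moreover have "1 - \<epsilon> \<le> (1 - \<epsilon> / 2)\<^sup>2" by (simp add: power2_diff)
      ultimately show ?thesis by (simp add: mult.commute)
    qed
    \<comment> \<open>In the limit \<open>s\<close> has squared norm at most the reciprocal of
      \<open>fock_sq u\<close>, while by \<open>lower\<close> its Hankel image has at least that
      squared norm.\<close>
    have upper: "(cmod (\<Sum>i\<in>X. cnj (e i) * s i))\<^sup>2 * (fock_sq u - \<epsilon>) \<le> ksq e" for e
    proof (cases "fock_sq u - \<epsilon> \<ge> 0")
      case True
      have "(cmod (\<Sum>i\<in>X. cnj (e i) * s i))\<^sup>2 * (fock_sq u - \<epsilon>) \<le> (fock_sq x * ksq e) * (fock_sq u - \<epsilon>)"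
        unfolding s_def using True by (intro mult_right_mono kip_peval_le)
      also have "\<dots> = ksq e * (fock_sq x * (fock_sq u - \<epsilon>))" by simp
      also have "\<dots> \<le> ksq e * 1"
      proof (rule mult_left_mono)
        have "fock_sq x * (fock_sq u - \<epsilon>) \<le> fock_sq x * (fock_sq u - 2 * \<theta>)" using \<theta> by (intro mult_left_mono) auto
        then show "fock_sq x * (fock_sq u - \<epsilon>) \<le> 1" using xU by linarith
      qed simp
      finally show ?thesis by simp
    next
      case False
      then have "(cmod (\<Sum>i\<in>X. cnj (e i) * s i))\<^sup>2 * (fock_sq u - \<epsilon>) \<le> 0"
        by (intro mult_nonneg_nonpos) auto
      then show ?thesis using ksq_nonneg order_trans by blast
    qed
    have "s z0 = 1" using x(3) by (simp add: s_def b_z0 peval_null)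
    moreover have "fock_sq u \<le> 2" using U v1[of N] by (simp add: u_def)
    ultimately show "\<exists>s U. s z0 = 1 \<and> \<tau> \<le> U \<and> U \<le> 2 \<and>
     (\<forall>e. (cmod (\<Sum>i\<in>X. cnj (e i) * s i))\<^sup>2 * (U - \<epsilon>) \<le> ksq e) \<and> 1 - \<epsilon> \<le> ksq (hankel \<beta> s) * (U + \<epsilon>)"
      using U lower upper unfolding u_def by blast
  qed
qed

lemma ev_add: "ev (\<lambda>i. a i + c i) j = ev a j + ev c j"
  by (simp add: ev_def ring_distribs sum.distrib)

lemma ev_scale: "ev (\<lambda>i. t * a i) j = t * ev a j"
  by (simp add: ev_def sum_distrib_left mult_ac)

lemma kip_add_left: "kip (\<lambda>i. a i + c i) e = kip a e + kip c e"
  by (simp add: kip_def ev_add ring_distribs sum.distrib)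

lemma kip_add_right: "kip e (\<lambda>i. a i + c i) = kip e a + kip e c"
  by (simp add: kip_def ring_distribs sum.distrib)

lemma kip_scale_left: "kip (\<lambda>i. t * a i) e = t * kip a e"
  by (simp add: kip_def ev_scale sum_distrib_left mult_ac)

lemma kip_scale_right: "kip e (\<lambda>i. t * a i) = cnj t * kip e a"
  by (simp add: kip_def sum_distrib_left mult_ac)

lemma ksq_scale: "ksq (\<lambda>i. t * a i) = (cmod t)\<^sup>2 * ksq a"
proof -
  have "complex_of_real (ksq (\<lambda>i. t * a i)) = (t * cnj t) * kip a a"
    by (simp add: kip_self[symmetric] kip_scale_left kip_scale_right)
  also have "\<dots> = of_real ((cmod t)\<^sup>2 * ksq a)"
    by (simp add: kip_self complex_norm_square del: of_real_power)
  finally show ?thesis by (metis of_real_eq_iff)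
qed

lemma ksq_add_scale: "ksq (\<lambda>i. a i + t * c i) = ksq a + 2 * Re (cnj t * kip a c) + (cmod t)\<^sup>2 * ksq c"
proof -
  have "kip (\<lambda>i. a i + t * c i) (\<lambda>i. a i + t * c i)
      = kip a a + (cnj t * kip a c + cnj (cnj t * kip a c)) + t * cnj t * kip c c"
    by (simp add: kip_add_left kip_add_right kip_scale_left kip_scale_right kip_cnj algebra_simps)
  also have "\<dots> = of_real (ksq a + 2 * Re (cnj t * kip a c) + (cmod t)\<^sup>2 * ksq c)"
    by (simp only: kip_self complex_add_cnj complex_norm_square[symmetric] of_real_add of_real_mult)
  finally show ?thesis unfolding kip_self by (metis of_real_eq_iff)
qed

lemma ksq_tendsto:
  "(\<And>i. i \<in> X \<Longrightarrow> (\<lambda>k. a k i) \<longlonglongrightarrow> c i) \<Longrightarrow> (\<lambda>k. ksq (a k)) \<longlonglongrightarrow> ksq c"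
  unfolding ksq_def kip_def ev_def by (intro tendsto_intros) auto

lemma ev_tendsto:
  "(\<And>i. i \<in> X \<Longrightarrow> (\<lambda>k. a k i) \<longlonglongrightarrow> c i) \<Longrightarrow> (\<lambda>k. ev (a k) j) \<longlonglongrightarrow> ev c j"
  unfolding ev_def by (intro tendsto_intros) auto

text \<open>A limit of approximate top vectors exists by compactness: \<open>U\<close> stays between
  \<open>\<tau>\<close> and 2, which bounds the vectors, and \<open>s z0 = 1\<close> survives. On
  the limit the contraction preserves the norm, and equality forces
  \<open>C (C s) = s\<close>.\<close>

lemma top_vector:
  assumes \<beta>: "hankel_contraction \<beta>" and a: "ksq a \<le> 1" and c: "ksq c \<le> 1"
    and ac: "(\<Sum>i\<in>X. \<beta> i * ev a i * ev c i) = 1"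
  shows "\<exists>s. s z0 = 1 \<and> (\<forall>i\<in>X. s i = ev (hankel \<beta> (ev (hankel \<beta> s))) i)"
proof -
  obtain \<tau> where \<tau>: "\<tau> > 0" and app: "\<And>\<epsilon>. \<epsilon> > 0 \<Longrightarrow> \<epsilon> < 1 \<Longrightarrow> \<exists>s U. s z0 = 1 \<and> \<tau> \<le> U \<and> U \<le> 2 \<and>
     (\<forall>e. (cmod (\<Sum>i\<in>X. cnj (e i) * s i))\<^sup>2 * (U - \<epsilon>) \<le> ksq e) \<and> 1 - \<epsilon> \<le> ksq (hankel \<beta> s) * (U + \<epsilon>)"
    using approximate_top_vector[OF assms] by blast
  \<comment> \<open>The cap \<open>\<tau> / 2\<close> keeps \<open>U - \<epsilon>\<close> at least
    \<open>\<tau> / 2\<close>, which makes the values of \<open>s\<close> bounded.\<close>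
  define \<epsilon> where "\<epsilon> k = min (1/2) (\<tau>/2) * inverse (real (Suc k))" for k
  have \<epsilon>: "0 < \<epsilon> k" "\<epsilon> k \<le> 1/2" "\<epsilon> k \<le> \<tau>/2" for k
  proof -
    have "\<epsilon> k \<le> min (1/2) (\<tau>/2) * 1"
      unfolding \<epsilon>_def using \<tau> by (intro mult_left_mono) (auto simp: inverse_le_1_iff)
    then show "\<epsilon> k \<le> 1/2" "\<epsilon> k \<le> \<tau>/2" by auto
  qed (use \<tau> in \<open>simp add: \<epsilon>_def\<close>)
  have \<epsilon>lim: "\<epsilon> \<longlonglongrightarrow> 0"
    unfolding \<epsilon>_def using tendsto_mult_right_zero[OF LIMSEQ_inverse_real_of_nat] by blast
  define P where "P k s U \<longleftrightarrow> s z0 = 1 \<and> \<tau> \<le> U \<and> U \<le> 2 \<and>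
     (\<forall>e. (cmod (\<Sum>i\<in>X. cnj (e i) * s i))\<^sup>2 * (U - \<epsilon> k) \<le> ksq e) \<and> 1 - \<epsilon> k \<le> ksq (hankel \<beta> s) * (U + \<epsilon> k)"
    for k s U
  have "\<exists>s U. P k s U" for k
    unfolding P_def using app[of "\<epsilon> k"] \<epsilon>[of k] by auto
  then obtain s U where P: "\<And>k. P k (s k) (U k)" by metis
  \<comment> \<open>\<open>None\<close> carries \<open>U\<close> and \<open>Some i\<close> the value
    of \<open>s\<close> at \<open>i\<close>, so that one subsequence serves both.\<close>
  define f where "f k = (\<lambda>p. case p of None \<Rightarrow> complex_of_real (U k) | Some i \<Rightarrow> s k i)" for k
  have bnd: "bounded (range (\<lambda>k. f k p))" if "p \<in> insert None (Some ` X)" for p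
  proof (cases p)
    case None
    have "\<bar>U k\<bar> \<le> 2" for k using P[of k] \<tau> by (auto simp: P_def)
    then show ?thesis using None by (auto intro!: boundedI[where B = 2] simp: f_def)
  next
    case (Some i)
    have i: "i \<in> X" using that Some by auto
    have "cmod (s k i) \<le> sqrt (ksq (delta i) / (\<tau> / 2))" for k
    proof (rule real_le_rsqrt)
      have "(\<Sum>j\<in>X. cnj (delta i j) * s k j) = s k i"
        using i by (simp add: delta_def if_distrib[of cnj] if_distrib[of "\<lambda>z. z * _"] sum.delta cong: if_cong)
      then have "(cmod (s k i))\<^sup>2 * (U k - \<epsilon> k) \<le> ksq (delta i)"
        using P[of k] unfolding P_def by metis
      moreover have "(cmod (s k i))\<^sup>2 * (\<tau> / 2) \<le> (cmod (s k i))\<^sup>2 * (U k - \<epsilon> k)"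
        using P[of k] \<epsilon>[of k] by (intro mult_left_mono) (auto simp: P_def)
      ultimately show "(cmod (s k i))\<^sup>2 \<le> ksq (delta i) / (\<tau> / 2)"
        using \<tau> by (simp add: field_simps)
    qed
    then show ?thesis using Some by (auto intro!: boundedI simp: f_def)
  qed
  obtain l r where r: "strict_mono (r :: nat \<Rightarrow> nat)"
    and l: "\<forall>p\<in>insert None (Some ` X). (\<lambda>k. f (r k) p) \<longlonglongrightarrow> l p"
    using bounded_sequences_convergent_subsequence[of "insert None (Some ` X)" f] bnd by auto
  define \<sigma> where "\<sigma> i = l (Some i)" for i
  define V where "V = Re (l None)"
  have slim: "(\<lambda>k. s (r k) i) \<longlonglongrightarrow> \<sigma> i" if "i \<in> X" for i
    using l that by (auto simp: f_def \<sigma>_def)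
  have Ulim: "(\<lambda>k. U (r k)) \<longlonglongrightarrow> V"
    using tendsto_Re[of "\<lambda>k. f (r k) None"] l by (auto simp: f_def V_def)
  have el: "(\<lambda>k. \<epsilon> (r k)) \<longlonglongrightarrow> 0"
    using LIMSEQ_subseq_LIMSEQ[OF \<epsilon>lim r] by (simp add: o_def)
  have V: "V > 0"
    using LIMSEQ_le_const[OF Ulim, of \<tau>] P \<tau> by (fastforce simp: P_def)
  have s0: "\<sigma> z0 = 1"
    using LIMSEQ_unique[OF slim[OF z0X], of 1] P by (simp add: P_def)
  have upper: "(cmod (\<Sum>i\<in>X. cnj (e i) * \<sigma> i))\<^sup>2 * V \<le> ksq e" for e
  proof (rule LIMSEQ_le_const2)
    show "(\<lambda>k. (cmod (\<Sum>i\<in>X. cnj (e i) * s (r k) i))\<^sup>2 * (U (r k) - \<epsilon> (r k))) \<longlonglongrightarrow>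
        (cmod (\<Sum>i\<in>X. cnj (e i) * \<sigma> i))\<^sup>2 * V"
      using Ulim el slim by (auto intro!: tendsto_eq_intros)
  qed (use P in \<open>auto simp: P_def\<close>)
  have hlim: "(\<lambda>k. ksq (hankel \<beta> (s (r k)))) \<longlonglongrightarrow> ksq (hankel \<beta> \<sigma>)"
    unfolding hankel_def by (intro ksq_tendsto tendsto_intros slim)
  have lower: "1 \<le> ksq (hankel \<beta> \<sigma>) * V"
  proof (rule LIMSEQ_le)
    show "(\<lambda>k. 1 - \<epsilon> (r k)) \<longlonglongrightarrow> 1" using el by (auto intro!: tendsto_eq_intros)
    show "(\<lambda>k. ksq (hankel \<beta> (s (r k))) * (U (r k) + \<epsilon> (r k))) \<longlonglongrightarrow> ksq (hankel \<beta> \<sigma>) * V"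
      using Ulim el hlim by (auto intro!: tendsto_eq_intros)
  qed (use P in \<open>auto simp: P_def\<close>)
  define B where "B = 1 / V"
  define e where "e = hankel \<beta> \<sigma>"
  define e2 where "e2 = hankel \<beta> (ev e)"
  have B: "B > 0" using V by (simp add: B_def)
  have upB: "(cmod (\<Sum>i\<in>X. cnj (h i) * \<sigma> i))\<^sup>2 \<le> B * ksq h" for h
    using upper[of h] V by (simp add: B_def field_simps)
  have eB: "ksq e = B"
    using ksq_hankel_le[OF \<beta> upB] B lower V by (intro antisym) (auto simp: e_def B_def field_simps)
  have e2B: "ksq e2 \<le> B"
    using \<beta> eB by (auto simp: e2_def hankel_contraction_def)
  have pair: "(\<Sum>i\<in>X. cnj (e2 i) * \<sigma> i) = of_real B"
  proof -
    have "(\<Sum>i\<in>X. cnj (e2 i) * \<sigma> i) = kip e e"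
      unfolding e_def[of] kip_hankel by (simp add: e2_def e_def hankel_def mult_ac)
    then show ?thesis by (simp add: kip_self eB)
  qed
  \<comment> \<open>The equality case of Cauchy-Schwarz by variation: the functional
    \<open>L\<close> attains its bound at \<open>e2\<close>, so the first-order change in the
    direction of the kernel at \<open>i\<close> must agree with that of \<open>ksq\<close>.\<close>
  have "\<sigma> i = ev e2 i" if i: "i \<in> X" for i
  proof -
    define L where "L h = (\<Sum>i\<in>X. cnj (h i) * \<sigma> i)" for h
    have "cmod (L (delta i) - kip e2 (delta i)) \<le> 0 * sqrt (ksq (delta i))"
    proof (rule quadratic_near_minimum[where t = 0 and U = 0])
      fix z :: complex
      let ?h = "delta i"
      have "L (\<lambda>j. e2 j + z * ?h j) = of_real B + cnj z * L ?h"
        using pair by (simp add: L_def ring_distribs sum.distrib sum_distrib_left mult_ac)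
      then have "(cmod (of_real B + cnj z * L ?h))\<^sup>2 \<le> B * ksq (\<lambda>j. e2 j + z * ?h j)"
        using upB[of "\<lambda>j. e2 j + z * ?h j"] by (simp add: L_def)
      also have "\<dots> \<le> B * (B + 2 * Re (cnj z * kip e2 ?h) + (cmod z)\<^sup>2 * ksq ?h)"
        unfolding ksq_add_scale using e2B B by (intro mult_left_mono) auto
      finally have "(cmod (of_real B + cnj z * L ?h))\<^sup>2 \<le> B * (B + 2 * Re (cnj z * kip e2 ?h) + (cmod z)\<^sup>2 * ksq ?h)" .
      moreover have "(cmod (of_real B + w))\<^sup>2 \<ge> B * (B + 2 * Re w)" for w
        using zero_le_power2[of "Re w"] zero_le_power2[of "Im w"]
        by (simp add: cmod_power2) (simp add: power2_eq_square algebra_simps)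
      then have "(cmod (of_real B + cnj z * L ?h))\<^sup>2 \<ge> B * (B + 2 * Re (cnj z * L ?h))" .
      ultimately have "B * (B + 2 * Re (cnj z * L ?h)) \<le> B * (B + 2 * Re (cnj z * kip e2 ?h) + (cmod z)\<^sup>2 * ksq ?h)"
        by linarith
      then have "B + 2 * Re (cnj z * L ?h) \<le> B + 2 * Re (cnj z * kip e2 ?h) + (cmod z)\<^sup>2 * ksq ?h"
        using B by (simp only: mult_le_cancel_left_pos)
      then show "0 \<le> 0 - 2 * Re (cnj z * (L ?h - kip e2 ?h)) + (cmod z)\<^sup>2 * ksq ?h"
        by (simp add: right_diff_distrib)
    qed auto
    then have "L (delta i) = ev e2 i" by (simp add: kip_delta[OF i])
    moreover have "L (delta i) = \<sigma> i"
      using i by (simp add: L_def delta_def if_distrib[of cnj] if_distrib[of "\<lambda>z. z * _"] sum.delta cong: if_cong)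
    ultimately show ?thesis by simp
  qed
  then show ?thesis using s0 unfolding e2_def e_def by blast
qed

text \<open>Otherwise normalized vectors with \<open>ksq\<close> tending to 0 would have a limit of
  coefficient norm 1 with \<open>ksq\<close> equal to 0, against the independence of the
  kernels.\<close>

lemma ksq_lower_bound: "\<exists>l>0. \<forall>a. l * (\<Sum>i\<in>X. (cmod (a i))\<^sup>2) \<le> ksq a"
proof (rule ccontr)
  assume neg: "\<not> ?thesis"
  have "\<exists>a. (\<Sum>i\<in>X. (cmod (a i))\<^sup>2) = 1 \<and> ksq a \<le> inverse (real (Suc k))" for k
  proof -
    obtain a where a: "ksq a < inverse (real (Suc k)) * (\<Sum>i\<in>X. (cmod (a i))\<^sup>2)"
      using neg by (meson inverse_positive_iff_positive not_le of_nat_0_less_iff zero_less_Suc)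
    define S where "S = (\<Sum>i\<in>X. (cmod (a i))\<^sup>2)"
    have "0 < inverse (real (Suc k)) * S" using a ksq_nonneg[of a] unfolding S_def by linarith
    then have S: "S > 0" by (simp add: zero_less_mult_iff)
    let ?a = "\<lambda>i. of_real (1 / sqrt S) * a i"
    have "(\<Sum>i\<in>X. (cmod (?a i))\<^sup>2) = (1 / sqrt S)\<^sup>2 * S"
      unfolding S_def by (simp only: norm_mult power_mult_distrib sum_distrib_left norm_of_real power2_abs)
    then have "(\<Sum>i\<in>X. (cmod (?a i))\<^sup>2) = 1" using S by (simp add: power_divide)
    moreover have "ksq ?a \<le> inverse (real (Suc k))"
      unfolding ksq_scale using a S by (simp add: norm_divide power_divide S_def[symmetric] divide_le_eq)
    ultimately show ?thesis by (intro exI[of _ ?a] conjI)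
  qed
  then obtain a where a: "\<And>k. (\<Sum>i\<in>X. (cmod (a k i))\<^sup>2) = 1" "\<And>k. ksq (a k) \<le> inverse (real (Suc k))"
    by metis
  have "cmod (a k i) \<le> 1" if "i \<in> X" for k i
  proof -
    have "(cmod (a k i))\<^sup>2 \<le> 1" using a(1)[of k] member_le_sum[OF that, of "\<lambda>i. (cmod (a k i))\<^sup>2"] by simp
    then show ?thesis by (simp add: power_le_one_iff)
  qed
  then have "bounded (range (\<lambda>k. a k i))" if "i \<in> X" for i
    using that by (auto intro!: boundedI)
  then obtain l r where r: "strict_mono (r :: nat \<Rightarrow> nat)" and l: "\<forall>i\<in>X. (\<lambda>k. a (r k) i) \<longlonglongrightarrow> l i"
    using bounded_sequences_convergent_subsequence[of X a] by auto
  have "(\<lambda>k. \<Sum>i\<in>X. (cmod (a (r k) i))\<^sup>2) \<longlonglongrightarrow> (\<Sum>i\<in>X. (cmod (l i))\<^sup>2)"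
    using l by (intro tendsto_intros) auto
  then have l1: "(\<Sum>i\<in>X. (cmod (l i))\<^sup>2) = 1" by (simp only: a(1) LIMSEQ_const_iff)
  have "ksq l \<le> 0"
  proof (rule LIMSEQ_le)
    show "(\<lambda>k. ksq (a (r k))) \<longlonglongrightarrow> ksq l" using l by (intro ksq_tendsto) auto
    show "(\<lambda>k. inverse (real (Suc (r k)))) \<longlonglongrightarrow> 0"
      using LIMSEQ_subseq_LIMSEQ[OF LIMSEQ_inverse_real_of_nat r] by (simp add: o_def)
  qed (use a in auto)
  then have "l i = 0" if "i \<in> X" for i using ksq_definite[of l i] ksq_nonneg[of l] that by auto
  then show False using l1 by simp
qed

section \<open>The operator norm as a norm on symbols\<close>

definition gauge_set :: "('x \<Rightarrow> complex) \<Rightarrow> real set" where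
  "gauge_set \<beta> = {cmod (\<Sum>i\<in>X. \<beta> i * ev a i * ev c i) | a c. ksq a \<le> 1 \<and> ksq c \<le> 1}"

text \<open>The norm of the Hankel operator with symbol \<open>\<beta>\<close>, written as the
  supremum of a pairing that is linear in \<open>\<beta>\<close>.\<close>

definition hgauge :: "('x \<Rightarrow> complex) \<Rightarrow> real" where
  "hgauge \<beta> = Sup (gauge_set \<beta>)"

lemma gauge_set_nonempty: "0 \<in> gauge_set \<beta>"
proof -
  have "ksq (\<lambda>_. 0) = 0" by (simp add: ksq_def kip_def)
  then show ?thesis unfolding gauge_set_def by (intro CollectI exI[of _ "\<lambda>_. 0"]) (simp add: ev_def)
qed

lemma pairing_bound:
  assumes "ksq a \<le> 1" "ksq c \<le> 1"
  shows "cmod (\<Sum>i\<in>X. \<beta> i * ev a i * ev c i) \<le> (\<Sum>i\<in>X. cmod (\<beta> i) * ksq (delta i))"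
proof (rule order_trans[OF norm_sum], rule sum_mono)
  fix i assume i: "i \<in> X"
  have le: "cmod (ev a i) \<le> sqrt (ksq (delta i))" if "ksq a \<le> 1" for a
  proof (rule real_le_rsqrt)
    have "ksq a * ksq (delta i) \<le> 1 * ksq (delta i)" using that by (intro mult_right_mono) auto
    then show "(cmod (ev a i))\<^sup>2 \<le> ksq (delta i)" using cmod_ev_le[OF i, of a] by simp
  qed
  have "cmod (ev a i) * cmod (ev c i) \<le> sqrt (ksq (delta i)) * sqrt (ksq (delta i))"
    using le assms by (intro mult_mono) auto
  then show "cmod (\<beta> i * ev a i * ev c i) \<le> cmod (\<beta> i) * ksq (delta i)"
    by (simp add: norm_mult mult.assoc mult_left_mono)
qed

lemma gauge_set_bdd: "bdd_above (gauge_set \<beta>)"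
  unfolding gauge_set_def
  by (rule bdd_aboveI[of _ "\<Sum>i\<in>X. cmod (\<beta> i) * ksq (delta i)"]) (use pairing_bound in blast)

lemma hgauge_upper:
  "ksq a \<le> 1 \<Longrightarrow> ksq c \<le> 1 \<Longrightarrow> cmod (\<Sum>i\<in>X. \<beta> i * ev a i * ev c i) \<le> hgauge \<beta>"
  unfolding hgauge_def by (rule cSup_upper[OF _ gauge_set_bdd]) (auto simp: gauge_set_def)

lemma hgauge_least:
  assumes "\<And>a c. ksq a \<le> 1 \<Longrightarrow> ksq c \<le> 1 \<Longrightarrow> cmod (\<Sum>i\<in>X. \<beta> i * ev a i * ev c i) \<le> B"
  shows "hgauge \<beta> \<le> B"
proof -
  have "gauge_set \<beta> \<noteq> {}" using gauge_set_nonempty by blast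
  then show ?thesis unfolding hgauge_def
    by (rule cSup_least) (use assms in \<open>auto simp: gauge_set_def\<close>)
qed

lemma hgauge_nonneg: "0 \<le> hgauge \<beta>"
  unfolding hgauge_def by (rule cSup_upper[OF gauge_set_nonempty gauge_set_bdd])

lemma hgauge_diff: "hgauge \<beta> \<le> hgauge \<gamma> + (\<Sum>i\<in>X. cmod (\<beta> i - \<gamma> i) * ksq (delta i))"
proof (rule hgauge_least)
  fix a c assume ac: "ksq a \<le> 1" "ksq c \<le> 1"
  have "(\<Sum>i\<in>X. \<beta> i * ev a i * ev c i) =
      (\<Sum>i\<in>X. \<gamma> i * ev a i * ev c i) + (\<Sum>i\<in>X. (\<beta> i - \<gamma> i) * ev a i * ev c i)"
    by (simp add: sum.distrib[symmetric] algebra_simps)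
  then have "cmod (\<Sum>i\<in>X. \<beta> i * ev a i * ev c i) \<le>
      cmod (\<Sum>i\<in>X. \<gamma> i * ev a i * ev c i) + cmod (\<Sum>i\<in>X. (\<beta> i - \<gamma> i) * ev a i * ev c i)"
    by (simp add: norm_triangle_ineq)
  then show "cmod (\<Sum>i\<in>X. \<beta> i * ev a i * ev c i) \<le> hgauge \<gamma> + (\<Sum>i\<in>X. cmod (\<beta> i - \<gamma> i) * ksq (delta i))"
    using hgauge_upper[OF ac, of \<gamma>] pairing_bound[OF ac, of "\<lambda>i. \<beta> i - \<gamma> i"] by linarith
qed

lemma hgauge_cong:
  assumes "\<And>i. i \<in> X \<Longrightarrow> \<beta> i = \<gamma> i" shows "hgauge \<beta> = hgauge \<gamma>"
proof -
  have "(\<Sum>i\<in>X. cmod (\<beta> i - \<gamma> i) * ksq (delta i)) = 0" "(\<Sum>i\<in>X. cmod (\<gamma> i - \<beta> i) * ksq (delta i)) = 0"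
    by (rule sum.neutral, simp add: assms)+
  then show ?thesis using hgauge_diff[of \<beta> \<gamma>] hgauge_diff[of \<gamma> \<beta>] by simp
qed

lemma hgauge_tendsto:
  assumes "\<And>i. i \<in> X \<Longrightarrow> (\<lambda>k. \<beta> k i) \<longlonglongrightarrow> \<gamma> i"
  shows "(\<lambda>k. hgauge (\<beta> k)) \<longlonglongrightarrow> hgauge \<gamma>"
proof -
  have "(\<lambda>k. hgauge (\<beta> k) - hgauge \<gamma>) \<longlonglongrightarrow> 0"
  proof (rule Lim_null_comparison)
    show "\<forall>\<^sub>F k in sequentially. norm (hgauge (\<beta> k) - hgauge \<gamma>) \<le> (\<Sum>i\<in>X. cmod (\<beta> k i - \<gamma> i) * ksq (delta i))"
    proof (intro always_eventually allI)
      fix k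
      show "norm (hgauge (\<beta> k) - hgauge \<gamma>) \<le> (\<Sum>i\<in>X. cmod (\<beta> k i - \<gamma> i) * ksq (delta i))"
        using hgauge_diff[of "\<beta> k" \<gamma>] hgauge_diff[of \<gamma> "\<beta> k"] by (simp add: norm_minus_commute abs_le_iff)
    qed
    have "(\<lambda>k. \<Sum>i\<in>X. cmod (\<beta> k i - \<gamma> i) * ksq (delta i)) \<longlonglongrightarrow> (\<Sum>i\<in>X. cmod (\<gamma> i - \<gamma> i) * ksq (delta i))"
      using assms by (intro tendsto_intros) auto
    then show "(\<lambda>k. \<Sum>i\<in>X. cmod (\<beta> k i - \<gamma> i) * ksq (delta i)) \<longlonglongrightarrow> 0" by simp
  qed
  then show ?thesis by (simp add: LIM_zero_iff)
qed

lemma hgauge_scale_le: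
  assumes "t \<ge> 0" shows "hgauge (\<lambda>i. of_real t * \<beta> i) \<le> t * hgauge \<beta>"
proof (rule hgauge_least)
  fix a c assume ac: "ksq a \<le> 1" "ksq c \<le> 1"
  have "(\<Sum>i\<in>X. of_real t * \<beta> i * ev a i * ev c i) = of_real t * (\<Sum>i\<in>X. \<beta> i * ev a i * ev c i)"
    by (simp add: sum_distrib_left mult_ac)
  then show "cmod (\<Sum>i\<in>X. of_real t * \<beta> i * ev a i * ev c i) \<le> t * hgauge \<beta>"
    using assms hgauge_upper[OF ac, of \<beta>] by (simp add: norm_mult mult_left_mono)
qed

lemma pairing_scale:
  "(\<Sum>i\<in>X. \<beta> i * ev (\<lambda>i. s * a i) i * ev (\<lambda>i. t * c i) i) = s * t * (\<Sum>i\<in>X. \<beta> i * ev a i * ev c i)"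
  by (simp add: ev_scale sum_distrib_left mult_ac)

lemma hgauge_pairing:
  assumes a: "ksq a > 0" and c: "ksq c > 0"
  shows "cmod (\<Sum>i\<in>X. \<beta> i * ev a i * ev c i) \<le> hgauge \<beta> * (sqrt (ksq a) * sqrt (ksq c))"
proof -
  let ?a = "\<lambda>i. of_real (1 / sqrt (ksq a)) * a i" and ?c = "\<lambda>i. of_real (1 / sqrt (ksq c)) * c i"
  have "ksq ?a \<le> 1" "ksq ?c \<le> 1"
    unfolding ksq_scale using assms by (simp_all add: norm_divide power_divide)
  from hgauge_upper[OF this, of \<beta>]
  have "cmod (\<Sum>i\<in>X. \<beta> i * ev ?a i * ev ?c i) \<le> hgauge \<beta>" .
  then have "\<bar>1 / sqrt (ksq a)\<bar> * \<bar>1 / sqrt (ksq c)\<bar> * cmod (\<Sum>i\<in>X. \<beta> i * ev a i * ev c i) \<le> hgauge \<beta>"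
    unfolding pairing_scale norm_mult norm_of_real .
  then show ?thesis using assms by (simp add: field_simps)
qed

text \<open>Pairing with the image vector itself yields its squared norm. The degenerate cases are
  split off because \<open>hgauge_pairing\<close> normalizes both arguments.\<close>

lemma hankel_contraction_if_hgauge_le_1:
  assumes "hgauge \<beta> \<le> 1" shows "hankel_contraction \<beta>"
  unfolding hankel_contraction_def
proof
  fix a
  let ?e = "hankel \<beta> (ev a)"
  show "ksq ?e \<le> ksq a"
  proof (cases "ksq a = 0 \<or> ksq ?e = 0")
    case True
    moreover have "ksq ?e = 0" if "ksq a = 0"
    proof -
      have "?e i = 0" if "i \<in> X" for i
        using cmod_ev_le[OF that, of a] \<open>ksq a = 0\<close> by (simp add: hankel_def)
      then show ?thesis by (simp add: ksq_def kip_def)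
    qed
    ultimately show ?thesis by auto
  next
    case False
    then have pos: "ksq a > 0" "ksq ?e > 0" 
      by (simp_all only: less_le ksq_nonneg) auto
    have "(\<Sum>i\<in>X. \<beta> i * ev a i * ev ?e i) = of_real (ksq ?e)"
      by (simp add: kip_hankel[symmetric] kip_self)
    then have "ksq ?e \<le> hgauge \<beta> * (sqrt (ksq a) * sqrt (ksq ?e))"
      using hgauge_pairing[OF pos, of \<beta>] pos by simp
    also have "\<dots> \<le> 1 * (sqrt (ksq a) * sqrt (ksq ?e))"
      using assms by (intro mult_right_mono) auto
    finally have "sqrt (ksq ?e) * sqrt (ksq ?e) \<le> sqrt (ksq a) * sqrt (ksq ?e)" using pos by simp
    then have "sqrt (ksq ?e) \<le> sqrt (ksq a)" by (rule mult_right_le_imp_le) (use pos in simp)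
    then show ?thesis by simp
  qed
qed

lemma ev_delta_z0: "i \<in> X \<Longrightarrow> ev (delta z0) i = 1"
  by (simp add: ev_def delta_def if_distrib[of "\<lambda>z. _ * z"] sum.delta K_z0 cong: if_cong)

lemma ksq_delta_z0: "ksq (delta z0) = 1"
  by (simp add: ksq_def kip_delta ev_delta_z0)

text \<open>The image of the constant function 1 has the conjugate of \<open>\<beta>\<close> as
  coefficient vector and norm at most \<open>hgauge \<beta>\<close>. This encloses the unit ball of
  symbols in a cube.\<close>

lemma hgauge_coefficient_bound: "\<exists>R>0. \<forall>\<beta>. \<forall>i\<in>X. cmod (\<beta> i) \<le> R * hgauge \<beta>"
proof -
  obtain l where l: "l > 0" "\<And>a. l * (\<Sum>i\<in>X. (cmod (a i))\<^sup>2) \<le> ksq a" using ksq_lower_bound by blast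
  have "cmod (\<beta> i) \<le> 1 / sqrt l * hgauge \<beta>" if i: "i \<in> X" for \<beta> i
  proof -
    let ?e = "hankel \<beta> (ev (delta z0))"
    have "l * (cmod (\<beta> i))\<^sup>2 \<le> l * (\<Sum>i\<in>X. (cmod (\<beta> i))\<^sup>2)"
      using l i by (intro mult_left_mono member_le_sum) auto
    also have "\<dots> = l * (\<Sum>i\<in>X. (cmod (?e i))\<^sup>2)" by (simp add: hankel_def ev_delta_z0 cong: sum.cong)
    also have "\<dots> \<le> ksq ?e" by (rule l)
    also have "\<dots> \<le> (hgauge \<beta>)\<^sup>2"
    proof (cases "ksq ?e = 0")
      case False
      then have pos: "ksq ?e > 0" by (simp add: less_le)
      have "(\<Sum>i\<in>X. \<beta> i * ev (delta z0) i * ev ?e i) = of_real (ksq ?e)"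
        by (simp add: kip_hankel[symmetric] kip_self)
      then have "ksq ?e \<le> hgauge \<beta> * sqrt (ksq ?e)"
        using hgauge_pairing[OF _ pos, of "delta z0" \<beta>] pos by (simp add: ksq_delta_z0)
      then have "sqrt (ksq ?e) * sqrt (ksq ?e) \<le> hgauge \<beta> * sqrt (ksq ?e)" using pos by simp
      then have "sqrt (ksq ?e) \<le> hgauge \<beta>" by (rule mult_right_le_imp_le) (use pos in simp)
      then have "(sqrt (ksq ?e))\<^sup>2 \<le> (hgauge \<beta>)\<^sup>2" using pos by (intro power_mono) auto
      then show ?thesis using pos by simp
    qed simp
    finally have "(sqrt l * cmod (\<beta> i))\<^sup>2 \<le> (hgauge \<beta>)\<^sup>2" using l by (simp add: power_mult_distrib)
    then have "sqrt l * cmod (\<beta> i) \<le> hgauge \<beta>" using hgauge_nonneg by (rule power2_le_imp_le)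
    then show ?thesis using l by (simp add: field_simps)
  qed
  then show ?thesis using l by (intro exI[of _ "1 / sqrt l"]) auto
qed

text \<open>Unit vectors have bounded coefficients, so a maximizing sequence has a limit; a phase in
  the second argument turns modulus 1 into the value 1.\<close>

lemma hgauge_attained:
  assumes "hgauge \<beta> = 1"
  shows "\<exists>a c. ksq a \<le> 1 \<and> ksq c \<le> 1 \<and> (\<Sum>i\<in>X. \<beta> i * ev a i * ev c i) = 1"
proof -
  have "\<exists>a c. ksq a \<le> 1 \<and> ksq c \<le> 1 \<and> cmod (\<Sum>i\<in>X. \<beta> i * ev a i * ev c i) > 1 - inverse (real (Suc k))" for k
    using less_cSupD[of "gauge_set \<beta>" "1 - inverse (real (Suc k))"] gauge_set_nonempty[of \<beta>] assms
    by (fastforce simp: gauge_set_def hgauge_def)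
  then obtain a c where a: "\<And>k. ksq (a k) \<le> 1" and c: "\<And>k. ksq (c k) \<le> 1"
    and ac: "\<And>k. cmod (\<Sum>i\<in>X. \<beta> i * ev (a k) i * ev (c k) i) > 1 - inverse (real (Suc k))"
    by metis
  obtain l where l: "l > 0" "\<And>a. l * (\<Sum>i\<in>X. (cmod (a i))\<^sup>2) \<le> ksq a" using ksq_lower_bound by blast
  have cb: "cmod (d i) \<le> sqrt (1 / l)" if "i \<in> X" "ksq d \<le> 1" for d i
  proof (rule real_le_rsqrt)
    have "l * (cmod (d i))\<^sup>2 \<le> l * (\<Sum>i\<in>X. (cmod (d i))\<^sup>2)"
      using l that by (intro mult_left_mono member_le_sum) auto
    then have "l * (cmod (d i))\<^sup>2 \<le> 1" using l(2)[of d] that(2) by linarith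
    then show "(cmod (d i))\<^sup>2 \<le> 1 / l" using l(1) by (simp add: field_simps)
  qed
  define f where "f k = (\<lambda>(t, i). if t then a k i else c k i)" for k
  have "bounded (range (\<lambda>k. f k p))" if "p \<in> UNIV \<times> X" for p
    using that cb a c by (cases p) (auto intro!: boundedI simp: f_def)
  then obtain m r where r: "strict_mono (r :: nat \<Rightarrow> nat)" and m: "\<forall>p\<in>UNIV \<times> X. (\<lambda>k. f (r k) p) \<longlonglongrightarrow> m p"
    using bounded_sequences_convergent_subsequence[of "(UNIV :: bool set) \<times> X" f] by auto
  define A where "A i = m (True, i)" for i
  define C where "C i = m (False, i)" for i
  have Al: "(\<lambda>k. a (r k) i) \<longlonglongrightarrow> A i" and Cl: "(\<lambda>k. c (r k) i) \<longlonglongrightarrow> C i" if "i \<in> X" for i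
    using m[rule_format, of "(True, i)"] m[rule_format, of "(False, i)"] that by (auto simp: f_def A_def C_def)
  have A1: "ksq A \<le> 1" by (rule LIMSEQ_le_const2[OF ksq_tendsto[OF Al]]) (use a in auto)
  have C1: "ksq C \<le> 1" by (rule LIMSEQ_le_const2[OF ksq_tendsto[OF Cl]]) (use c in auto)
  define S where "S = (\<Sum>i\<in>X. \<beta> i * ev A i * ev C i)"
  have "1 \<le> cmod S"
  proof (rule LIMSEQ_le)
    show "(\<lambda>k. cmod (\<Sum>i\<in>X. \<beta> i * ev (a (r k)) i * ev (c (r k)) i)) \<longlonglongrightarrow> cmod S"
      unfolding S_def by (intro tendsto_intros ev_tendsto Al Cl)
    show "(\<lambda>k. 1 - inverse (real (Suc (r k)))) \<longlonglongrightarrow> 1"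
      using tendsto_diff[OF tendsto_const[of "1 :: real"] LIMSEQ_subseq_LIMSEQ[OF LIMSEQ_inverse_real_of_nat r]]
      by (simp add: o_def)
  qed (use ac in \<open>auto intro: less_imp_le\<close>)
  moreover have "cmod S \<le> 1" using hgauge_upper[OF A1 C1, of \<beta>] assms by (simp add: S_def)
  ultimately have S: "cmod S = 1" by simp
  let ?C = "\<lambda>i. cnj S * C i"
  have "ksq ?C \<le> 1" unfolding ksq_scale using C1 S by simp
  moreover have "(\<Sum>i\<in>X. \<beta> i * ev A i * ev ?C i) = cnj S * S"
    using pairing_scale[of \<beta> 1 A "cnj S" C] unfolding S_def[symmetric] by simp
  then have "(\<Sum>i\<in>X. \<beta> i * ev A i * ev ?C i) = 1"
    using S complex_norm_square[of S] by (simp add: mult.commute)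
  ultimately show ?thesis using A1 by blast
qed

section \<open>A fixed point in the unit ball of symbols\<close>

definition gauge_retraction :: "('x \<Rightarrow> complex) \<Rightarrow> 'x \<Rightarrow> complex" where
  "gauge_retraction \<beta> = (\<lambda>i. of_real (1 / max 1 (hgauge \<beta>)) * \<beta> i)"

lemma hgauge_gauge_retraction_le: "hgauge (gauge_retraction \<beta>) \<le> 1"
proof -
  have "hgauge (gauge_retraction \<beta>) \<le> 1 / max 1 (hgauge \<beta>) * hgauge \<beta>"
    unfolding gauge_retraction_def by (rule hgauge_scale_le) simp
  also have "\<dots> \<le> 1" by (simp add: divide_le_eq)
  finally show ?thesis .
qed

lemma hgauge_gauge_retraction_eq: "hgauge \<beta> \<ge> 1 \<Longrightarrow> hgauge (gauge_retraction \<beta>) = 1"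
proof (rule antisym[OF hgauge_gauge_retraction_le])
  assume g: "hgauge \<beta> \<ge> 1"
  have "hgauge \<beta> = hgauge (\<lambda>i. of_real (hgauge \<beta>) * gauge_retraction \<beta> i)"
    using g by (intro hgauge_cong) (simp add: gauge_retraction_def max_def)
  also have "\<dots> \<le> hgauge \<beta> * hgauge (gauge_retraction \<beta>)" by (rule hgauge_scale_le) (use g in simp)
  finally have "hgauge \<beta> * 1 \<le> hgauge \<beta> * hgauge (gauge_retraction \<beta>)" by simp
  then show "1 \<le> hgauge (gauge_retraction \<beta>)" by (rule mult_left_le_imp_le) (use g in simp)
qed

lemma gauge_retraction_id: "hgauge \<beta> \<le> 1 \<Longrightarrow> gauge_retraction \<beta> = \<beta>"
  by (simp add: gauge_retraction_def max_def)

lemma gauge_retraction_tendsto: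
  assumes "\<And>i. i \<in> X \<Longrightarrow> (\<lambda>k. \<beta> k i) \<longlonglongrightarrow> \<gamma> i" and "i \<in> X"
  shows "(\<lambda>k. gauge_retraction (\<beta> k) i) \<longlonglongrightarrow> gauge_retraction \<gamma> i"
  unfolding gauge_retraction_def by (intro tendsto_intros hgauge_tendsto assms) auto

text \<open>Fixed points of \<open>fixpoint_map y\<close> are the symbols \<open>\<beta>\<close> for which the vector \<open>1 + C y\<close> satisfies
  \<open>C (1 + C y) = y\<close>.\<close>

definition fixpoint_map :: "('x \<Rightarrow> complex) \<Rightarrow> ('x \<Rightarrow> complex) \<Rightarrow> 'x \<Rightarrow> complex" where
  "fixpoint_map y \<beta> i = cnj (y i) - \<beta> i * ev (hankel \<beta> (ev y)) i"

lemma fixpoint_map_tendsto: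
  assumes "\<And>i. i \<in> X \<Longrightarrow> (\<lambda>k. \<beta> k i) \<longlonglongrightarrow> \<gamma> i" and "i \<in> X"
  shows "(\<lambda>k. fixpoint_map y (\<beta> k) i) \<longlonglongrightarrow> fixpoint_map y \<gamma> i"
  unfolding fixpoint_map_def
proof (intro tendsto_intros assms ev_tendsto)
  show "(\<lambda>k. hankel (\<beta> k) (ev y) j) \<longlonglongrightarrow> hankel \<gamma> (ev y) j" if "j \<in> X" for j
    unfolding hankel_def by (intro tendsto_intros assms that)
qed

text \<open>The function \<open>(1 - C\<^sup>2) y\<close> is orthogonal to the top singular vectors of \<open>C\<close>, while \<open>C 1\<close> is not:
  pairing it with \<open>C s\<close> for a top vector \<open>s\<close> gives the conjugate of \<open>s z0\<close>.\<close>

lemma fixpoint_map_not_multiple: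
  assumes \<beta>: "hgauge \<beta> = 1" and m: "m > 0" and eq: "\<And>i. i \<in> X \<Longrightarrow> fixpoint_map y \<beta> i = of_real m * \<beta> i"
  shows False
proof -
  obtain a c where "ksq a \<le> 1" "ksq c \<le> 1" "(\<Sum>i\<in>X. \<beta> i * ev a i * ev c i) = 1"
    using hgauge_attained[OF \<beta>] by blast
  then obtain s where s0: "s z0 = 1" and s: "\<And>i. i \<in> X \<Longrightarrow> s i = ev (hankel \<beta> (ev (hankel \<beta> s))) i"
    using top_vector[of \<beta> a c] hankel_contraction_if_hgauge_le_1[of \<beta>] \<beta> by auto
  define e where "e = hankel \<beta> s"
  define e2 where "e2 = hankel \<beta> (ev e)"
  define g where "g = hankel \<beta> (ev y)"
  \<comment> \<open>Pairing the symbol with \<open>ev e\<close> is pairing with \<open>C 1\<close>;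
    as the kernel at \<open>z0\<close> is 1, it evaluates \<open>C (C s)\<close> at
    \<open>z0\<close>.\<close>
  have "(\<Sum>i\<in>X. \<beta> i * ev e i) = cnj (ev e2 z0)"
  proof -
    have "ev e2 z0 = (\<Sum>j\<in>X. e2 j)" unfolding ev_def by (rule sum.cong) (simp_all add: K_z0)
    then show ?thesis by (simp add: e2_def hankel_def)
  qed
  also have "\<dots> = 1" using s[OF z0X] s0 by (simp add: e2_def e_def)
  finally have lhs: "(\<Sum>i\<in>X. of_real m * \<beta> i * ev e i) = of_real m"
    by (simp add: mult.assoc sum_distrib_left[symmetric])
  have "(\<Sum>i\<in>X. of_real m * \<beta> i * ev e i) = (\<Sum>i\<in>X. fixpoint_map y \<beta> i * ev e i)"
    by (simp add: eq)
  also have "\<dots> = (\<Sum>i\<in>X. ev e i * cnj (y i)) - (\<Sum>i\<in>X. \<beta> i * ev e i * ev g i)"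
    unfolding sum_subtractf[symmetric] by (rule sum.cong) (simp_all add: fixpoint_map_def g_def algebra_simps)
  also have "(\<Sum>i\<in>X. ev e i * cnj (y i)) = kip e y" by (simp add: kip_def)
  also have "(\<Sum>i\<in>X. \<beta> i * ev e i * ev g i) = kip g e2"
    by (simp add: e2_def kip_hankel)
  \<comment> \<open>Symmetry of the Hankel pairing and \<open>s = C (C s)\<close> turn the second
    term into the first, so the difference is 0.\<close>
  also have "kip g e2 = cnj (\<Sum>i\<in>X. s i * cnj (g i))"
  proof -
    have "(\<Sum>i\<in>X. s i * cnj (g i)) = kip e2 g"
      unfolding kip_def by (rule sum.cong) (simp_all add: s[folded e_def, folded e2_def])
    then show ?thesis by (simp add: kip_cnj)
  qed
  also have "(\<Sum>i\<in>X. s i * cnj (g i)) = kip y e"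
    by (simp add: g_def e_def kip_hankel hankel_def mult_ac)
  also have "cnj (kip y e) = kip e y" by (rule kip_cnj)
  finally show False using lhs m by simp
qed

text \<open>Retracting before and after the map gives a continuous self-map of a whole cube of real
  and imaginary parts. At its fixed point either the outer retraction does nothing, or the value of
  the map is a multiple, with factor above 1, of a symbol of norm 1.\<close>

lemma fixpoint_map_has_fixed_point:
  "\<exists>\<beta>. hankel_contraction \<beta> \<and> (\<forall>i\<in>X. fixpoint_map y \<beta> i = \<beta> i)"
proof -
  define I where "I = X \<times> (UNIV :: bool set)"
  define dec where "dec x i = Complex (x (i, True)) (x (i, False))" for x :: "'x \<times> bool \<Rightarrow> real" and i
  define enc where "enc \<gamma> p = (if snd p then Re (\<gamma> (fst p)) else Im (\<gamma> (fst p)))" for \<gamma> :: "'x \<Rightarrow> complex" and p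
  define F where "F \<beta> = gauge_retraction (fixpoint_map y (gauge_retraction \<beta>))" for \<beta>
  obtain R where R: "R > 0" "\<And>\<beta> i. i \<in> X \<Longrightarrow> cmod (\<beta> i) \<le> R * hgauge \<beta>"
    using hgauge_coefficient_bound by blast
  have "\<exists>x. (\<forall>p\<in>I. \<bar>x p\<bar> \<le> R) \<and> (\<forall>p\<in>I. enc (F (dec x)) p = x p)"
  proof (rule brouwer_finite_cube)
    show "finite I" by (simp add: I_def)
    show "R > 0" by fact
    fix x :: "'x \<times> bool \<Rightarrow> real" and p assume p: "p \<in> I"
    have "cmod (F (dec x) (fst p)) \<le> R * hgauge (F (dec x))" using R p by (auto simp: I_def)
    also have "\<dots> \<le> R * 1" unfolding F_def using R hgauge_gauge_retraction_le by (intro mult_left_mono) auto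
    finally have "cmod (F (dec x) (fst p)) \<le> R" by simp
    moreover have "\<bar>enc (F (dec x)) p\<bar> \<le> cmod (F (dec x) (fst p))"
      by (simp add: enc_def abs_Re_le_cmod abs_Im_le_cmod)
    ultimately show "\<bar>enc (F (dec x)) p\<bar> \<le> R" by linarith
  next
    fix Y :: "nat \<Rightarrow> 'x \<times> bool \<Rightarrow> real" and x p
    assume lim: "\<forall>j\<in>I. (\<lambda>k. Y k j) \<longlonglongrightarrow> x j" and p: "p \<in> I"
    have "(\<lambda>k. dec (Y k) i) \<longlonglongrightarrow> dec x i" if "i \<in> X" for i
      unfolding dec_def using lim that by (intro tendsto_Complex) (auto simp: I_def)
    then have "(\<lambda>k. F (dec (Y k)) i) \<longlonglongrightarrow> F (dec x) i" if "i \<in> X" for i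
      unfolding F_def using that by (intro gauge_retraction_tendsto fixpoint_map_tendsto)
    then show "(\<lambda>k. enc (F (dec (Y k))) p) \<longlonglongrightarrow> enc (F (dec x)) p"
      using p by (auto simp: enc_def I_def intro!: tendsto_Re tendsto_Im)
  qed
  then obtain x where x: "\<And>p. p \<in> I \<Longrightarrow> enc (F (dec x)) p = x p" by blast
  define \<beta> where "\<beta> = dec x"
  have fp: "F \<beta> i = \<beta> i" if "i \<in> X" for i
    using x[of "(i, True)"] x[of "(i, False)"] that
    by (simp add: I_def enc_def \<beta>_def complex_eq_iff) (simp add: dec_def)
  have "hgauge \<beta> = hgauge (F \<beta>)" by (intro hgauge_cong) (simp add: fp)
  also have "\<dots> \<le> 1" unfolding F_def by (rule hgauge_gauge_retraction_le)
  finally have g1: "hgauge \<beta> \<le> 1" .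
  define \<gamma> where "\<gamma> = fixpoint_map y \<beta>"
  have \<beta>\<gamma>: "gauge_retraction \<gamma> i = \<beta> i" if "i \<in> X" for i
    using fp[OF that] g1 by (simp add: F_def gauge_retraction_id \<gamma>_def)
  have "hgauge \<gamma> \<le> 1"
  proof (rule ccontr)
    assume "\<not> hgauge \<gamma> \<le> 1"
    then have g: "hgauge \<gamma> > 1" by simp
    then have "hgauge \<beta> = 1" using hgauge_gauge_retraction_eq[of \<gamma>] hgauge_cong[of \<beta> "gauge_retraction \<gamma>"] \<beta>\<gamma> by simp
    moreover have "fixpoint_map y \<beta> i = of_real (hgauge \<gamma>) * \<beta> i" if "i \<in> X" for i
      using \<beta>\<gamma>[OF that] g by (simp add: \<gamma>_def[symmetric] gauge_retraction_def max_def field_simps)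
    ultimately show False using fixpoint_map_not_multiple[of \<beta> "hgauge \<gamma>" y] g by simp
  qed
  then have "fixpoint_map y \<beta> i = \<beta> i" if "i \<in> X" for i using \<beta>\<gamma>[OF that] by (simp add: gauge_retraction_id \<gamma>_def)
  then show ?thesis using hankel_contraction_if_hgauge_le_1[OF g1] by blast
qed

text \<open>For \<open>h = 1 + C y\<close> symmetry gives \<open>\<langle>h, C y\<rangle> =
  \<langle>y, C h\<rangle> = \<parallel>y\<parallel>\<^sup>2\<close>, while
  \<open>\<langle>h, 1\<rangle> = h z0\<close> is at most \<open>\<parallel>h\<parallel>\<close> in
  modulus. Hence \<open>\<parallel>h\<parallel>\<^sup>2 \<le> \<parallel>h\<parallel> +
  \<parallel>y\<parallel>\<^sup>2\<close>, which after scaling by \<open>r\<close> loses only the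
  summand \<open>r\<close>.\<close>

lemma hankel_factorization:
  assumes r: "r > 0"
  shows "\<exists>\<beta> a. hankel_contraction \<beta> \<and> (\<forall>i\<in>X. c i = hankel \<beta> (ev a) i) \<and> sqrt (ksq a) \<le> sqrt (ksq c) + r"
proof -
  define y where "y = (\<lambda>i. of_real (1 / r) * c i)"
  obtain \<beta> where \<beta>: "hankel_contraction \<beta>" and fp: "\<And>i. i \<in> X \<Longrightarrow> fixpoint_map y \<beta> i = \<beta> i"
    using fixpoint_map_has_fixed_point by blast
  define g where "g = hankel \<beta> (ev y)"
  define h where "h = (\<lambda>i. delta z0 i + g i)"
  define a where "a = (\<lambda>i. of_real r * h i)"
  have evh: "ev h i = 1 + ev g i" if "i \<in> X" for i
    using that by (simp add: h_def ev_add ev_delta_z0)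
  have hy: "cnj (\<beta> i * ev h i) = y i" if "i \<in> X" for i
  proof -
    have "\<beta> i * ev h i = cnj (y i)"
      using fp[OF that] evh[OF that] by (simp add: fixpoint_map_def g_def algebra_simps)
    then show ?thesis by simp
  qed
  have "c i = hankel \<beta> (ev a) i" if "i \<in> X" for i
  proof -
    have "hankel \<beta> (ev a) i = of_real r * cnj (\<beta> i * ev h i)"
      by (simp add: hankel_def a_def ev_scale mult_ac)
    then show ?thesis using hy[OF that] r by (simp add: y_def)
  qed
  moreover have "sqrt (ksq a) \<le> sqrt (ksq c) + r"
  proof -
    define q where "q = sqrt (ksq h)"
    have q0: "q \<ge> 0" by (simp add: q_def)
    have eh: "\<beta> i * ev h i = cnj (y i)" if "i \<in> X" for i
      using fp[OF that] evh[OF that] by (simp add: fixpoint_map_def g_def algebra_simps)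
    have "kip h g = (\<Sum>i\<in>X. ev y i * (\<beta> i * ev h i))"
      unfolding g_def kip_hankel by (simp add: mult_ac)
    also have "\<dots> = kip y y" by (simp add: kip_def eh)
    finally have hg: "kip h g = of_real (ksq y)" by (simp add: kip_self)
    have "kip h h = kip h (delta z0) + kip h g"
      by (subst (2) h_def) (rule kip_add_right)
    then have "ksq h = Re (ev h z0) + ksq y" by (simp add: ksq_def[of h] hg kip_delta)
    moreover have "Re (ev h z0) \<le> q"
    proof -
      have "(cmod (ev h z0))\<^sup>2 \<le> ksq h" using cmod_ev_le[OF z0X, of h] by (simp add: ksq_delta_z0)
      then have "cmod (ev h z0) \<le> q" by (simp add: q_def real_le_rsqrt)
      then show ?thesis using complex_Re_le_cmod order_trans by blast
    qed
    moreover have "q\<^sup>2 = ksq h" by (simp add: q_def)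
    ultimately have "q\<^sup>2 \<le> q + ksq y" by linarith
    moreover have "ksq y = (1 / r)\<^sup>2 * ksq c" unfolding y_def ksq_scale using r by (simp add: norm_divide)
    ultimately have "r\<^sup>2 * q\<^sup>2 \<le> r\<^sup>2 * q + ksq c"
    proof -
      assume 1: "q\<^sup>2 \<le> q + ksq y" and 2: "ksq y = (1 / r)\<^sup>2 * ksq c"
      have "r\<^sup>2 * q\<^sup>2 \<le> r\<^sup>2 * (q + (1 / r)\<^sup>2 * ksq c)" using 1 unfolding 2 by (rule mult_left_mono) simp
      then show ?thesis using r by (simp add: distrib_left power_divide)
    qed
    then have E: "(r * q)\<^sup>2 \<le> r * (r * q) + (sqrt (ksq c))\<^sup>2"
      by (simp add: power2_eq_square mult_ac)
    \<comment> \<open>With \<open>t = r * q\<close>, \<open>E\<close> reads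
      \<open>t * (t - r) \<le> S\<^sup>2\<close>, which fails for \<open>t > S + r\<close>.\<close>
    have "r * q \<le> sqrt (ksq c) + r"
    proof (rule ccontr)
      assume "\<not> ?thesis"
      then have gt: "r * q > sqrt (ksq c) + r" by simp
      define S where "S = sqrt (ksq c)"
      have S: "S \<ge> 0" by (simp add: S_def)
      have "(r * q) * (r * q - r) > (S + r) * (S + r - r)"
      proof -
        have "(S + r) * S \<le> (r * q) * S" using gt S by (intro mult_right_mono) (auto simp: S_def)
        also have "\<dots> < (r * q) * (r * q - r)"
          by (rule mult_strict_left_mono) (use gt S r in \<open>unfold S_def, linarith+\<close>)
        finally show ?thesis by simp
      qed
      moreover have "(S + r) * (S + r - r) \<ge> S\<^sup>2" using S r by (simp add: power2_eq_square distrib_right)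
      moreover have "(r * q) * (r * q - r) \<le> S\<^sup>2"
        using E by (simp add: S_def power2_eq_square right_diff_distrib mult_ac)
      ultimately show False by linarith
    qed
    moreover have "sqrt (ksq a) = r * q"
      unfolding a_def ksq_scale q_def using r by (simp add: real_sqrt_mult)
    ultimately show ?thesis by simp
  qed
  ultimately show ?thesis using \<beta> by blast
qed

end

subsection \<open>Reproducing kernel Hilbert spaces\<close>

context rkhs
begin

lemma diff_mem: "f \<in> H \<Longrightarrow> g \<in> H \<Longrightarrow> (\<lambda>x. f x - g x) \<in> H"
  using add_mem[OF _ scale_mem[of g "-1"], of f] by simp

lemma sum_mem: "(\<And>n. n \<in> I \<Longrightarrow> F n \<in> H) \<Longrightarrow> (\<lambda>x. \<Sum>n\<in>I. F n x) \<in> H"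
  by (induction I rule: infinite_finite_induct) (simp_all add: zero_mem add_mem)

lemma ip_add_right:
  assumes "f \<in> H" "g \<in> H" "h \<in> H" shows "ip h (\<lambda>x. f x + g x) = ip h f + ip h g"
  using assms ip_cnj[of "\<lambda>x. f x + g x" h] ip_cnj[of f h] ip_cnj[of g h] by (simp add: ip_add add_mem)

lemma ip_scale_right:
  assumes "f \<in> H" "h \<in> H" shows "ip h (\<lambda>x. c * f x) = cnj c * ip h f"
  using assms ip_cnj[of "\<lambda>x. c * f x" h] ip_cnj[of f h] by (simp add: ip_scale scale_mem)

lemma ip_zero_left: "h \<in> H \<Longrightarrow> ip (\<lambda>x. 0) h = 0"
  using ip_scale[OF zero_mem, of h 0] by simp

lemma ip_zero_right: "h \<in> H \<Longrightarrow> ip h (\<lambda>x. 0) = 0"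
  using ip_scale_right[OF zero_mem, of h 0] by simp

lemma ip_sum_left:
  "(\<And>n. n \<in> I \<Longrightarrow> F n \<in> H) \<Longrightarrow> h \<in> H \<Longrightarrow> ip (\<lambda>x. \<Sum>n\<in>I. F n x) h = (\<Sum>n\<in>I. ip (F n) h)"
  by (induction I rule: infinite_finite_induct) (simp_all add: ip_zero_left ip_add sum_mem)

lemma ip_self: "f \<in> H \<Longrightarrow> ip f f = of_real ((hnorm ip f)\<^sup>2)"
  using ip_cnj[of f f] ip_nonneg[of f] by (simp add: hnorm_def complex_eq_iff)

lemma hnorm_nonneg: "f \<in> H \<Longrightarrow> 0 \<le> hnorm ip f"
  by (simp add: hnorm_def ip_nonneg)

lemma hnorm_add_scale_squared:
  assumes f: "f \<in> H" and g: "g \<in> H"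
  shows "(hnorm ip (\<lambda>x. f x + t * g x))\<^sup>2
    = (hnorm ip f)\<^sup>2 + 2 * Re (cnj t * ip f g) + (cmod t)\<^sup>2 * (hnorm ip g)\<^sup>2"
proof -
  have tg: "(\<lambda>x. t * g x) \<in> H" using g by (rule scale_mem)
  have "complex_of_real ((hnorm ip (\<lambda>x. f x + t * g x))\<^sup>2)
      = ip f f + (cnj t * ip f g + cnj (cnj t * ip f g)) + (t * cnj t) * ip g g"
    using f g tg ip_cnj[of f g]
    by (simp add: ip_self[symmetric] ip_add ip_add_right ip_scale ip_scale_right add_mem algebra_simps del: of_real_power)
  also have "\<dots> = of_real ((hnorm ip f)\<^sup>2 + 2 * Re (cnj t * ip f g) + (cmod t)\<^sup>2 * (hnorm ip g)\<^sup>2)"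
    using f g by (simp only: ip_self complex_add_cnj complex_norm_square[symmetric] of_real_add of_real_mult)
  finally show ?thesis by (simp only: of_real_eq_iff)
qed

lemma hnorm_eq_0: "f \<in> H \<Longrightarrow> hnorm ip f = 0 \<Longrightarrow> f = (\<lambda>x. 0)"
  using ip_definite[of f] ip_self[of f] by simp

lemma ip_cauchy_schwarz:
  assumes f: "f \<in> H" and g: "g \<in> H"
  shows "cmod (ip f g) \<le> hnorm ip f * hnorm ip g"
proof (cases "hnorm ip g = 0")
  case True
  then show ?thesis using hnorm_eq_0[OF g] ip_zero_right[OF f] by simp
next
  case False
  define c where "c = ip f g"
  define q where "q = (hnorm ip g)\<^sup>2"
  have q: "q > 0" using False by (simp add: q_def)
  define t where "t = - c / of_real q"
  have t: "cnj t * c = - of_real ((cmod c)\<^sup>2 / q)" "(cmod t)\<^sup>2 = (cmod c)\<^sup>2 / q\<^sup>2"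
    using complex_norm_square[of c] q
    by (simp_all add: t_def norm_divide power_divide mult.commute[of "cnj c"])
  have "0 \<le> (hnorm ip f)\<^sup>2 + 2 * Re (cnj t * c) + (cmod t)\<^sup>2 * q"
    using hnorm_add_scale_squared[OF f g, of t] by (simp add: c_def q_def) (metis zero_le_power2)
  also have "\<dots> = (hnorm ip f)\<^sup>2 - (cmod c)\<^sup>2 / q"
    unfolding t using q by (simp add: power2_eq_square field_simps)
  finally have "(cmod c)\<^sup>2 \<le> (hnorm ip f * hnorm ip g)\<^sup>2"
    using q by (simp add: pos_divide_le_eq power_mult_distrib q_def)
  then show ?thesis unfolding c_def by (rule power2_le_imp_le) (simp add: f g hnorm_nonneg)
qed

lemma hnorm_triangle:
  assumes f: "f \<in> H" and g: "g \<in> H"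
  shows "hnorm ip (\<lambda>x. f x + g x) \<le> hnorm ip f + hnorm ip g"
proof (rule power2_le_imp_le)
  have "Re (ip f g) \<le> hnorm ip f * hnorm ip g"
    using ip_cauchy_schwarz[OF f g] complex_Re_le_cmod order_trans by blast
  then show "(hnorm ip (\<lambda>x. f x + g x))\<^sup>2 \<le> (hnorm ip f + hnorm ip g)\<^sup>2"
    using hnorm_add_scale_squared[OF f g, of 1] by (simp add: power2_sum)
qed (simp add: f g hnorm_nonneg)

lemma hdist_commute:
  assumes f: "f \<in> H" and g: "g \<in> H" shows "hdist ip f g = hdist ip g f"
proof -
  have "(\<lambda>x. g x - f x) = (\<lambda>x. (-1) * (f x - g x))" by auto
  then have "ip (\<lambda>x. g x - f x) (\<lambda>x. g x - f x) = ip (\<lambda>x. f x - g x) (\<lambda>x. f x - g x)"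
    using diff_mem[OF f g] by (simp only: ip_scale[OF _ scale_mem] ip_scale_right) simp
  then show ?thesis by (simp add: hdist_def hnorm_def)
qed

lemma hnorm_le_hdist: "f \<in> H \<Longrightarrow> g \<in> H \<Longrightarrow> hnorm ip f \<le> hnorm ip g + hdist ip f g"
  using hnorm_triangle[of g "\<lambda>x. f x - g x"] diff_mem[of f g] by (simp add: hdist_def)

end

section \<open>Combinations of kernels in a Pick space\<close>

locale pick_space = rkhs H ip for H :: "('x \<Rightarrow> complex) set" and ip :: "'x inner_prod" +
  fixes K :: "'x \<Rightarrow> 'x \<Rightarrow> complex" and z0 :: 'x and b :: "'x \<Rightarrow> nat \<Rightarrow> complex" and d :: enat
  assumes reproducing: "reproducing_kernel H ip K"
    and K_normalized: "K z z0 = 1"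
    and b_unit_ball: "b z \<in> unit_ball d"
    and b_base: "b z0 = (\<lambda>n. 0)"
    and K_pick: "K z w = 1 / (1 - seq_inner (b z) (b w))"
begin

definition comb :: "'x set \<Rightarrow> ('x \<Rightarrow> complex) \<Rightarrow> 'x \<Rightarrow> complex" where
  "comb X a z = (\<Sum>i\<in>X. K z i * a i)"

lemma kernel_mem: "(\<lambda>z. K z w) \<in> H" and reproduce: "f \<in> H \<Longrightarrow> ip f (\<lambda>z. K z w) = f w"
  using reproducing by (simp_all add: reproducing_kernel_def)

lemma comb_mem: "comb X a \<in> H"
proof -
  have "(\<lambda>z. \<Sum>i\<in>X. a i * K z i) \<in> H" by (intro sum_mem scale_mem kernel_mem)
  then show ?thesis by (simp add: comb_def[abs_def] mult.commute)
qed

lemma ip_comb: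
  assumes "u \<in> H" shows "ip u (comb X a) = (\<Sum>i\<in>X. cnj (a i) * u i)"
proof -
  have 1: "(\<lambda>z. a i * K z i) \<in> H" for i by (intro scale_mem kernel_mem)
  have "ip (\<lambda>z. \<Sum>i\<in>X. a i * K z i) u = (\<Sum>i\<in>X. ip (\<lambda>z. a i * K z i) u)"
    by (rule ip_sum_left[OF 1 assms])
  also have "\<dots> = (\<Sum>i\<in>X. cnj (cnj (a i) * u i))"
    using ip_cnj[OF assms kernel_mem] by (simp add: ip_scale kernel_mem assms reproduce)
  finally have "ip (comb X a) u = cnj (\<Sum>i\<in>X. cnj (a i) * u i)"
    by (simp add: comb_def[abs_def] mult.commute)
  then show ?thesis using ip_cnj[OF comb_mem assms] by simp
qed

lemma comb_add_scale:
  assumes "finite X" "finite Y"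
  shows "\<exists>Z c. finite Z \<and> comb Z c = (\<lambda>z. comb X a z + t * comb Y e z)"
proof (intro exI conjI ext)
  let ?c = "\<lambda>i. (if i \<in> X then a i else 0) + t * (if i \<in> Y then e i else 0)"
  show "finite (X \<union> Y)" using assms by simp
  fix z
  have X: "(\<Sum>i\<in>X \<union> Y. K z i * (if i \<in> X then a i else 0)) = comb X a z"
    unfolding comb_def using assms by (intro sum.mono_neutral_cong_right) auto
  have Y: "(\<Sum>i\<in>X \<union> Y. K z i * (if i \<in> Y then e i else 0)) = comb Y e z"
    unfolding comb_def using assms by (intro sum.mono_neutral_cong_right) auto
  have "comb (X \<union> Y) ?c z = (\<Sum>i\<in>X \<union> Y. K z i * (if i \<in> X then a i else 0))
      + t * (\<Sum>i\<in>X \<union> Y. K z i * (if i \<in> Y then e i else 0))"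
    unfolding comb_def sum_distrib_left sum.distrib[symmetric]
    by (rule sum.cong) (simp_all add: distrib_left mult.left_commute)
  then show "comb (X \<union> Y) ?c z = comb X a z + t * comb Y e z" by (simp only: X Y)
qed

text \<open>The map \<open>b\<close> may identify points, so kernels can be dependent. In a
  representation with fewest points, a relation with a nonzero coefficient away from
  \<open>z0\<close> would eliminate a point, and one supported at \<open>z0\<close> alone is trivial
  since \<open>K z0 z0 = 1\<close>.\<close>

lemma independent_representation:
  assumes "finite Y"
  shows "\<exists>X c. finite X \<and> z0 \<in> X \<and> comb Y e = comb X c \<and>
     (\<forall>a. comb X a = (\<lambda>z. 0) \<longrightarrow> (\<forall>i\<in>X. a i = 0))"
proof -
  define P where "P n \<longleftrightarrow> (\<exists>X c. finite X \<and> z0 \<in> X \<and> card X = n \<and> comb Y e = comb X c)" for n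
  have "P (card (insert z0 Y))"
  proof -
    have "comb Y e z = comb (insert z0 Y) (\<lambda>i. if i \<in> Y then e i else 0) z" for z
      unfolding comb_def using assms by (intro sum.mono_neutral_cong_left) auto
    then show ?thesis unfolding P_def using assms
      by (intro exI[of _ "insert z0 Y"] exI[of _ "\<lambda>i. if i \<in> Y then e i else 0"]) auto
  qed
  then have "P (LEAST n. P n)" by (rule LeastI)
  then obtain X c where X: "finite X" "z0 \<in> X" "card X = (LEAST n. P n)" "comb Y e = comb X c"
    unfolding P_def by blast
  have "a i = 0" if a: "comb X a = (\<lambda>z. 0)" and i: "i \<in> X" for a i
  proof -
    have *: "a j = 0" if j: "j \<in> X" "j \<noteq> z0" for j
    proof (rule ccontr)
      assume nz: "a j \<noteq> 0"
      have "comb X c z = comb (X - {j}) (\<lambda>i. c i - c j / a j * a i) z" for z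
      proof -
        have "comb (X - {j}) (\<lambda>i. c i - c j / a j * a i) z = comb X (\<lambda>i. c i - c j / a j * a i) z"
          unfolding comb_def using X(1) j nz by (intro sum.mono_neutral_left) auto
        also have "\<dots> = comb X c z - c j / a j * comb X a z"
          by (simp add: comb_def sum_distrib_left right_diff_distrib sum_subtractf mult_ac)
        finally show ?thesis using a by simp
      qed
      then have "P (card (X - {j}))" unfolding P_def using X j
        by (intro exI[of _ "X - {j}"] exI[of _ "\<lambda>i. c i - c j / a j * a i"]) auto
      then have "card X \<le> card (X - {j})" unfolding X(3) by (rule Least_le)
      then show False using X(1) j card_Diff1_less[of X j] by simp
    qed
    have "comb X a z0 = a z0"
      unfolding comb_def using X * by (subst sum.remove[of X z0]) (simp_all add: K_normalized)
    then show ?thesis using a * i by (cases "i = z0") auto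
  qed
  then show ?thesis using X by blast
qed

lemma pick_points_if_independent:
  assumes X: "finite X" "z0 \<in> X" and ind: "\<And>a i. comb X a = (\<lambda>z. 0) \<Longrightarrow> i \<in> X \<Longrightarrow> a i = 0"
  shows "pick_points X z0 b K"
proof
  show "summable (\<lambda>n. (cmod (b i n))\<^sup>2)" "suminf (\<lambda>n. (cmod (b i n))\<^sup>2) < 1" for i
    using b_unit_ball[of i] by (simp_all add: unit_ball_def)
  fix a i assume a: "(\<Sum>i\<in>X. (\<Sum>j\<in>X. K i j * a j) * cnj (a i)) = 0" and i: "i \<in> X"
  have "ip (comb X a) (comb X a) = 0"
    using a by (subst ip_comb[OF comb_mem]) (simp add: comb_def mult.commute)
  then have "comb X a = (\<lambda>z. 0)" by (rule ip_definite[OF comb_mem])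
  then show "a i = 0" using ind i by blast
qed (use X K_pick b_base in auto)

text \<open>The vectors on the left are the images of \<open>comb Y e\<close> under the adjoints of the multiplication
  operators by the \<open>\<phi> n\<close>.\<close>

lemma sum_adjoint_le:
  fixes \<phi> :: "nat \<Rightarrow> 'x \<Rightarrow> complex"
  assumes col: "column_bounded H ip \<phi> 1" and I: "finite I" and Y: "finite Y"
  shows "\<exists>G. (\<forall>n. G n \<in> H \<and> (\<forall>f\<in>H. (\<lambda>x. \<phi> n x * f x) \<in> H \<longrightarrow> ip (\<lambda>x. \<phi> n x * f x) (comb Y e) = ip f (G n)))
     \<and> (\<Sum>n\<in>I. (hnorm ip (G n))\<^sup>2) \<le> (hnorm ip (comb Y e))\<^sup>2"
proof -
  obtain X c where X: "finite X" "z0 \<in> X" "comb Y e = comb X c"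
    and ind: "\<And>a i. comb X a = (\<lambda>z. 0) \<Longrightarrow> i \<in> X \<Longrightarrow> a i = 0"
    using independent_representation[OF Y] by metis
  interpret P: pick_points X z0 b K by (rule pick_points_if_independent[OF X(1,2)]) (rule ind)
  have ev: "P.ev a = comb X a" for a by (simp add: P.ev_def[abs_def] comb_def[abs_def])
  have ksq: "P.ksq a = (hnorm ip (comb X a))\<^sup>2" for a
  proof -
    have "P.kip a a = ip (comb X a) (comb X a)"
      by (simp add: P.kip_def ev ip_comb comb_mem mult.commute)
    then show ?thesis by (simp add: P.ksq_def ip_self comb_mem)
  qed
  define G where "G n = comb X (\<lambda>i. c i * cnj (\<phi> n i))" for n
  define S where "S = (\<Sum>n\<in>I. (hnorm ip (G n))\<^sup>2)"
  have "sqrt S \<le> hnorm ip (comb X c) + r" if r: "r > 0" for r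
  proof -
    obtain \<beta> a where \<beta>: "P.hankel_contraction \<beta>" and c: "\<And>i. i \<in> X \<Longrightarrow> c i = P.hankel \<beta> (P.ev a) i"
      and a: "sqrt (P.ksq a) \<le> sqrt (P.ksq c) + r"
      using P.hankel_factorization[OF r, of c] by blast
    define \<eta> where "\<eta> = comb X a"
    have \<eta>: "\<eta> \<in> H" by (simp add: \<eta>_def comb_mem)
    have \<phi>\<eta>: "(\<lambda>x. \<phi> n x * \<eta> x) \<in> H" for n
      using col \<eta> by (auto simp: column_bounded_def ell2_space_def)
    have sm: "summable (\<lambda>n. (hnorm ip (\<lambda>x. \<phi> n x * \<eta> x))\<^sup>2)"
      and le: "sqrt (suminf (\<lambda>n. (hnorm ip (\<lambda>x. \<phi> n x * \<eta> x))\<^sup>2)) \<le> hnorm ip \<eta>"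
      using col \<eta> by (auto simp: column_bounded_def ell2_space_def ell2_norm_def)
    \<comment> \<open>\<open>G n\<close> is the Hankel image of \<open>\<phi> n * \<eta>\<close>,
      because \<open>c\<close> is that of \<open>\<eta>\<close>. The product need not be a
      combination of kernels at \<open>X\<close>; its values there and its norm are what
      enter.\<close>
    have "(hnorm ip (G n))\<^sup>2 \<le> (hnorm ip (\<lambda>x. \<phi> n x * \<eta> x))\<^sup>2" for n
    proof -
      let ?u = "\<lambda>x. \<phi> n x * \<eta> x"
      have "G n z = comb X (P.hankel \<beta> ?u) z" for z
        unfolding G_def comb_def by (rule sum.cong) (simp_all add: c P.hankel_def \<eta>_def ev)
      then have "G n = comb X (P.hankel \<beta> ?u)" by (rule ext)
      then have "(hnorm ip (G n))\<^sup>2 = P.ksq (P.hankel \<beta> ?u)" by (simp only: ksq)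
      also have "\<dots> \<le> (hnorm ip ?u)\<^sup>2"
      proof (rule P.ksq_hankel_le[OF \<beta>])
        fix e
        have "(cmod (ip ?u (comb X e)))\<^sup>2 \<le> (hnorm ip ?u * hnorm ip (comb X e))\<^sup>2"
          by (rule power_mono[OF ip_cauchy_schwarz[OF \<phi>\<eta> comb_mem]]) simp
        then show "(cmod (\<Sum>i\<in>X. cnj (e i) * ?u i))\<^sup>2 \<le> (hnorm ip ?u)\<^sup>2 * P.ksq e"
          by (simp add: ip_comb[OF \<phi>\<eta>] ksq power_mult_distrib)
      qed simp
      finally show ?thesis .
    qed
    then have "S \<le> (\<Sum>n\<in>I. (hnorm ip (\<lambda>x. \<phi> n x * \<eta> x))\<^sup>2)" unfolding S_def by (intro sum_mono)
    also have "\<dots> \<le> suminf (\<lambda>n. (hnorm ip (\<lambda>x. \<phi> n x * \<eta> x))\<^sup>2)"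
      by (rule sum_le_suminf[OF sm I]) simp
    finally have "sqrt S \<le> sqrt (suminf (\<lambda>n. (hnorm ip (\<lambda>x. \<phi> n x * \<eta> x))\<^sup>2))" by simp
    also note le
    also have "hnorm ip \<eta> = sqrt (P.ksq a)" by (simp add: ksq \<eta>_def hnorm_nonneg comb_mem)
    also note a
    also have "sqrt (P.ksq c) = hnorm ip (comb X c)" by (simp add: ksq hnorm_nonneg comb_mem)
    finally show ?thesis .
  qed
  then have "sqrt S \<le> hnorm ip (comb X c)" by (rule field_le_epsilon)
  then have "S \<le> (hnorm ip (comb X c))\<^sup>2" by (rule sqrt_le_D)
  moreover have "ip (\<lambda>x. \<phi> n x * f x) (comb X c) = ip f (G n)" if "f \<in> H" "(\<lambda>x. \<phi> n x * f x) \<in> H" for n f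
    using that by (simp add: G_def ip_comb mult_ac)
  ultimately show ?thesis unfolding S_def X(3) using comb_mem by (intro exI[of _ G]) (auto simp: G_def)
qed

text \<open>A minimizing sequence of combinations is Cauchy by the parallelogram law. The difference
  of \<open>g\<close> and its limit is orthogonal to every kernel, so it vanishes at every
  point.\<close>

lemma kernel_combinations_dense:
  assumes g: "g \<in> H" and \<epsilon>: "\<epsilon> > 0"
  shows "\<exists>X a. finite X \<and> hdist ip g (comb X a) < \<epsilon>"
proof -
  define D where "D = {(hdist ip g (comb X a))\<^sup>2 | X a. finite X}"
  define m where "m = Inf D"
  have bdd: "bdd_below D" by (rule bdd_belowI[of _ 0]) (auto simp: D_def)
  have lower: "m \<le> (hdist ip g (comb X a))\<^sup>2" if "finite X" for X a
    unfolding m_def by (rule cInf_lower[OF _ bdd]) (use that in \<open>auto simp: D_def\<close>)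
  have "D \<noteq> {}" by (auto simp: D_def)
  have "\<exists>X a. finite X \<and> (hdist ip g (comb X a))\<^sup>2 < m + inverse (real (Suc n))" for n
    using cInf_lessD[OF \<open>D \<noteq> {}\<close>, of "m + inverse (real (Suc n))"] by (auto simp: m_def D_def)
  then obtain X a where fin: "\<And>n. finite (X n)"
    and near: "\<And>n. (hdist ip g (comb (X n) (a n)))\<^sup>2 < m + inverse (real (Suc n))" by metis
  define f where "f n = comb (X n) (a n)" for n
  define h where "h n = (\<lambda>x. g x - f n x)" for n
  have f: "f n \<in> H" and h: "h n \<in> H" for n by (simp_all add: f_def h_def comb_mem diff_mem g)
  have hn: "(hnorm ip (h n))\<^sup>2 < m + inverse (real (Suc n))" for n
    using near[of n] by (simp add: h_def f_def hdist_def)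
  have par: "(hdist ip (f k) (f n))\<^sup>2 \<le> 2 * (inverse (real (Suc k)) + inverse (real (Suc n)))" for k n
  proof -
    obtain Z c where Z: "finite Z" "comb Z c = (\<lambda>z. comb (X k) (a k) z + 1 * comb (X n) (a n) z)"
      using comb_add_scale[OF fin fin] by blast
    obtain Z' c' where Z': "finite Z'" "comb Z' c' = (\<lambda>z. comb {} (\<lambda>_. 0) z + (1/2) * comb Z c z)"
      using comb_add_scale[OF _ Z(1)] by blast
    have c': "comb Z' c' = (\<lambda>z. (f k z + f n z) / 2)" using Z(2) Z'(2) by (simp add: f_def comb_def[of "{}"])
    have "hdist ip g (comb Z' c') = hnorm ip (\<lambda>x. (0::complex) + (1/2) * (h n x + 1 * h k x))"
      unfolding hdist_def c' h_def by (rule arg_cong[of _ _ "hnorm ip"]) (auto simp: field_simps)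
    then have "(hdist ip g (comb Z' c'))\<^sup>2 = (1/4) * (hnorm ip (\<lambda>x. h n x + 1 * h k x))\<^sup>2"
      using hnorm_add_scale_squared[OF zero_mem, of "\<lambda>x. h n x + 1 * h k x" "1/2"] add_mem[OF h h, of n k]
      by (simp add: ip_zero_left hnorm_def[of ip "\<lambda>_. 0"] zero_mem power_divide norm_divide)
    then have 1: "4 * m \<le> (hnorm ip (\<lambda>x. h n x + 1 * h k x))\<^sup>2" using lower[OF Z'(1), of c'] by simp
    have 2: "hdist ip (f k) (f n) = hnorm ip (\<lambda>x. h n x + (-1) * h k x)"
      by (simp add: hdist_def h_def)
    show ?thesis
      using 1 hn[of k] hn[of n] unfolding 2 hnorm_add_scale_squared[OF h h] by simp
  qed
  have "\<exists>p\<in>H. (\<lambda>n. hdist ip (f n) p) \<longlonglongrightarrow> 0"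
  proof (rule complete[OF f])
    fix e :: real assume e: "e > 0"
    then obtain N where N: "inverse (real (Suc N)) < e\<^sup>2 / 4" using reals_Archimedean[of "e\<^sup>2 / 4"] by auto
    have "hdist ip (f k) (f n) < e" if "k \<ge> N" "n \<ge> N" for k n
    proof -
      have "inverse (real (Suc k)) \<le> inverse (real (Suc N))" "inverse (real (Suc n)) \<le> inverse (real (Suc N))"
        using that by (intro le_imp_inverse_le; simp)+
      then have "2 * (inverse (real (Suc k)) + inverse (real (Suc n)))
          \<le> 2 * (inverse (real (Suc N)) + inverse (real (Suc N)))"
        by (intro mult_left_mono add_mono) auto
      also have "\<dots> < e\<^sup>2" using N by (simp del: of_nat_Suc)
      finally have "(hdist ip (f k) (f n))\<^sup>2 < e\<^sup>2" using par[of k n] by simp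
      then show ?thesis by (rule power2_less_imp_less) (use e in simp)
    qed
    then show "\<exists>N. \<forall>m\<ge>N. \<forall>n\<ge>N. hdist ip (f m) (f n) < e" by blast
  qed
  then obtain p where p: "p \<in> H" and lim: "(\<lambda>n. hdist ip (f n) p) \<longlonglongrightarrow> 0" by blast
  define q where "q = (\<lambda>x. g x - p x)"
  have q: "q \<in> H" by (simp add: q_def diff_mem g p)
  have gp: "hnorm ip q \<le> hnorm ip (h n) + hdist ip (f n) p" for n
    using hnorm_triangle[OF h diff_mem[OF f p], of n n] by (simp add: h_def q_def hdist_def)
  have "(\<lambda>n. sqrt (m + inverse (real (Suc n))) + hdist ip (f n) p) \<longlonglongrightarrow> sqrt (m + 0) + 0"
    by (intro tendsto_intros LIMSEQ_inverse_real_of_nat lim)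
  moreover have "hnorm ip q \<le> sqrt (m + inverse (real (Suc n))) + hdist ip (f n) p" for n
    using gp[of n] real_le_rsqrt[OF less_imp_le[OF hn[of n]]] by linarith
  ultimately have "hnorm ip q \<le> sqrt m" using LIMSEQ_le_const by fastforce
  moreover have "0 \<le> m" unfolding m_def by (rule cInf_greatest[OF \<open>D \<noteq> {}\<close>]) (auto simp: D_def)
  ultimately have qm: "(hnorm ip q)\<^sup>2 \<le> m"
    using power_mono[of "hnorm ip q" "sqrt m" 2] hnorm_nonneg[OF q] by simp
  have min: "m \<le> (hnorm ip (\<lambda>x. q x + t * K x w))\<^sup>2" for t w
  proof -
    have "sqrt m \<le> hnorm ip (\<lambda>x. q x + t * K x w) + hdist ip (f n) p" for n
    proof -
      obtain Z c where Z: "finite Z" "comb Z c = (\<lambda>z. comb (X n) (a n) z + (-t) * comb {w} (\<lambda>_. 1) z)"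
        using comb_add_scale[OF fin, of "{w}"] by blast
      have c: "comb Z c = (\<lambda>z. f n z - t * K z w)" unfolding Z(2) by (simp add: f_def comb_def[of "{w}"])
      have k: "(\<lambda>x. q x + t * K x w) \<in> H" by (intro add_mem scale_mem q kernel_mem)
      have "sqrt m \<le> hdist ip g (comb Z c)"
        using lower[OF Z(1), of c] by (intro real_le_lsqrt) (auto simp: hdist_def hnorm_nonneg diff_mem g comb_mem)
      also have "\<dots> = hnorm ip (\<lambda>x. (q x + t * K x w) + (p x - f n x))"
        unfolding hdist_def c by (rule arg_cong[of _ _ "hnorm ip"]) (auto simp: q_def)
      also have "\<dots> \<le> hnorm ip (\<lambda>x. q x + t * K x w) + hdist ip p (f n)"
        unfolding hdist_def by (rule hnorm_triangle[OF k diff_mem[OF p f]])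
      finally show ?thesis by (simp add: hdist_commute[OF p f])
    qed
    moreover have "(\<lambda>n. hnorm ip (\<lambda>x. q x + t * K x w) + hdist ip (f n) p) \<longlonglongrightarrow> hnorm ip (\<lambda>x. q x + t * K x w) + 0"
      by (intro tendsto_intros lim)
    ultimately have "sqrt m \<le> hnorm ip (\<lambda>x. q x + t * K x w)" using LIMSEQ_le_const by fastforce
    then show ?thesis by (rule sqrt_le_D)
  qed
  have "q w = 0" for w
  proof (rule ccontr)
    assume nz: "q w \<noteq> 0"
    \<comment> \<open>The summand 1 makes \<open>k\<close> positive, and the resulting
      \<open>t\<close> still strictly decreases the norm.\<close>
    define k where "k = (hnorm ip (\<lambda>x. K x w))\<^sup>2 + 1"
    have k: "k > 0" by (simp add: k_def add_nonneg_pos)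
    define t where "t = - q w / of_real k"
    have t: "cnj t * q w = - of_real ((cmod (q w))\<^sup>2 / k)" "(cmod t)\<^sup>2 = (cmod (q w))\<^sup>2 / k\<^sup>2"
      using complex_norm_square[of "q w"] k
      by (simp_all add: t_def norm_divide power_divide mult.commute[of "cnj (q w)"])
    have "m \<le> (hnorm ip q)\<^sup>2 + 2 * Re (cnj t * q w) + (cmod t)\<^sup>2 * (k - 1)"
      using min[of t w] hnorm_add_scale_squared[OF q kernel_mem, of t w] by (simp add: reproduce q k_def)
    then have "0 \<le> 2 * Re (cnj t * q w) + (cmod t)\<^sup>2 * (k - 1)" using qm by linarith
    also have "\<dots> = - (cmod (q w))\<^sup>2 * (1 / k + 1 / k\<^sup>2)"
      unfolding t using k by (simp add: power2_eq_square field_simps)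
    also have "\<dots> < 0" using nz k by (simp add: add_pos_pos)
    finally show False by simp
  qed
  then have "p = g" by (simp add: q_def fun_eq_iff)
  then have "(\<lambda>n. hdist ip g (f n)) \<longlonglongrightarrow> 0" using lim by (simp add: hdist_commute[OF g f])
  then have "\<forall>\<^sub>F n in sequentially. hdist ip g (f n) < \<epsilon>" using \<epsilon> by (rule order_tendstoD(2))
  then obtain n where "hdist ip g (f n) < \<epsilon>" using eventually_happens'[OF sequentially_bot] by blast
  then show ?thesis using fin[of n] by (auto simp: f_def)
qed

text \<open>Approximating \<open>g\<close> itself by a combination within \<open>\<delta>\<close>
  changes both sides of \<open>\<parallel>g\<parallel>\<^sup>2 \<le> M *
  \<parallel>g\<parallel>\<close> by at most \<open>(M + \<parallel>g\<parallel>) * \<delta>\<close>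
  in total, which fixes the choice of \<open>\<delta>\<close>.\<close>

lemma hnorm_le_if_weakly_bounded:
  assumes g: "g \<in> H" and M: "0 \<le> M"
    and le: "\<And>X a. finite X \<Longrightarrow> cmod (ip g (comb X a)) \<le> M * hnorm ip (comb X a)"
  shows "hnorm ip g \<le> M"
proof -
  let ?n = "hnorm ip g"
  have "?n\<^sup>2 \<le> M * ?n + e" if e: "e > 0" for e
  proof -
    define \<delta> where "\<delta> = e / (M + ?n + 1)"
    have pos: "M + ?n + 1 > 0" using M hnorm_nonneg[OF g] by linarith
    then have \<delta>: "\<delta> > 0" using e by (simp add: \<delta>_def)
    obtain X a where X: "finite X" "hdist ip g (comb X a) < \<delta>"
      using kernel_combinations_dense[OF g \<delta>] by blast
    define f where "f = comb X a"
    have f: "f \<in> H" by (simp add: f_def comb_mem)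
    have gf: "hdist ip g f < \<delta>" "hdist ip f g < \<delta>" using X hdist_commute[OF g f] by (simp_all add: f_def)
    have "ip g g = ip g (\<lambda>x. f x + (g x - f x))" by simp
    also have "\<dots> = ip g f + ip g (\<lambda>x. g x - f x)" by (rule ip_add_right[OF f diff_mem[OF g f] g])
    finally have split: "ip g g = ip g f + ip g (\<lambda>x. g x - f x)" .
    have "?n\<^sup>2 = cmod (ip g g)" by (simp add: ip_self[OF g] norm_power)
    also have "\<dots> = cmod (ip g f + ip g (\<lambda>x. g x - f x))" by (simp only: split)
    also have "\<dots> \<le> cmod (ip g f) + cmod (ip g (\<lambda>x. g x - f x))" by (rule norm_triangle_ineq)
    also have "\<dots> \<le> M * hnorm ip f + ?n * hdist ip g f"
      unfolding hdist_def f_def by (intro add_mono le X ip_cauchy_schwarz g diff_mem comb_mem)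
    also have "\<dots> \<le> M * (?n + \<delta>) + ?n * \<delta>"
      using hnorm_le_hdist[OF f g] gf M hnorm_nonneg[OF g] by (intro add_mono mult_left_mono) auto
    also have "\<dots> = M * ?n + (M + ?n) * \<delta>" by (simp add: algebra_simps)
    also have "(M + ?n) * \<delta> \<le> e"
      using pos e M hnorm_nonneg[OF g] by (simp add: \<delta>_def pos_divide_le_eq mult.commute)
    finally show ?thesis by simp
  qed
  then have "?n * ?n \<le> M * ?n" unfolding power2_eq_square by (rule field_le_epsilon)
  then show ?thesis using M hnorm_nonneg[OF g] by (cases "?n = 0") (auto simp: mult_le_cancel_right)
qed

text \<open>Dual to \<open>sum_adjoint_le\<close>: pairing with a combination of kernels moves the
  multipliers to the other side, where Cauchy-Schwarz over \<open>I\<close> applies.\<close>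

lemma finite_row_bound:
  fixes \<phi> :: "nat \<Rightarrow> 'x \<Rightarrow> complex"
  assumes col: "column_bounded H ip \<phi> 1" and mult: "\<And>n. \<phi> n \<in> multipliers H"
    and F: "\<And>n. F n \<in> H" and I: "finite I"
  shows "hnorm ip (\<lambda>x. \<Sum>n\<in>I. \<phi> n x * F n x) \<le> sqrt (\<Sum>n\<in>I. (hnorm ip (F n))\<^sup>2)"
proof (rule hnorm_le_if_weakly_bounded)
  have \<phi>F: "(\<lambda>x. \<phi> n x * F n x) \<in> H" for n using mult F by (auto simp: multipliers_def)
  show "(\<lambda>x. \<Sum>n\<in>I. \<phi> n x * F n x) \<in> H" by (intro sum_mem \<phi>F)
  show "0 \<le> sqrt (\<Sum>n\<in>I. (hnorm ip (F n))\<^sup>2)" by (simp add: sum_nonneg)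
  fix X :: "'x set" and a assume X: "finite X"
  let ?f = "comb X a"
  obtain G where G: "\<And>n. G n \<in> H" and adj: "\<And>n. ip (\<lambda>x. \<phi> n x * F n x) ?f = ip (F n) (G n)"
    and le: "(\<Sum>n\<in>I. (hnorm ip (G n))\<^sup>2) \<le> (hnorm ip ?f)\<^sup>2"
    using sum_adjoint_le[OF col I X, of a] F \<phi>F by blast
  have "cmod (ip (\<lambda>x. \<Sum>n\<in>I. \<phi> n x * F n x) ?f) = cmod (\<Sum>n\<in>I. ip (F n) (G n))"
    by (simp add: ip_sum_left \<phi>F comb_mem adj)
  also have "\<dots> \<le> (\<Sum>n\<in>I. \<bar>hnorm ip (F n)\<bar> * \<bar>hnorm ip (G n)\<bar>)"
    using ip_cauchy_schwarz[OF F G] hnorm_nonneg[OF F] hnorm_nonneg[OF G]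
    by (intro order_trans[OF norm_sum] sum_mono) simp
  also have "\<dots> \<le> L2_set (\<lambda>n. hnorm ip (F n)) I * L2_set (\<lambda>n. hnorm ip (G n)) I"
    by (rule L2_set_mult_ineq)
  also have "\<dots> \<le> sqrt (\<Sum>n\<in>I. (hnorm ip (F n))\<^sup>2) * hnorm ip ?f"
    unfolding L2_set_def using le hnorm_nonneg[OF comb_mem]
    by (intro mult_left_mono) (auto intro!: real_le_lsqrt sum_nonneg)
  finally show "cmod (ip (\<lambda>x. \<Sum>n\<in>I. \<phi> n x * F n x) ?f) \<le> sqrt (\<Sum>n\<in>I. (hnorm ip (F n))\<^sup>2) * hnorm ip ?f" .
qed

text \<open>The finite bound on blocks \<open>{m..<n}\<close> makes the partial sums Cauchy, and on
  initial segments it passes to the limit.\<close>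

lemma row_bounded_if_column_bounded:
  fixes \<phi> :: "nat \<Rightarrow> 'x \<Rightarrow> complex"
  assumes col: "column_bounded H ip \<phi> 1" and mult: "\<And>n. \<phi> n \<in> multipliers H"
  shows "row_bounded H ip \<phi> 1"
  unfolding row_bounded_def
proof
  fix F assume "F \<in> ell2_space H ip"
  then have F: "\<And>n. F n \<in> H" and sm: "summable (\<lambda>n. (hnorm ip (F n))\<^sup>2)"
    by (auto simp: ell2_space_def)
  define S where "S N = (\<lambda>x. \<Sum>n<N. \<phi> n x * F n x)" for N
  have S: "S N \<in> H" for N unfolding S_def using mult F by (intro sum_mem) (auto simp: multipliers_def)
  have "\<exists>g\<in>H. (\<lambda>N. hdist ip (S N) g) \<longlonglongrightarrow> 0"
  proof (rule complete[OF S])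
    fix e :: real assume e: "e > 0"
    obtain N where N: "\<And>m n. m \<ge> N \<Longrightarrow> norm (\<Sum>k=m..<n. (hnorm ip (F k))\<^sup>2) < e\<^sup>2"
      using sm e unfolding summable_Cauchy by (meson zero_less_power)
    have ord: "hdist ip (S n) (S m) < e" if "N \<le> m" "m \<le> n" for m n
    proof -
      have "(\<lambda>x. S n x - S m x) = (\<lambda>x. \<Sum>k=m..<n. \<phi> k x * F k x)"
        using that by (simp add: S_def lessThan_atLeast0 sum_diff_nat_ivl)
      then have "hdist ip (S n) (S m) \<le> sqrt (\<Sum>k=m..<n. (hnorm ip (F k))\<^sup>2)"
        unfolding hdist_def using finite_row_bound[OF col mult F, of "{m..<n}"] by simp
      also have "\<dots> < e" using N[OF that(1), of n] e by (intro real_less_lsqrt) (auto simp: sum_nonneg)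
      finally show ?thesis .
    qed
    have "hdist ip (S m) (S n) < e" if "N \<le> m" "N \<le> n" for m n
      using ord[of m n] ord[of n m] that hdist_commute[OF S S, of m n] by (cases "m \<le> n") auto
    then show "\<exists>N. \<forall>m\<ge>N. \<forall>n\<ge>N. hdist ip (S m) (S n) < e" by blast
  qed
  then obtain g where g: "g \<in> H" and lim: "(\<lambda>N. hdist ip (S N) g) \<longlonglongrightarrow> 0" by blast
  have "hnorm ip g \<le> ell2_norm ip F + hdist ip (S N) g" for N
  proof -
    have "hnorm ip (S N) \<le> sqrt (\<Sum>n<N. (hnorm ip (F n))\<^sup>2)"
      unfolding S_def by (rule finite_row_bound[OF col mult F]) simp
    also have "\<dots> \<le> ell2_norm ip F"
      unfolding ell2_norm_def by (intro real_sqrt_le_mono sum_le_suminf[OF sm]) auto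
    finally show ?thesis using hnorm_le_hdist[OF g S, of N] hdist_commute[OF g S, of N] by linarith
  qed
  moreover have "(\<lambda>N. ell2_norm ip F + hdist ip (S N) g) \<longlonglongrightarrow> ell2_norm ip F + 0"
    by (intro tendsto_intros lim)
  ultimately have "hnorm ip g \<le> 1 * ell2_norm ip F" using LIMSEQ_le_const by fastforce
  moreover have "hsums H ip (\<lambda>n x. \<phi> n x * F n x) g" using g lim by (simp add: hsums_def S_def)
  ultimately show "\<exists>g. hsums H ip (\<lambda>n x. \<phi> n x * F n x) g \<and> hnorm ip g \<le> 1 * ell2_norm ip F" by blast
qed

end

theorem theorem1p2:
  fixes H :: "('x \<Rightarrow> complex) set" and ip :: "'x inner_prod"
  assumes "normalized_complete_pick_space H ip"
  shows "column_row_property H ip 1"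
proof -
  obtain K z0 d and b :: "'x \<Rightarrow> nat \<Rightarrow> complex" where "pick_space H ip K z0 b d"
    using assms unfolding normalized_complete_pick_space_def pick_space_def pick_space_axioms_def by blast
  then show ?thesis
    unfolding column_row_property_def by (auto intro: pick_space.row_bounded_if_column_bounded)
qed

end
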